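(* Let $n\geq 2$, let $\Gamma\subset\mathrm{SU}((n,1),\mathbb{C})$ be a discrete, torsion-free, cocompact subgroup, $X_\Gamma=\Gamma\backslash\mathbb{B}^n$, with injectivity radius $r_X$. Then for $k\geq 2n+2$, \[ \sup_{z\in X_{\Gamma}}\big|\mathcal{B}_\Gamma^k(z)\big|_{\mathrm{pet}}\leq C_{\Gamma,k}+ \frac{C_{\Gamma,k}\cosh^{2n}\big(r_X/ 4\big) }{\big(k-2n-1\big)\sinh^{2n}\big(r_X/ 4\big)} +\frac{C_{\Gamma,k}\sinh^{2n}\big(5r_X/ 8\big)}{\sinh^{2n}\big(r_X/ 4\big)\cosh^{k}\big(3r_X/ 8\big)}. \]
   Context: $\mathbb{B}^n=\{z\in\mathbb{C}^n:|z|^2<1\}$ with hyperbolic metric $\mu_{\mathrm{hyp}}=-2i\partial\overline\partial\log(1-|z|^2)$, volume form $\mu^{\mathrm{vol}}_{\mathrm{hyp}}$, and distance $d_{\mathrm{hyp}}$ with $\cosh^2(d_{\mathrm{hyp}}(z,w)/2)=\frac{|\langle\tilde z,\tilde w\rangle_H|^2}{\langle\tilde z,\tilde z\rangle_H\langle\tilde w,\tilde w\rangle_H}$, $\langle\tilde z,\tilde w\rangle_H=\sum_jz_j\overline{w_j}-1$. $\mathrm{SU}((n,1),\mathbb{C})$ preserves $H=\mathrm{diag}(\mathrm{Id}_n,-1)$ and acts by $\gamma z=(Az+B)/(Cz+D)$, $\gamma=\begin{pmatrix}A&B\\C&D\end{pmatrix}$. $r_X=\inf\{d_{\mathrm{hyp}}(z,\gamma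 z): z\in\mathbb{B}^n,\gamma\in\Gamma\setminus\{\mathrm{Id}\}\}$. $\mathcal{S}_k(\Gamma)$: holomorphic $f$ on $\mathbb{B}^n$ with $f(\gamma z)=(Cz+D)^kf(z)$ ($\gamma\in\Gamma$), Petersson inner product $\int_{\mathcal F}(1-|z|^2)^kf\overline g\,\mu^{\mathrm{vol}}_{\mathrm{hyp}}$. For an orthonormal basis $\{f_j\}$, $\mathcal{B}_\Gamma^k(z,w)=\sum_jf_j(z)\overline{f_j(w)}$ and $|\mathcal{B}_\Gamma^k(z)|_{\mathrm{pet}}=(1-|z|^2)^k|\mathcal{B}_\Gamma^k(z,z)|$. $C_{\Gamma,k}$ denotes the constant (depending on $\Gamma$ and $k$) in the paper's series expression of the Bergman kernel, valid for $k\geq 2n+1$: $\mathcal{B}_\Gamma^k(z,w)=\sum_{\gamma\in\Gamma}\frac{C_{\Gamma,k}}{|\langle z,\gamma w\rangle|^k(Cw+D)^k}$ with $\langle z,w\rangle=1-\sum_jz_j\overline{w_j}$; the paper asserts $C_{\Gamma,k}=O_\Gamma(k^n)$.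
   Formalization: The printed kernel series defining C_{Γ,k} cannot hold for a nonzero kernel (wrong automorphy in w, not holomorphic in z); C_{Γ,k} is instead the nonnegative constant in the corrected series Σ C/(⟨z,γw⟩^k · conj(Cw+D)^k). *)

theory Defs
  imports "HOL-Analysis.Analysis" "HOL-Algebra.Group"
begin

section \<open>The group \<open>SU(n,1)\<close> and its action on the ball\<close>

text \<open>The dimension is \<open>n = CARD('n)\<close>. Matrices of size \<open>n+1\<close> are indexed by \<open>'n option\<close>:
  \<open>Some i\<close> are the first \<open>n\<close> coordinates, \<open>None\<close> is the last one. In block form, \<open>A\<close>, \<open>B\<close>,
  \<open>C\<close>, \<open>D\<close> are the entries indexed by (\<open>Some\<close>, \<open>Some\<close>), (\<open>Some\<close>, \<open>None\<close>), (\<open>None\<close>, \<open>Some\<close>),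
  (\<open>None\<close>, \<open>None\<close>).\<close>

type_synonym 'n cmat1 = "complex ^ ('n option) ^ ('n option)"

definition unit_ball :: "(complex ^ 'n::finite) set" where
  "unit_ball = {z. (norm z)\<^sup>2 < 1}"

definition conj_transpose :: "complex ^ 'm ^ 'm \<Rightarrow> complex ^ 'm ^ 'm" where
  "conj_transpose A = (\<chi> i j. cnj (A $ j $ i))"

definition H_mat :: "('n::finite) cmat1" where
  "H_mat = (\<chi> i j. if i = j then (if i = None then -1 else 1) else 0)"

definition SU_n1 :: "('n::finite) cmat1 monoid" where
  "SU_n1 = \<lparr>carrier = {g. conj_transpose g ** H_mat ** g = H_mat \<and> det g = 1},
            mult = (**), one = mat 1\<rparr>"

definition aut_factor :: "('n::finite) cmat1 \<Rightarrow> complex ^ 'n \<Rightarrow> complex" where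
  "aut_factor g z = (\<Sum>j\<in>UNIV. g $ None $ Some j * z $ j) + g $ None $ None"

definition ball_act :: "('n::finite) cmat1 \<Rightarrow> complex ^ 'n \<Rightarrow> complex ^ 'n" where
  "ball_act g z =
     (\<chi> i. ((\<Sum>j\<in>UNIV. g $ Some i $ Some j * z $ j) + g $ Some i $ None) / aut_factor g z)"

section \<open>The quotient and the conditions on the group\<close>

definition orbit_of :: "('n::finite) cmat1 set \<Rightarrow> complex ^ 'n \<Rightarrow> (complex ^ 'n) set" where
  "orbit_of \<Gamma> z = (\<lambda>g. ball_act g z) ` \<Gamma>"

definition X_quot :: "('n::finite) cmat1 set \<Rightarrow> (complex ^ 'n) set set" where
  "X_quot \<Gamma> = orbit_of \<Gamma> ` unit_ball"

definition X_top :: "('n::finite) cmat1 set \<Rightarrow> (complex ^ 'n) set topology" where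
  "X_top \<Gamma> = topology (\<lambda>U. U \<subseteq> X_quot \<Gamma> \<and> open {z \<in> unit_ball. orbit_of \<Gamma> z \<in> U})"

definition torsion_free :: "('n::finite) cmat1 set \<Rightarrow> bool" where
  "torsion_free \<Gamma> \<longleftrightarrow>
     (\<forall>g\<in>\<Gamma>. \<forall>m::nat. m > 0 \<longrightarrow> g [^]\<^bsub>SU_n1\<^esub> m = \<one>\<^bsub>SU_n1\<^esub> \<longrightarrow> g = \<one>\<^bsub>SU_n1\<^esub>)"

definition cocompact :: "('n::finite) cmat1 set \<Rightarrow> bool" where
  "cocompact \<Gamma> \<longleftrightarrow> compact_space (X_top \<Gamma>)"

section \<open>Hyperbolic distance, injectivity radius and volume\<close>

definition herm_form :: "complex ^ 'n::finite \<Rightarrow> complex ^ 'n \<Rightarrow> complex" where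
  "herm_form z w = (\<Sum>j\<in>UNIV. z $ j * cnj (w $ j)) - 1"

text \<open>The nonnegative solution \<open>d\<close> of \<open>cosh\<^sup>2 (d/2) = \<dots>\<close>; see lemma \<open>cosh_hyp_dist\<close>.\<close>

definition hyp_dist :: "complex ^ 'n::finite \<Rightarrow> complex ^ 'n \<Rightarrow> real" where
  "hyp_dist z w = 2 * arcosh (sqrt ((cmod (herm_form z w))\<^sup>2 /
                     (Re (herm_form z z) * Re (herm_form w w))))"

definition inj_radius :: "('n::finite) cmat1 set \<Rightarrow> real" where
  "inj_radius \<Gamma> = Inf {hyp_dist z (ball_act g z) | z g. z \<in> unit_ball \<and> g \<in> \<Gamma> - {mat 1}}"

definition wirtinger :: "'n::finite \<Rightarrow> (complex ^ 'n \<Rightarrow> complex) \<Rightarrow> complex ^ 'n \<Rightarrow> complex" where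
  "wirtinger j F z = (frechet_derivative F (at z) (axis j 1)
                      - \<i> * frechet_derivative F (at z) (axis j \<i>)) / 2"

definition wirtinger_bar :: "'n::finite \<Rightarrow> (complex ^ 'n \<Rightarrow> complex) \<Rightarrow> complex ^ 'n \<Rightarrow> complex" where
  "wirtinger_bar j F z = (frechet_derivative F (at z) (axis j 1)
                          + \<i> * frechet_derivative F (at z) (axis j \<i>)) / 2"

text \<open>The Hermitian matrix \<open>h\<close> with \<open>-2\<i>\<partial>\<partial>\<close>-bar \<open>log (1 - |z|\<^sup>2) = (\<i>/2) \<Sum> h\<^sub>j\<^sub>k dz\<^sub>j \<and> d(cnj z\<^sub>k)\<close>.
  Since \<open>(\<i>/2) dz \<and> d(cnj z) = dx \<and> dy\<close>, the volume form (the \<open>n\<close>-th exterior power of this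
  (1,1)-form divided by \<open>n!\<close>) is \<open>det h\<close> times Lebesgue measure.\<close>

definition hyp_metric :: "complex ^ 'n::finite \<Rightarrow> complex ^ 'n ^ 'n" where
  "hyp_metric z =
     (\<chi> j k. -4 * wirtinger j (wirtinger_bar k (\<lambda>v. complex_of_real (ln (1 - (norm v)\<^sup>2)))) z)"

definition hyp_vol :: "(complex ^ 'n::finite) measure" where
  "hyp_vol = density lborel (\<lambda>z. indicator unit_ball z * ennreal (Re (det (hyp_metric z))))"

section \<open>Automorphic forms and the Bergman kernel\<close>

definition holomorphic_n :: "(complex ^ 'n::finite \<Rightarrow> complex) \<Rightarrow> (complex ^ 'n) set \<Rightarrow> bool" where
  "holomorphic_n f S \<longleftrightarrow>
     (\<forall>z\<in>S. \<exists>D. (f has_derivative D) (at z) \<and> (\<forall>c v. D (c *s v) = c * D v))"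

text \<open>Functions on the ball are represented by functions vanishing outside it, so that equality
  of functions is equality on the ball.\<close>

definition aut_forms :: "('n::finite) cmat1 set \<Rightarrow> nat \<Rightarrow> (complex ^ 'n \<Rightarrow> complex) set" where
  "aut_forms \<Gamma> k = {f. holomorphic_n f unit_ball \<and>
     (\<forall>g\<in>\<Gamma>. \<forall>z\<in>unit_ball. f (ball_act g z) = aut_factor g z ^ k * f z) \<and>
     (\<forall>z. z \<notin> unit_ball \<longrightarrow> f z = 0)}"

definition fundamental_domain :: "('n::finite) cmat1 set \<Rightarrow> (complex ^ 'n) set \<Rightarrow> bool" where
  "fundamental_domain \<Gamma> F \<longleftrightarrow>
     F \<in> sets borel \<and> F \<subseteq> unit_ball \<and>
     (\<Union>g\<in>\<Gamma>. ball_act g ` F) = unit_ball \<and>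
     (\<forall>g\<in>\<Gamma> - {mat 1}. negligible (F \<inter> ball_act g ` F))"

definition petersson ::
    "(complex ^ 'n::finite) set \<Rightarrow> nat \<Rightarrow> (complex ^ 'n \<Rightarrow> complex) \<Rightarrow> (complex ^ 'n \<Rightarrow> complex) \<Rightarrow> complex" where
  "petersson F k f g =
     (LINT z:F|hyp_vol. complex_of_real ((1 - (norm z)\<^sup>2) ^ k) * f z * cnj (g z))"

text \<open>The space of forms is finite-dimensional because the quotient is compact, hence \<open>finite\<close>.\<close>

definition petersson_onb ::
    "('n::finite) cmat1 set \<Rightarrow> (complex ^ 'n) set \<Rightarrow> nat \<Rightarrow> (complex ^ 'n \<Rightarrow> complex) set \<Rightarrow> bool" where
  "petersson_onb \<Gamma> F k \<B> \<longleftrightarrow>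
     finite \<B> \<and> \<B> \<subseteq> aut_forms \<Gamma> k \<and>
     (\<forall>f\<in>\<B>. \<forall>g\<in>\<B>. petersson F k f g = (if f = g then 1 else 0)) \<and>
     (\<forall>f\<in>aut_forms \<Gamma> k. \<exists>c. f = (\<lambda>z. \<Sum>g\<in>\<B>. c g * g z))"

definition bergman_kernel ::
    "(complex ^ 'n::finite \<Rightarrow> complex) set \<Rightarrow> complex ^ 'n \<Rightarrow> complex ^ 'n \<Rightarrow> complex" where
  "bergman_kernel \<B> z w = (\<Sum>f\<in>\<B>. f z * cnj (f w))"

definition bergman_pet ::
    "(complex ^ 'n::finite \<Rightarrow> complex) set \<Rightarrow> nat \<Rightarrow> complex ^ 'n \<Rightarrow> real" where
  "bergman_pet \<B> k z = (1 - (norm z)\<^sup>2) ^ k * cmod (bergman_kernel \<B> z z)"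

definition ball_pairing :: "complex ^ 'n::finite \<Rightarrow> complex ^ 'n \<Rightarrow> complex" where
  "ball_pairing z w = 1 - (\<Sum>j\<in>UNIV. z $ j * cnj (w $ j))"

text \<open>\<open>C\<close> is the nonnegative constant in the expansion of the Bergman kernel as a series over
  \<open>\<Gamma>\<close>. The kernel is holomorphic in \<open>z\<close>, antiholomorphic in \<open>w\<close>, and transforms in \<open>w\<close> by the
  conjugate of the automorphy factor; this forces the \<open>k\<close>-th power of the pairing itself (not of
  its modulus) and the conjugated factor. The sign condition only matters if there are no
  nonzero forms: then the expansion would hold for every \<open>C\<close>.\<close>

definition bergman_series_const ::
    "('n::finite) cmat1 set \<Rightarrow> nat \<Rightarrow> (complex ^ 'n \<Rightarrow> complex) set \<Rightarrow> real \<Rightarrow> bool" where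
  "bergman_series_const \<Gamma> k \<B> C \<longleftrightarrow> 0 \<le> C \<and>
     (\<forall>z\<in>unit_ball. \<forall>w\<in>unit_ball.
        ((\<lambda>g. complex_of_real C / (ball_pairing z (ball_act g w) ^ k * cnj (aut_factor g w) ^ k))
           has_sum bergman_kernel \<B> z w) \<Gamma>)"

section \<open>Basic facts\<close>


lemma herm_form_self: "herm_form z z = complex_of_real ((norm z)\<^sup>2 - 1)"
  by (simp add: herm_form_def norm_vec_def L2_set_def sum_nonneg complex_norm_square
      del: of_real_power add: of_real_power[symmetric])

lemma cmod_sum_le_norm: "cmod (\<Sum>j\<in>UNIV. z $ j * cnj (w $ j)) \<le> norm z * norm w"
proof -
  have "cmod (\<Sum>j\<in>UNIV. z $ j * cnj (w $ j)) \<le> (\<Sum>j\<in>UNIV. norm (z $ j) * norm (w $ j))"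
    by (rule order_trans[OF norm_sum]) (simp add: norm_mult)
  also have "\<dots> \<le> norm z * norm w"
    using L2_set_mult_ineq[of "\<lambda>j. norm (z $ j)" "\<lambda>j. norm (w $ j)" UNIV]
    by (simp add: norm_vec_def)
  finally show ?thesis .
qed

lemma hyp_ratio_ge_1:
  assumes "z \<in> unit_ball" "w \<in> unit_ball"
  shows "1 \<le> (cmod (herm_form z w))\<^sup>2 / (Re (herm_form z z) * Re (herm_form w w))"
proof -
  define a b where "a = norm z" and "b = norm w"
  have ab: "0 \<le> a" "0 \<le> b" "a < 1" "b < 1" "a\<^sup>2 < 1" "b\<^sup>2 < 1"
    using assms by (auto simp: unit_ball_def a_def b_def abs_square_less_1)
  have "a * b < 1" using ab mult_strict_mono'[of a 1 b 1] by simp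
  moreover have "1 - a * b \<le> cmod (herm_form z w)"
    using norm_triangle_ineq2[of 1 "\<Sum>j\<in>UNIV. z $ j * cnj (w $ j)"] cmod_sum_le_norm[of z w]
    by (simp add: herm_form_def a_def b_def norm_minus_commute)
  ultimately have "(1 - a * b)\<^sup>2 \<le> (cmod (herm_form z w))\<^sup>2"
    by (intro power_mono) auto
  moreover have "(a\<^sup>2 - 1) * (b\<^sup>2 - 1) \<le> (1 - a * b)\<^sup>2"
    using zero_le_power2[of "a - b"] by (simp add: power2_eq_square algebra_simps)
  moreover have "0 < (a\<^sup>2 - 1) * (b\<^sup>2 - 1)" using ab by (simp add: mult_neg_neg)
  ultimately show ?thesis by (simp add: herm_form_self a_def b_def)
qed

lemma cosh_hyp_dist:
  assumes "z \<in> unit_ball" "w \<in> unit_ball"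
  shows "(cosh (hyp_dist z w / 2))\<^sup>2
           = (cmod (herm_form z w))\<^sup>2 / (Re (herm_form z z) * Re (herm_form w w))"
    and "0 \<le> hyp_dist z w"
  using hyp_ratio_ge_1[OF assms]
  by (auto simp: hyp_dist_def cosh_arcosh_real real_sqrt_ge_1_iff arcosh_nonneg_real)

lemma open_unit_ball: "open unit_ball"
  unfolding unit_ball_def by (intro open_Collect_less continuous_intros)

lemma openin_X_top:
  "openin (X_top \<Gamma>) U \<longleftrightarrow> U \<subseteq> X_quot \<Gamma> \<and> open {z \<in> unit_ball. orbit_of \<Gamma> z \<in> U}"
proof -
  have "istopology (\<lambda>U. U \<subseteq> X_quot \<Gamma> \<and> open {z \<in> unit_ball. orbit_of \<Gamma> z \<in> U})"
    unfolding istopology_def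
  proof (intro conjI allI impI; (elim conjE)?)
    fix S T assume "open {z \<in> unit_ball. orbit_of \<Gamma> z \<in> S}" "open {z \<in> unit_ball. orbit_of \<Gamma> z \<in> T}"
    then have "open ({z \<in> unit_ball. orbit_of \<Gamma> z \<in> S} \<inter> {z \<in> unit_ball. orbit_of \<Gamma> z \<in> T})" by blast
    also have "\<dots> = {z \<in> unit_ball. orbit_of \<Gamma> z \<in> S \<inter> T}" by blast
    finally show "open {z \<in> unit_ball. orbit_of \<Gamma> z \<in> S \<inter> T}" .
  next
    fix K assume "\<forall>S\<in>K. S \<subseteq> X_quot \<Gamma> \<and> open {z \<in> unit_ball. orbit_of \<Gamma> z \<in> S}"
    then have "open (\<Union>S\<in>K. {z \<in> unit_ball. orbit_of \<Gamma> z \<in> S})" by blast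
    also have "\<dots> = {z \<in> unit_ball. orbit_of \<Gamma> z \<in> \<Union>K}" by blast
    finally show "open {z \<in> unit_ball. orbit_of \<Gamma> z \<in> \<Union>K}" .
  qed blast+
  then show ?thesis by (simp add: X_top_def topology_inverse')
qed

lemma quotient_map_X_top: "quotient_map (top_of_set unit_ball) (X_top \<Gamma>) (orbit_of \<Gamma>)"
proof -
  have "{z \<in> unit_ball. orbit_of \<Gamma> z \<in> X_quot \<Gamma>} = unit_ball" by (auto simp: X_quot_def)
  then have "topspace (X_top \<Gamma>) = X_quot \<Gamma>"
    unfolding topspace_def openin_X_top using open_unit_ball by auto
  then show ?thesis
    unfolding quotient_map_def openin_X_top
    by (auto simp: X_quot_def openin_open_eq[OF open_unit_ball])
qed

lemma conj_transpose_mult: "conj_transpose (A ** B) = conj_transpose B ** conj_transpose A"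
  by (simp add: conj_transpose_def matrix_matrix_mult_def vec_eq_iff mult.commute)
lemma conj_transpose_twice: "conj_transpose (conj_transpose A) = A"
  by (simp add: conj_transpose_def vec_eq_iff)
lemma conj_transpose_mat_1: "conj_transpose (mat 1) = mat 1"
  by (simp add: conj_transpose_def vec_eq_iff mat_def)
lemma conj_transpose_H: "conj_transpose H_mat = H_mat"
  by (simp add: conj_transpose_def vec_eq_iff H_mat_def)
lemma H_mat_H_mat: "H_mat ** H_mat = mat 1"
proof -
  have "(\<Sum>k\<in>UNIV. H_mat $ i $ k * H_mat $ k $ j) = mat 1 $ i $ j" for i j :: "'a option"
  proof -
    have "(\<Sum>k\<in>UNIV. H_mat $ i $ k * H_mat $ k $ j)
        = (\<Sum>k\<in>UNIV. if k = i then mat 1 $ i $ j else 0 :: complex)"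
      by (rule sum.cong) (auto simp: H_mat_def mat_def)
    then show ?thesis by simp
  qed
  then show ?thesis by (simp add: vec_eq_iff matrix_matrix_mult_def)
qed

lemma group_SU_n1: "group SU_n1"
proof (rule groupI)
  fix x y :: "'a cmat1" assume x: "x \<in> carrier SU_n1" and y: "y \<in> carrier SU_n1"
  have "conj_transpose (x ** y) ** H_mat ** (x ** y)
      = conj_transpose y ** (conj_transpose x ** H_mat ** x) ** y"
    by (simp add: conj_transpose_mult matrix_mul_assoc)
  with x y show "x \<otimes>\<^bsub>SU_n1\<^esub> y \<in> carrier SU_n1" by (simp add: SU_n1_def det_mul)
next
  fix x :: "'a cmat1" assume x: "x \<in> carrier SU_n1"
  define y where "y = H_mat ** conj_transpose x ** H_mat"
  have xx: "conj_transpose x ** H_mat ** x = H_mat" "det x = 1" using x by (auto simp: SU_n1_def)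
  have yx: "y ** x = mat 1"
    using xx(1) by (metis y_def H_mat_H_mat matrix_mul_assoc)
  then have xy: "x ** y = mat 1" by (simp add: matrix_left_right_inverse)
  have "det y = 1" using yx xx(2) by (metis det_I det_mul mult.right_neutral)
  moreover have "conj_transpose y ** H_mat ** y = H_mat"
  proof -
    have "conj_transpose y ** H_mat ** y = H_mat ** x ** (H_mat ** H_mat) ** y"
      by (simp add: y_def conj_transpose_mult conj_transpose_twice conj_transpose_H matrix_mul_assoc)
    also have "\<dots> = H_mat ** (x ** y)" by (simp add: H_mat_H_mat matrix_mul_assoc)
    finally show ?thesis by (simp add: xy)
  qed
  ultimately show "\<exists>y\<in>carrier SU_n1. y \<otimes>\<^bsub>SU_n1\<^esub> x = \<one>\<^bsub>SU_n1\<^esub>"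
    using yx by (auto simp: SU_n1_def)
qed (auto simp: SU_n1_def conj_transpose_mat_1 matrix_mul_assoc)

lemma det_mat_1_plus_rank_1:
  fixes u v :: "complex ^ 'n::finite"
  shows "det (\<chi> i j. (if i = j then 1 else 0) + u $ i * v $ j) = 1 + (\<Sum>i\<in>UNIV. u $ i * v $ i)"
proof -
  define A where "A S = ((\<chi> i. axis i 1 + (if i \<in> S then u $ i else 0) *s v) :: complex ^ 'n ^ 'n)" for S
  have "det (A S) = 1 + (\<Sum>i\<in>S. u $ i * v $ i)" for S
  proof -
    have "finite S" by simp
    then show ?thesis
    proof (induction S)
      case empty
      have "A {} = mat 1" by (simp add: A_def vec_eq_iff mat_def axis_def)
      then show ?case by simp
    next
      case (insert a S)
      define R where "R T = (\<chi> i. if i = a then v else A T $ i)" for T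
      have R: "det (R T) = v $ a" if "finite T" "a \<notin> T" for T using that
      proof (induction T)
        case empty
        have "det (R {}) = (\<Sum>i\<in>UNIV. v $ i * det ((\<chi> j. if j = a then axis i 1 else axis j 1) :: complex ^ 'n ^ 'n))"
        proof -
          have "R {} = (\<chi> j. if j = a then (\<Sum>i\<in>UNIV. v $ i *s axis i 1) else axis j 1)"
            unfolding basis_expansion by (simp add: R_def A_def fun_eq_iff)
          then show ?thesis by (simp add: det_linear_row_sum det_row_mul)
        qed
        also have "\<dots> = (\<Sum>i\<in>UNIV. if i = a then v $ i else 0)"
        proof (rule sum.cong[OF refl])
          fix i
          show "v $ i * det ((\<chi> j. if j = a then axis i 1 else axis j 1) :: complex ^ 'n ^ 'n) = (if i = a then v $ i else 0)"
          proof (cases "i = a")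
            case True
            then have "((\<chi> j. if j = a then axis i 1 else axis j 1) :: complex ^ 'n ^ 'n) = mat 1"
              by (simp add: vec_eq_iff mat_def axis_def)
            with True show ?thesis by simp
          next
            case False
            then have "det ((\<chi> j. if j = a then axis i 1 else axis j 1) :: complex ^ 'n ^ 'n) = 0"
              by (intro det_identical_rows[of i a]) (auto simp: row_def vec_eq_iff)
            with False show ?thesis by simp
          qed
        qed
        finally show ?case by simp
      next
        case (insert b T)
        have "R (insert b T) = (\<chi> k. if k = b then row b (R T) + u $ b *s row a (R T) else row k (R T))"
          using insert by (auto simp: R_def A_def row_def vec_eq_iff)
        moreover have "b \<noteq> a" using insert by auto
        ultimately show ?case using insert by (simp add: det_row_operation)
      qed
      have 1: "A (insert a S) = (\<chi> i. if i = a then axis a 1 + u $ a *s v else A S $ i)"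
        by (auto simp: A_def vec_eq_iff)
      have 2: "(\<chi> i. if i = a then axis a 1 else A S $ i) = A S"
        using insert by (auto simp: A_def vec_eq_iff)
      show ?case unfolding 1 using R[OF insert(1,2)] insert
        by (simp add: det_row_add det_row_mul 2 R_def)
    qed
  qed
  moreover have "A UNIV = (\<chi> i j. (if i = j then 1 else 0) + u $ i * v $ j)"
    by (simp add: A_def axis_def vec_eq_iff)
  ultimately show ?thesis by metis
qed


lemma inner_axis_1: "z \<bullet> axis k 1 = Re (z $ k)" for z :: "complex ^ 'n::finite"
  by (simp add: inner_axis inner_complex_def)
lemma inner_axis_ii: "z \<bullet> axis k \<i> = Im (z $ k)" for z :: "complex ^ 'n::finite"
  by (simp add: inner_axis inner_complex_def)

lemma wirtinger_bar_log:
  assumes "z \<in> unit_ball"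
  shows "wirtinger_bar k (\<lambda>v. complex_of_real (ln (1 - (norm v)\<^sup>2))) z
           = - (z $ k) / complex_of_real (1 - (norm z)\<^sup>2)"
proof -
  have s: "1 - z \<bullet> z > 0" using assms by (simp add: unit_ball_def power2_norm_eq_inner)
  have "((\<lambda>v. complex_of_real (ln (1 - v \<bullet> v))) has_derivative
         (\<lambda>h. complex_of_real (- 2 * (z \<bullet> h) / (1 - z \<bullet> z)))) (at z)"
    using s by (auto intro!: derivative_eq_intros ext simp: inner_commute field_simps)
  then have "frechet_derivative (\<lambda>v. complex_of_real (ln (1 - v \<bullet> v))) (at z)
         = (\<lambda>h. complex_of_real (- 2 * (z \<bullet> h) / (1 - z \<bullet> z)))"
    by (rule frechet_derivative_at[symmetric])
  then show ?thesis
    using s by (simp add: wirtinger_bar_def power2_norm_eq_inner inner_axis_1 inner_axis_ii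
        complex_eq_iff) (simp add: field_simps)
qed

lemma wirtinger_algebra_aux:
  fixes e p q a b :: complex
  shows "-4 * ((- e * p - 2 * a * q - \<i> * (- (\<i> * e) * p - 2 * b * q)) / 2)
    = 4 * (e * p + (a - \<i> * b) * q)"
proof -
  have "\<i> * (- (\<i> * e) * p - 2 * b * q) = e * p - 2 * \<i> * b * q"
    by (simp only: right_diff_distrib mult_minus_left mult_minus_right mult.assoc[symmetric] complex_i_mult_minus i_times_eq_iff) (simp add: mult_ac)
  then show ?thesis by (simp add: diff_divide_distrib add_divide_distrib left_diff_distrib right_diff_distrib mult_ac)
qed

lemma hyp_metric_entry:
  assumes "z \<in> unit_ball"
  shows "hyp_metric z $ j $ k = 4 * ((if j = k then 1 else 0) / complex_of_real (1 - (norm z)\<^sup>2)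
           + cnj (z $ j) * z $ k / (complex_of_real (1 - (norm z)\<^sup>2))\<^sup>2)"
proof -
  let ?L = "\<lambda>v::complex^'n. complex_of_real (ln (1 - (norm v)\<^sup>2))"
  let ?s = "complex_of_real (1 - z \<bullet> z)"
  have s: "1 - z \<bullet> z > 0" using assms by (simp add: unit_ball_def power2_norm_eq_inner)
  then have s0: "?s \<noteq> 0" by (metis of_real_eq_0_iff less_irrefl)
  have "((\<lambda>v. - (v $ k) / complex_of_real (1 - v \<bullet> v)) has_derivative
         (\<lambda>h. - (h $ k) / ?s - z $ k * complex_of_real (2 * (z \<bullet> h)) / ?s\<^sup>2)) (at z)"
  proof -
    have 1: "((\<lambda>v. complex_of_real (1 - v \<bullet> v)) has_derivative
            (\<lambda>h. complex_of_real (- (2 * (z \<bullet> h))))) (at z)"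
      by (auto intro!: derivative_eq_intros ext simp: inner_commute)
    have 2: "((\<lambda>v. - (v $ k)) has_derivative (\<lambda>h. - (h $ k))) (at z)"
      by (intro derivative_intros bounded_linear_imp_has_derivative bounded_linear_vec_nth)
    have e: "(- (h $ k) * ?s - - (z $ k) * complex_of_real (- (2 * (z \<bullet> h)))) / (?s * ?s)
        = - (h $ k) / ?s - z $ k * complex_of_real (2 * (z \<bullet> h)) / ?s\<^sup>2" for h
      using s0 by (simp add: divide_simps power2_eq_square del: of_real_diff)
    show ?thesis
      using has_derivative_divide'[OF 2 1 s0] unfolding e .
  qed
  then have "(wirtinger_bar k ?L has_derivative
         (\<lambda>h. - (h $ k) / ?s - z $ k * complex_of_real (2 * (z \<bullet> h)) / ?s\<^sup>2)) (at z)"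
    by (rule has_derivative_transform_within_open[OF _ open_unit_ball assms])
       (simp add: wirtinger_bar_log[unfolded power2_norm_eq_inner] power2_norm_eq_inner)
  then have F: "frechet_derivative (wirtinger_bar k ?L) (at z)
         = (\<lambda>h. - (h $ k) / ?s - z $ k * complex_of_real (2 * (z \<bullet> h)) / ?s\<^sup>2)"
    by (rule frechet_derivative_at[symmetric])
  have zj: "cnj (z $ j) = complex_of_real (Re (z $ j)) - \<i> * complex_of_real (Im (z $ j))"
    by (simp add: complex_eq_iff)
  have ax: "axis j c $ k = (if j = k then c else 0)" for c :: complex by (auto simp: axis_def)
  define e p q :: complex where "e = (if j = k then 1 else 0)" and "p = 1 / ?s" and "q = z $ k / ?s\<^sup>2"
  have e1: "- (if j = k then 1 else 0) / ?s = - e * p" "(if j = k then 1 else 0) / ?s = e * p"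
    and e2: "- (if j = k then \<i> else 0) / ?s = - (\<i> * e) * p"
    by (simp_all add: e_def p_def)
  have e3: "z $ k * complex_of_real (2 * x) / ?s\<^sup>2 = 2 * complex_of_real x * q"
    and e4: "c * z $ k / ?s\<^sup>2 = c * q" for x c
    by (simp_all add: q_def)
  have G: "hyp_metric z $ j $ k
      = -4 * wirtinger j (wirtinger_bar k ?L) z" by (simp add: hyp_metric_def)
  show ?thesis
    unfolding G wirtinger_def F ax inner_axis_1 inner_axis_ii zj
    unfolding power2_norm_eq_inner e1 e2 e3 e4
    by (rule wirtinger_algebra_aux)
qed

lemma det_hyp_metric:
  fixes z :: "complex ^ 'n::finite"
  assumes "z \<in> unit_ball"
  shows "det (hyp_metric z) = complex_of_real (4 ^ CARD('n) / (1 - (norm z)\<^sup>2) ^ (CARD('n) + 1))"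
proof -
  define s where "s = 1 - (norm z)\<^sup>2"
  have s: "s > 0" using assms by (simp add: unit_ball_def s_def)
  define u where "u = (\<chi> j. cnj (z $ j) / complex_of_real s)"
  have "hyp_metric z = (\<chi> i. (4 / complex_of_real s) *s
          ((\<chi> i j. (if i = j then 1 else 0) + u $ i * z $ j) :: complex ^ 'n ^ 'n) $ i)"
    using s by (simp add: vec_eq_iff hyp_metric_entry[OF assms, folded s_def] u_def
        field_simps power2_eq_square)
  then have "det (hyp_metric z) = (4 / complex_of_real s) ^ CARD('n)
      * (1 + (\<Sum>i\<in>UNIV. u $ i * z $ i))"
    by (simp add: det_rows_mul) (simp add: det_mat_1_plus_rank_1)
  also have "(\<Sum>i\<in>UNIV. u $ i * z $ i) = (\<Sum>i\<in>UNIV. z $ i * cnj (z $ i)) / complex_of_real s"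
    by (simp add: u_def sum_divide_distrib mult.commute)
  also have "(\<Sum>i\<in>UNIV. z $ i * cnj (z $ i)) = complex_of_real (1 - s)"
    using herm_form_self[of z] by (simp add: herm_form_def s_def algebra_simps)
  also have "1 + complex_of_real (1 - s) / complex_of_real s = complex_of_real (1 / s)"
    using s by (simp add: field_simps)
  finally show ?thesis
    by (simp add: s_def[symmetric] power_divide)
qed

end

theory Submission
  imports Defs
begin

text \<open>
  By the series expansion and the identity \<open>\<bar>\<langle>z, \<gamma>z\<rangle>\<bar> \<bar>Cz + D\<bar> = (1 - \<bar>z\<bar>\<^sup>2) cosh (d(z, \<gamma>z)/2)\<close> it
  suffices to bound \<open>\<Sum>\<^sub>\<gamma> cosh\<^sup>-\<^sup>k (d(z, \<gamma>z)/2)\<close>, where the points of the orbit of \<open>z\<close> have mutual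
  distance at least \<open>r\<close>. The function \<open>w \<mapsto> cosh\<^sup>-\<^sup>k (d(z, w)/2)\<close> satisfies a sub-mean-value
  inequality relative to the weight \<open>cosh\<^sup>-\<^sup>k (d(p, w)/2)\<close> centred at any \<open>p\<close>. Averaging over the disjoint
  balls of radius \<open>r/2\<close> about the orbit therefore bounds the sum by a quotient of two incomplete beta
  integrals, which an elementary argument compares with the first two terms of the claim. For
  \<open>n = 2\<close> and \<open>k = 7, 8\<close> this fails for small \<open>r\<close>; there the balls are replaced by Blichfeldt's
  overlapping weights \<open>1 - 2 tanh\<^sup>2 (d/2) / tanh\<^sup>2 (r/2)\<close>, and for the remaining \<open>r\<close> the third term of the
  claim makes up the difference.

  Integration takes place in \<open>\<complex>\<^sup>n\<^sup>,\<^sup>1\<close> over the shell \<open>1 < -\<langle>v, v\<rangle> < 2\<close>: there \<open>U(n,1)\<close> acts by linear maps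
  of determinant of modulus 1, so no Jacobian of the action on the ball is needed. That \<open>r\<close> is
  positive follows from cocompactness, discreteness and the absence of torsion.
\<close>

section \<open>Linear maps preserving Lebesgue measure\<close>

text \<open>Put a = r/4, s = tanh^2 a and l = k - 2n - 2. The first two terms of the claim are then
  1 + 1/((l + 1) s^n). The disjoint balls bound the orbit sum by \<beta>/J, where \<beta> = n B(l/2
  + 1, n) is a beta value and J behaves like s^n as s tends to 0. For small r the comparison
  therefore amounts to (l + 1) \<beta> \<le> 1. For n = 2 the left side is 8 (l + 1) / ((l + 2) (l +
  4)): it equals 16/15 for l = 1, and exactly 1 for l = 2, where the next order in s has the wrong
  sign. The third term of the claim cannot repair this: it tends to (5/2)^4 but enters multiplied by
  J, which is of order s^2. Blichfeldt's weights can, since in real dimension 4 they gain a factor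
  that tends to 4/3 as s tends to 0, and 4/3 exceeds 16/15.\<close>

lemma lborel_distr_basis_bij:
  fixes \<phi> :: "'a::euclidean_space \<Rightarrow> 'b::euclidean_space"
  assumes l: "linear \<phi>" and b: "bij_betw \<phi> Basis Basis"
  shows "distr lborel borel \<phi> = lborel"
proof (rule lborel_eqI[symmetric])
  have bm: "\<phi> \<in> borel_measurable borel"
    using l by (auto intro!: borel_measurable_continuous_onI linear_continuous_on
        simp: linear_conv_bounded_linear)
  have \<phi>B: "\<phi> i \<in> Basis" if "i \<in> Basis" for i using b that by (auto simp: bij_betw_def)
  have in\<phi>: "\<phi> x \<bullet> \<phi> i = x \<bullet> i" if "i \<in> Basis" for x i
  proof -
    have "\<phi> x = \<phi> (\<Sum>j\<in>Basis. (x \<bullet> j) *\<^sub>R j)" by (simp add: euclidean_representation)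
    also have "\<dots> = (\<Sum>j\<in>Basis. (x \<bullet> j) *\<^sub>R \<phi> j)" by (simp add: linear_sum[OF l] linear_cmul[OF l])
    finally have "\<phi> x \<bullet> \<phi> i = (\<Sum>j\<in>Basis. (x \<bullet> j) * (\<phi> j \<bullet> \<phi> i))" by (simp add: inner_sum_left)
    also have "\<dots> = (\<Sum>j\<in>Basis. if j = i then x \<bullet> j else 0)"
      using b that by (intro sum.cong refl) (auto simp: inner_Basis \<phi>B bij_betw_def dest: inj_onD)
    finally show ?thesis using that by simp
  qed
  have all: "(\<forall>c\<in>Basis. P c) \<longleftrightarrow> (\<forall>i\<in>Basis. P (\<phi> i))" for P
    using b unfolding bij_betw_def by (metis image_iff)
  fix l u :: 'b assume lu: "\<And>b. b \<in> Basis \<Longrightarrow> l \<bullet> b \<le> u \<bullet> b"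
  define \<psi> where "\<psi> y = (\<Sum>i\<in>Basis. (y \<bullet> \<phi> i) *\<^sub>R i)" for y
  have \<psi>: "\<psi> y \<bullet> i = y \<bullet> \<phi> i" if "i \<in> Basis" for y i
    using that by (simp add: \<psi>_def inner_sum_left inner_Basis if_distrib cong: if_cong)
  have "\<phi> -` box l u = box (\<psi> l) (\<psi> u)"
    unfolding box_def all by (auto simp: in\<phi> \<psi>)
  then have "emeasure (distr lborel borel \<phi>) (box l u) = emeasure lborel (box (\<psi> l) (\<psi> u))"
    using bm by (simp add: emeasure_distr)
  also have "\<dots> = (\<Prod>i\<in>Basis. (\<psi> u - \<psi> l) \<bullet> i)"
    by (rule emeasure_lborel_box) (use lu \<phi>B in \<open>auto simp: \<psi>\<close>)
  also have "(\<Prod>i\<in>Basis. (\<psi> u - \<psi> l) \<bullet> i) = (\<Prod>i\<in>Basis. (u - l) \<bullet> \<phi> i)"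
    by (simp add: inner_diff_left \<psi>)
  also have "\<dots> = (\<Prod>c\<in>Basis. (u - l) \<bullet> c)" by (rule prod.reindex_bij_betw[OF b])
  finally show "emeasure (distr lborel borel \<phi>) (box l u) = (\<Prod>c\<in>Basis. (u - l) \<bullet> c)" .
qed simp

text \<open>The preimage of a box is its image under the inverse map, whose determinant also has
  modulus 1, so \<open>measure_linear_image\<close> applies.\<close>

lemma lborel_distr_linear_det:
  fixes f :: "real ^ 'i::{finite,wellorder} \<Rightarrow> real ^ 'i::_"
  assumes f: "linear f" and d: "\<bar>det (matrix f)\<bar> = 1"
  shows "distr lborel borel f = lborel"
proof (rule lborel_eqI[symmetric])
  have "det (matrix f) \<noteq> 0" using d by force
  then have "invertible (matrix f)" by (simp add: invertible_det_nz)
  then obtain M where M: "matrix f ** M = mat 1" "M ** matrix f = mat 1"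
    unfolding invertible_def by blast
  define g where "g = (\<lambda>x. M *v x)"
  have g: "linear g" by (simp add: g_def matrix_vector_mul_linear)
  have fM: "f x = matrix f *v x" for x using f by (simp add: matrix_works)
  have fg: "f (g x) = x" "g (f x) = x" for x
    using fM[of "g x"] fM[of x] by (simp_all add: g_def matrix_vector_mul_assoc M)
  have "det (matrix f) * det M = 1" using M(1) by (metis det_I det_mul)
  then have dM: "\<bar>det M\<bar> = 1" using d by (metis abs_mult abs_one mult_1)
  have mg: "matrix g = M" by (simp add: g_def matrix_of_matrix_vector_mul)
  have bf: "f \<in> borel_measurable borel"
    using f by (intro borel_measurable_continuous_onI linear_continuous_on)
      (simp add: linear_conv_bounded_linear)
  fix l u :: "real ^ 'i::_" assume lu: "\<And>b. b \<in> Basis \<Longrightarrow> l \<bullet> b \<le> u \<bullet> b"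
  have vi: "f -` box l u = g ` box l u"
    using fg by (auto simp: image_iff) metis+
  have bm: "g ` box l u \<in> sets borel"
    unfolding vi[symmetric] using measurable_sets[OF bf, of "box l u"] by simp
  have lm: "box l u \<in> lmeasurable" by simp
  have "emeasure (distr lborel borel f) (box l u) = emeasure lborel (g ` box l u)"
    using bf by (simp add: emeasure_distr vi)
  also have "\<dots> = emeasure lebesgue (g ` box l u)"
    using bm by simp
  also have "\<dots> = ennreal (measure lebesgue (g ` box l u))"
    using measurable_linear_image[OF g lm] by (simp add: emeasure_eq_measure2)
  also have "\<dots> = ennreal (measure lebesgue (box l u))"
    using measure_linear_image[OF g lm] by (simp add: mg dM)
  also have "\<dots> = (\<Prod>b\<in>Basis. (u - l) \<bullet> b)"
    using lu by (simp add: measure_lborel_box_eq)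
  finally show "emeasure (distr lborel borel f) (box l u) = (\<Prod>b\<in>Basis. (u - l) \<bullet> b)" .
qed simp

text \<open>An index type with as many elements as the dimension, made an instance of
  \<open>wellorder\<close> and \<open>finite\<close> because the determinant formula
  \<open>measure_linear_image\<close> concerns \<open>real ^ 'i\<close> with such an index type. It
  lets a map on an arbitrary Euclidean space be written as a square matrix.\<close>

typedef (overloaded) ('a::euclidean_space) basis_index = "{..<DIM('a)}"
  morphisms index_nat nat_index
  by (auto intro!: exI[of _ 0])

instantiation basis_index :: (euclidean_space) wellorder
begin
definition "x \<le> y \<longleftrightarrow> index_nat x \<le> index_nat y"
definition "x < y \<longleftrightarrow> index_nat x < index_nat y"
instance
proof
  fix P :: "'a basis_index \<Rightarrow> bool" and a assume *: "\<And>x. (\<And>y. y < x \<Longrightarrow> P y) \<Longrightarrow> P x"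
  show "P a"
    by (induction a rule: measure_induct_rule[of index_nat])
      (rule *, simp add: less_basis_index_def)
qed (auto simp: less_eq_basis_index_def less_basis_index_def index_nat_inject)
end

lemma bij_index_nat: "bij_betw index_nat (UNIV :: 'a::euclidean_space basis_index set) {..<DIM('a)}"
  using type_definition.Rep_range[OF type_definition_basis_index]
  by (auto simp: bij_betw_def inj_on_def index_nat_inject)

instance basis_index :: (euclidean_space) finite
  by standard (use bij_betw_finite[OF bij_index_nat] in auto)

text \<open>In coordinates the invariance says \<open>M\<^sup>T J M = J\<close>, which forces \<open>\<bar>det M\<bar> = 1\<close>.\<close>

lemma lborel_distr_linear_isometry:
  fixes f J :: "'a::euclidean_space \<Rightarrow> 'a"
  assumes f: "linear f" and J: "linear J" and JJ: "\<And>x. J (J x) = x"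
    and inv: "\<And>x y. f x \<bullet> J (f y) = x \<bullet> J y"
  shows "distr lborel borel f = lborel"
proof -
  have "\<exists>e. bij_betw e (UNIV :: 'a basis_index set) (Basis :: 'a set)"
    using bij_betw_trans[OF bij_index_nat] ex_bij_betw_nat_finite[of "Basis :: 'a set"]
    by (metis atLeast0LessThan finite_Basis)
  then obtain e where e: "bij_betw e (UNIV :: 'a basis_index set) (Basis :: 'a set)" by blast
  have eB: "e i \<in> Basis" for i using e by (auto simp: bij_betw_def)
  have ee: "e i \<bullet> e j = (if i = j then 1 else 0)" for i j
    using e eB by (auto simp: inner_Basis bij_betw_def inj_on_def)
  define \<phi> :: "real ^ 'a basis_index \<Rightarrow> 'a" where "\<phi> x = (\<Sum>i\<in>UNIV. x $ i *\<^sub>R e i)" for x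
  define \<psi> :: "'a \<Rightarrow> real ^ 'a basis_index" where "\<psi> x = (\<chi> i. x \<bullet> e i)" for x
  have \<phi>l: "linear \<phi>"
    by (auto simp: \<phi>_def linear_iff scaleR_add_left sum.distrib scaleR_sum_right)
  have \<psi>l: "linear \<psi>"
    by (auto simp: \<psi>_def linear_iff vec_eq_iff inner_add_left)
  have \<phi>e: "\<phi> x \<bullet> e i = x $ i" for x i
    by (simp add: \<phi>_def inner_sum_left ee if_distrib cong: if_cong)
  have \<psi>\<phi>: "\<psi> (\<phi> x) = x" for x by (simp add: \<psi>_def \<phi>e vec_eq_iff)
  have \<phi>\<psi>: "\<phi> (\<psi> x) = x" for x
  proof -
    have "\<phi> (\<psi> x) = (\<Sum>i\<in>UNIV. (x \<bullet> e i) *\<^sub>R e i)" by (simp add: \<phi>_def \<psi>_def)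
    also have "\<dots> = (\<Sum>b\<in>Basis. (x \<bullet> b) *\<^sub>R b)"
      by (rule sum.reindex_bij_betw[OF e])
    finally show ?thesis by (simp add: euclidean_representation)
  qed
  have in\<phi>: "x \<bullet> y = \<phi> x \<bullet> \<phi> y" for x y
  proof -
    have "\<phi> x \<bullet> \<phi> y = (\<Sum>i\<in>UNIV. \<phi> x \<bullet> e i * y $ i)"
      by (subst (2) \<phi>_def) (simp add: inner_sum_right mult.commute)
    then show ?thesis by (simp add: \<phi>e inner_vec_def)
  qed
  have bmf: "f \<in> borel_measurable borel" and bm\<phi>: "\<phi> \<in> borel_measurable borel"
    using f \<phi>l by (auto intro!: borel_measurable_continuous_onI linear_continuous_on
        simp: linear_conv_bounded_linear)
  define F where "F = \<psi> \<circ> f \<circ> \<phi>"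
  define K where "K = \<psi> \<circ> J \<circ> \<phi>"
  have Fl: "linear F" and Kl: "linear K"
    by (auto simp: F_def K_def intro!: linear_compose \<phi>l \<psi>l f J)
  have bmF: "F \<in> borel_measurable borel"
    using Fl by (auto intro!: borel_measurable_continuous_onI linear_continuous_on
        simp: linear_conv_bounded_linear)
  have "K \<circ> K = id" by (auto simp: K_def \<phi>\<psi> \<psi>\<phi> JJ)
  then have "matrix K ** matrix K = mat 1"
    by (metis Kl matrix_compose matrix_id_mat_1)
  then have dK: "det (matrix K) \<noteq> 0" by (metis det_I det_mul mult_zero_left zero_neq_one)
  have FK: "F x \<bullet> K (F y) = x \<bullet> K y" for x y
    unfolding in\<phi> F_def K_def by (simp add: \<phi>\<psi> inv)
  have "x \<bullet> ((transpose (matrix F) ** matrix K ** matrix F) *v y) = x \<bullet> (matrix K *v y)" for x y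
  proof -
    have "x \<bullet> ((transpose (matrix F) ** matrix K ** matrix F) *v y)
        = x \<bullet> (transpose (matrix F) *v (matrix K *v (matrix F *v y)))"
      by (simp add: matrix_vector_mul_assoc matrix_mul_assoc)
    also have "\<dots> = (matrix F *v x) \<bullet> (matrix K *v (matrix F *v y))"
      by (metis dot_lmul_matrix transpose_matrix_vector transpose_transpose)
    also have "\<dots> = F x \<bullet> K (F y)" using Fl Kl by (simp add: matrix_works)
    finally show ?thesis using Kl by (simp add: FK matrix_works)
  qed
  then have "(transpose (matrix F) ** matrix K ** matrix F) *v y = matrix K *v y" for y
    by (metis vector_eq_ldot)
  then have "transpose (matrix F) ** matrix K ** matrix F = matrix K" 
    by (metis matrix_eq)
  then have "det (matrix F) * det (matrix K) * det (matrix F) = det (matrix K)"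
    by (metis det_mul det_transpose)
  then have "(det (matrix F))\<^sup>2 = 1" using dK by (simp add: power2_eq_square)
  then have "\<bar>det (matrix F)\<bar> = 1" by (auto simp: power2_eq_1_iff)
  then have D: "distr lborel borel F = lborel" by (rule lborel_distr_linear_det[OF Fl])
  have E: "distr lborel borel \<phi> = (lborel :: 'a measure)"
  proof (rule lborel_distr_basis_bij[OF \<phi>l])
    have ax: "bij_betw (\<lambda>i::'a basis_index. axis i (1::real)) UNIV Basis"
      by (auto simp: bij_betw_def inj_on_def axis_eq_axis Basis_vec_def)
    have "\<phi> (axis i 1) = e i" for i
      by (simp add: \<phi>_def axis_def if_distrib[of "\<lambda>c. c *\<^sub>R _"] cong: if_cong)
    then have "\<phi> \<circ> (\<lambda>i. axis i 1) = e" by auto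
    then show "bij_betw \<phi> Basis Basis" using bij_betw_comp_iff[OF ax, of \<phi> Basis] e by simp
  qed
  have "distr lborel borel f = distr (distr lborel borel \<phi>) borel f" by (simp add: E)
  also have "\<dots> = distr lborel borel (f \<circ> \<phi>)"
    using bmf bm\<phi> by (simp add: distr_distr)
  also have "f \<circ> \<phi> = \<phi> \<circ> F" by (auto simp: F_def \<phi>\<psi>)
  also have "distr lborel borel (\<phi> \<circ> F) = distr (distr lborel borel F) borel \<phi>"
    using bm\<phi> bmF by (simp add: distr_distr)
  finally show ?thesis by (simp add: D E)
qed

section \<open>The Hermitian form and its unitary group\<close>

definition hform :: "complex ^ ('n::finite option) \<Rightarrow> complex ^ ('n option) \<Rightarrow> complex" where
  "hform v w = (\<Sum>j\<in>UNIV. v $ Some j * cnj (w $ Some j)) - v $ None * cnj (w $ None)"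

text \<open>Minus the Hermitian form on the diagonal, so that the lines representing points of the
  ball are those on which \<open>qform\<close> is positive.\<close>

definition qform :: "complex ^ ('n::finite option) \<Rightarrow> real" where
  "qform v = (cmod (v $ None))\<^sup>2 - (\<Sum>j\<in>UNIV. (cmod (v $ Some j))\<^sup>2)"

text \<open>The determinant is left free because the proof uses phases of one coordinate and complex
  reflections, which do not lie in \<open>SU_n1\<close> in general.\<close>

definition U_n1 :: "('n::finite) cmat1 set" where
  "U_n1 = {g. conj_transpose g ** H_mat ** g = H_mat}"

lemma sum_option: "(\<Sum>i\<in>UNIV. f i) = f None + (\<Sum>j\<in>UNIV. f (Some j))"
  for f :: "'n::finite option \<Rightarrow> 'a::comm_monoid_add"
proof -
  have "(\<Sum>i\<in>range Some. f i) = (\<Sum>j\<in>UNIV. f (Some j))"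
    by (subst sum.reindex) (auto simp: inj_on_def)
  then show ?thesis by (simp add: UNIV_option_conv)
qed

lemma hform_smult_left: "hform (c *s v) w = c * hform v w"
  by (simp add: hform_def algebra_simps sum_distrib_left)

lemma cnj_hform: "cnj (hform v w) = hform w v"
  by (simp add: hform_def mult.commute)

lemma hform_smult_right: "hform w (c *s v) = cnj c * hform w v"
  by (simp add: hform_def algebra_simps sum_distrib_left)

lemma hform_diff_left: "hform (u - v) w = hform u w - hform v w"
  by (simp add: hform_def algebra_simps sum_subtractf)

lemma hform_diff_right: "hform w (u - v) = hform w u - hform w v"
  by (simp add: hform_def algebra_simps sum_subtractf)

lemma cmod_hform_commute: "cmod (hform v w) = cmod (hform w v)"
  by (metis cnj_hform complex_mod_cnj)

lemma hform_self: "hform v v = - complex_of_real (qform v)"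
  by (simp add: hform_def qform_def complex_norm_square[symmetric] flip: of_real_power)

lemma hform_axis: "hform v (axis None 1) = - v $ None"
  by (simp add: hform_def axis_def)

lemma hform_H: "hform v w = (\<Sum>i\<in>UNIV. (H_mat *v v) $ i * cnj (w $ i))"
proof -
  have "(H_mat *v v) $ i = (if i = None then - v $ i else v $ i)" for i
    by (simp add: matrix_vector_mult_def H_mat_def if_distrib[of "\<lambda>x. x * _"] cong: if_cong)
  then show ?thesis by (simp add: sum_option hform_def)
qed

lemma hform_mult:
  "hform (g *v v) (g *v w) = (\<Sum>j\<in>UNIV. ((conj_transpose g ** H_mat ** g) *v v) $ j * cnj (w $ j))"
proof -
  define x where "x = H_mat *v (g *v v)"
  have "hform (g *v v) (g *v w) = (\<Sum>i\<in>UNIV. x $ i * (\<Sum>j\<in>UNIV. cnj (g $ i $ j) * cnj (w $ j)))"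
    unfolding hform_H x_def by (simp add: matrix_vector_mult_def)
  also have "\<dots> = (\<Sum>j\<in>UNIV. (\<Sum>i\<in>UNIV. cnj (g $ i $ j) * x $ i) * cnj (w $ j))"
    unfolding sum_distrib_left sum_distrib_right by (subst sum.swap) (simp add: mult_ac)
  also have "\<dots> = (\<Sum>j\<in>UNIV. (conj_transpose g *v x) $ j * cnj (w $ j))"
    by (simp add: matrix_vector_mult_def conj_transpose_def)
  also have "conj_transpose g *v x = (conj_transpose g ** H_mat ** g) *v v"
    by (simp add: x_def matrix_vector_mul_assoc matrix_mul_assoc)
  finally show ?thesis .
qed

lemma hform_U_n1: "g \<in> U_n1 \<Longrightarrow> hform (g *v v) (g *v w) = hform v w"
  by (simp only: hform_mult) (simp add: U_n1_def hform_H)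

lemma qform_U_n1: "g \<in> U_n1 \<Longrightarrow> qform (g *v v) = qform v"
  using hform_U_n1[of g v v] by (simp add: hform_self)

lemma U_n1_I:
  fixes g :: "('n::finite) cmat1"
  assumes "\<And>v w. hform (g *v v) (g *v w) = hform v w"
  shows "g \<in> U_n1"
proof -
  have "(\<Sum>j\<in>UNIV. ((conj_transpose g ** H_mat ** g) *v v) $ j * cnj (w $ j))
      = (\<Sum>j\<in>UNIV. (H_mat *v v) $ j * cnj (w $ j))" for v w
    using assms[of v w, unfolded hform_mult] by (simp only: hform_H)
  from this[of _ "axis i 1" for i]
  have "((conj_transpose g ** H_mat ** g) *v v) $ i = (H_mat *v v) $ i" for v i
    by (simp add: axis_def if_distrib cong: if_cong)
  then have "(conj_transpose g ** H_mat ** g) *v v = H_mat *v v" for v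
    by (simp add: vec_eq_iff)
  then show ?thesis by (simp add: U_n1_def matrix_eq)
qed

lemma U_n1_mult: "g \<in> U_n1 \<Longrightarrow> g' \<in> U_n1 \<Longrightarrow> g ** g' \<in> U_n1"
  by (rule U_n1_I) (simp add: hform_U_n1 flip: matrix_vector_mul_assoc)

lemma U_n1_inverse:
  assumes "g \<in> U_n1"
  obtains g' where "g' \<in> U_n1" "g' ** g = mat 1" "g ** g' = mat 1"
    "g' = H_mat ** conj_transpose g ** H_mat"
proof -
  define g' where "g' = H_mat ** conj_transpose g ** H_mat"
  have 1: "g' ** g = mat 1"
  proof -
    have "g' ** g = H_mat ** (conj_transpose g ** H_mat ** g)"
      by (simp add: g'_def matrix_mul_assoc)
    then show ?thesis using assms by (simp add: U_n1_def H_mat_H_mat)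
  qed
  then have 2: "g ** g' = mat 1" by (simp add: matrix_left_right_inverse)
  have "g' \<in> U_n1"
  proof (rule U_n1_I)
    fix v w
    have "hform (g' *v v) (g' *v w) = hform (g *v (g' *v v)) (g *v (g' *v w))"
      by (simp add: hform_U_n1[OF assms])
    then show "hform (g' *v v) (g' *v w) = hform v w"
      by (simp add: matrix_vector_mul_assoc 2)
  qed
  with 1 2 that g'_def show ?thesis by blast
qed

lemma linear_complex_matrix: "linear ((*v) A)" for A :: "complex ^ 'a ^ 'b"
  by (auto simp: linear_iff vec_eq_iff matrix_vector_mult_def scaleR_sum_right distrib_left
      sum.distrib)

lemma continuous_on_complex_matrix: "continuous_on UNIV ((*v) A)" for A :: "complex ^ 'a ^ 'b"
  by (simp add: linear_continuous_on linear_complex_matrix flip: linear_conv_bounded_linear)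

lemma measurable_complex_matrix [measurable]: "(*v) A \<in> borel_measurable borel"
  for A :: "complex ^ 'a ^ 'b"
  by (rule borel_measurable_continuous_onI[OF continuous_on_complex_matrix])

text \<open>The real part of the Hermitian form is the real inner product twisted by
  \<open>H_mat\<close>, so \<open>H_mat\<close> serves as the involution J of
  \<open>lborel_distr_linear_isometry\<close>.\<close>

lemma lborel_distr_U_n1:
  assumes "g \<in> U_n1"
  shows "distr lborel borel ((*v) g) = lborel"
proof (rule lborel_distr_linear_isometry)
  have in_h: "v \<bullet> (H_mat *v w) = Re (hform w v)" for v w :: "complex ^ ('n::finite option)"
    by (simp add: hform_H inner_vec_def inner_complex_def) (simp add: mult.commute)
  show "(g *v x) \<bullet> (H_mat *v (g *v y)) = x \<bullet> (H_mat *v y)" for x y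
    by (simp add: in_h hform_U_n1[OF assms])
qed (simp_all add: linear_complex_matrix matrix_vector_mul_assoc H_mat_H_mat)

lemma nn_integral_U_n1:
  assumes "g \<in> U_n1" "\<phi> \<in> borel_measurable borel"
  shows "(\<integral>\<^sup>+v. \<phi> (g *v v) \<partial>lborel) = (\<integral>\<^sup>+v. \<phi> v \<partial>lborel)"
proof -
  have "(\<integral>\<^sup>+v. \<phi> v \<partial>lborel) = (\<integral>\<^sup>+v. \<phi> v \<partial>(distr lborel borel ((*v) g)))"
    by (simp add: lborel_distr_U_n1[OF assms(1)])
  also have "\<dots> = (\<integral>\<^sup>+v. \<phi> (g *v v) \<partial>lborel)"
    using assms(2) by (intro nn_integral_distr) auto
  finally show ?thesis by simp
qed

text \<open>For \<omega> of modulus 1 it acts on the ball as the rotation by the inverse of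
  \<omega>. It supplies the substitutions over which \<open>cone_mean_value\<close>
  averages.\<close>

definition phase_mat :: "complex \<Rightarrow> ('n::finite) cmat1" where
  "phase_mat \<omega> = (\<chi> i j. if i = j then (if i = None then \<omega> else 1) else 0)"

lemma phase_mat_mult: "(phase_mat \<omega> *v v) $ i = (if i = None then \<omega> * v $ i else v $ i)"
  by (simp add: matrix_vector_mult_def phase_mat_def if_distrib[of "\<lambda>x. x * _"] cong: if_cong)

lemma phase_mat_U_n1: "cmod \<omega> = 1 \<Longrightarrow> phase_mat \<omega> \<in> U_n1"
  using complex_norm_square[of \<omega>] by (intro U_n1_I) (simp add: hform_def phase_mat_mult)

text \<open>A complex reflection exchanges the base vector with \<open>p\<close> once the last entry of \<open>p\<close> has been
  made positive by a phase.\<close>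

lemma U_n1_transitive:
  fixes p :: "complex ^ ('n::finite option)"
  assumes "qform p = 1"
  obtains g where "g \<in> U_n1" "g *v axis None 1 = p"
proof -
  have a1: "(cmod (p $ None))\<^sup>2 = 1 + (\<Sum>j\<in>UNIV. (cmod (p $ Some j))\<^sup>2)"
    using assms by (simp add: qform_def)
  then have "(cmod (p $ None))\<^sup>2 \<ge> 1" by (simp add: sum_nonneg)
  define a where "a = cmod (p $ None)"
  have "a \<ge> 1" using \<open>(cmod (p $ None))\<^sup>2 \<ge> 1\<close> by (simp add: a_def power2_nonneg_ge_1_iff) 
  define \<omega> where "\<omega> = p $ None / a"
  have \<omega>: "cmod \<omega> = 1" using \<open>a \<ge> 1\<close> by (auto simp: \<omega>_def a_def norm_divide)
  then have \<omega>\<omega>: "\<omega> * cnj \<omega> = 1" using complex_norm_square[of \<omega>] by simp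
  define p' where "p' = cnj \<omega> *s p"
  have p'p: "\<omega> *s p' = p" by (simp add: p'_def vec_eq_iff \<omega>\<omega> flip: mult.assoc)
  have p'N: "p' $ None = complex_of_real a"
  proof -
    have "p' $ None = (p $ None * cnj (p $ None)) / a" by (simp add: p'_def \<omega>_def)
    also have "\<dots> = complex_of_real (a\<^sup>2) / a" by (simp only: complex_norm_square a_def)
    finally show ?thesis using \<open>a \<ge> 1\<close> by (simp add: power2_eq_square)
  qed
  have hp: "hform p' p' = -1"
    unfolding p'_def hform_smult_left hform_smult_right
    using \<omega>\<omega> by (simp add: hform_self assms mult.commute)
  have "\<exists>R\<in>U_n1. R *v axis None 1 = p'"
  \<comment> \<open>Write e for the base vector and v = p' - e. Then <v, v> = 2a - 2 and <e, v> = 1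
    - a, which is -<v, v>/2; hence the reflection along v sends e to e + v = p'. It needs a to
    differ from 1, and for a = 1 the vectors p' and e coincide.\<close>
  proof (cases "a = 1")
    case True
    then have "(\<Sum>j\<in>UNIV. (cmod (p $ Some j))\<^sup>2) = 0" using a1 by (simp add: a_def)
    then have "p $ Some j = 0" for j by (simp add: sum_nonneg_eq_0_iff)
    then have "p' $ i = axis None 1 $ i" for i
      using p'N True by (cases i) (auto simp: axis_def p'_def)
    then have "p' = axis None 1" by (simp add: vec_eq_iff)
    moreover have "mat 1 \<in> U_n1" by (rule U_n1_I) simp
    ultimately show ?thesis by (metis matrix_vector_mul_lid)
  next
    case False
    define v where "v = p' - axis None 1"
    define c where "c = complex_of_real (2 * a - 2)"
    have c0: "c \<noteq> 0" using False by (simp add: c_def)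
    have cc: "cnj c = c" by (simp add: c_def)
    have ev: "hform (axis None 1) v = 1 - a"
      using hform_axis[of v] by (simp add: v_def p'N hform_def axis_def)
    have hv: "hform v v = c"
      by (simp add: v_def hform_diff_left hform_diff_right hp hform_axis p'N c_def)
        (simp add: hform_def axis_def p'N)
    define R :: "'n cmat1" where "R = (\<chi> i j. (if i = j then 1 else 0)
        - 2 / c * v $ i * (cnj (v $ j) * (if j = None then -1 else 1)))"
    have Rx: "R *v x = x - (2 / c * hform x v) *s v" for x
    proof -
      have "(R *v x) $ i = (x - (2 / c * hform x v) *s v) $ i" for i
      proof -
        have "(R *v x) $ i = (\<Sum>j\<in>UNIV. (if i = j then x $ j else 0))
            - (\<Sum>j\<in>UNIV. 2 / c * v $ i * (x $ j * cnj (v $ j) * (if j = None then -1 else 1)))"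
          unfolding sum_subtractf[symmetric]
          by (simp add: matrix_vector_mult_def R_def) (intro sum.cong, auto simp: algebra_simps)
        also have "(\<Sum>j\<in>UNIV. 2 / c * v $ i * (x $ j * cnj (v $ j) * (if j = None then -1 else 1)))
            = 2 / c * v $ i * hform x v"
          unfolding sum_distrib_left[symmetric] by (simp add: sum_option hform_def)
        finally show ?thesis by (simp add: mult_ac)
      qed
      then show ?thesis by (simp add: vec_eq_iff)
    qed
    have "hform (R *v x) (R *v y) = hform x y" for x y
    proof -
      have "hform (R *v x) (R *v y) = hform x y - 2 / c * hform x v * hform v y
          - 2 / c * hform v y * hform x v + 2 / c * hform x v * (2 / c * hform v y) * c"
        unfolding Rx hform_diff_left hform_diff_right hform_smult_left hform_smult_right
        by (simp add: hv cnj_hform cc algebra_simps)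
      then show ?thesis using c0 by (simp add: field_simps)
    qed
    then have "R \<in> U_n1" by (rule U_n1_I)
    moreover have "R *v axis None 1 = p'"
    proof -
      have "2 / c * hform (axis None 1) v = -1"
        using c0 by (simp add: ev field_simps) (simp add: c_def)
      then show ?thesis unfolding Rx by (simp add: v_def)
    qed
    ultimately show ?thesis by blast
  qed
  then obtain R where R: "R \<in> U_n1" "R *v axis None 1 = p'" by blast
  have "(R ** mat \<omega>) *v axis None 1 = p"
  proof -
    have "mat \<omega> *v axis None 1 = \<omega> *s (axis None 1 :: complex ^ 'n option)"
      by (simp add: vec_eq_iff matrix_vector_mult_def mat_def axis_def if_distrib[of "\<lambda>x. x * _"] cong: if_cong)
    then show ?thesis
      by (metis R(2) p'p matrix_vector_mul_assoc vector_scalar_commute)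
  qed
  moreover have "R ** mat \<omega> \<in> U_n1"
  proof (rule U_n1_mult[OF R(1)], rule U_n1_I)
    have "mat \<omega> *v v = \<omega> *s v" for v :: "complex ^ 'n option"
      by (simp add: vec_eq_iff matrix_vector_mult_def mat_def if_distrib[of "\<lambda>x. x * _"] cong: if_cong)
    then show "hform (mat \<omega> *v v) (mat \<omega> *v w) = hform v w" for v w :: "complex ^ 'n option"
      using \<omega>\<omega> by (simp add: hform_smult_left hform_smult_right mult.commute flip: mult.assoc)
  qed
  ultimately show ?thesis using that by blast
qed

section \<open>The packing inequality\<close>

definition neg_shell :: "(complex ^ ('n::finite option)) set" where
  "neg_shell = {v. 1 < qform v \<and> qform v < 2}"

lemma continuous_on_hform [continuous_intros]:
  "continuous_on S f \<Longrightarrow> continuous_on S g \<Longrightarrow> continuous_on S (\<lambda>x. hform (f x) (g x))"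
  unfolding hform_def by (intro continuous_intros)

lemma continuous_on_qform [continuous_intros]:
  "continuous_on S f \<Longrightarrow> continuous_on S (\<lambda>x. qform (f x))"
  unfolding qform_def by (intro continuous_intros)

lemma measurable_hform [measurable]: "hform p \<in> borel_measurable borel"
  by (intro borel_measurable_continuous_onI continuous_intros)

lemma measurable_qform [measurable]: "qform \<in> borel_measurable borel"
  by (intro borel_measurable_continuous_onI continuous_intros)

lemma measurable_vec_nth_complex [measurable]: "(\<lambda>v::complex ^ 'a. v $ i) \<in> borel_measurable borel"
  by (intro borel_measurable_continuous_onI continuous_intros)

lemma measurable_neg_shell [measurable]: "neg_shell \<in> sets borel"
  unfolding neg_shell_def by measurable

lemma neg_shell_U_n1: "g \<in> U_n1 \<Longrightarrow> g *v v \<in> neg_shell \<longleftrightarrow> v \<in> neg_shell"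
  by (simp add: neg_shell_def qform_U_n1)

lemma negative_cauchy_schwarz:
  assumes v: "qform v > 0" and w: "qform w > 0"
  shows "v $ None \<noteq> 0" "w $ None \<noteq> 0"
    "cmod ((\<Sum>j\<in>UNIV. v $ Some j * cnj (w $ Some j)) / (v $ None * cnj (w $ None))) < 1"
proof -
  define x y where "x = (\<chi> j. v $ Some j)" and "y = (\<chi> j. w $ Some j)"
  have x: "(norm x)\<^sup>2 = (\<Sum>j\<in>UNIV. (cmod (v $ Some j))\<^sup>2)"
    and y: "(norm y)\<^sup>2 = (\<Sum>j\<in>UNIV. (cmod (w $ Some j))\<^sup>2)"
    by (simp_all add: x_def y_def norm_vec_def L2_set_def sum_nonneg)
  have "(norm x)\<^sup>2 < (cmod (v $ None))\<^sup>2" "(norm y)\<^sup>2 < (cmod (w $ None))\<^sup>2"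
    using v w by (simp_all add: x y qform_def)
  then have xv: "norm x < cmod (v $ None)" and yw: "norm y < cmod (w $ None)"
    by (auto intro: power_less_imp_less_base)
  then show v0: "v $ None \<noteq> 0" and w0: "w $ None \<noteq> 0" by auto
  have "cmod (\<Sum>j\<in>UNIV. v $ Some j * cnj (w $ Some j)) \<le> norm x * norm y"
    using cmod_sum_le_norm[of x y] by (simp add: x_def y_def)
  also have "\<dots> < cmod (v $ None) * cmod (w $ None)"
    using xv yw by (intro mult_strict_mono') auto
  finally show "cmod ((\<Sum>j\<in>UNIV. v $ Some j * cnj (w $ Some j)) / (v $ None * cnj (w $ None))) < 1"
    using v0 w0 by (simp add: norm_divide norm_mult divide_less_eq)
qed

text \<open>If d is the hyperbolic distance from the origin to the point of the ball represented by
  v, then \<open>qform v / (cmod (v $ None))^2\<close> is cosh^-2 (d/2). The weight is thus H(tanh^2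
  (d/2)) cosh^-k (d/2).\<close>

definition base_weight :: "nat \<Rightarrow> (real \<Rightarrow> real) \<Rightarrow> complex ^ ('n::finite option) \<Rightarrow> real" where
  "base_weight k H v = H (1 - qform v / (cmod (v $ None))\<^sup>2) * (sqrt (qform v) / cmod (v $ None)) ^ k"

text \<open>The weight is invariant under scaling of v, so up to a constant factor this is its
  integral over the ball against the hyperbolic volume.\<close>

definition cone_integral :: "'n::finite itself \<Rightarrow> nat \<Rightarrow> (real \<Rightarrow> real) \<Rightarrow> ennreal" where
  "cone_integral _ k H
     = (\<integral>\<^sup>+v. indicator neg_shell v * ennreal (base_weight k H (v :: complex ^ ('n option))) \<partial>lborel)"

lemma am_gm_powr:
  fixes x y e :: real
  assumes "x > 0" "y > 0"
  shows "2 * (x * y) powr (- e / 2) \<le> x powr (- e) + y powr (- e)"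
proof -
  define a b where "a = x powr (- e / 2)" and "b = y powr (- e / 2)"
  have "x powr (- e) = a\<^sup>2" "y powr (- e) = b\<^sup>2"
    by (simp_all add: a_def b_def power2_eq_square flip: powr_add)
  moreover have "(x * y) powr (- e / 2) = a * b" using assms by (simp add: a_def b_def powr_mult)
  ultimately show ?thesis using sum_squares_bound[of a b] by simp
qed

text \<open>The mean value property of \<open>c \<mapsto> (1 - c)\<^sup>-\<^sup>k\<close>: averaging over \<open>c \<mapsto> -c\<close>, \<open>c\<^sup>2 \<mapsto> -c\<^sup>2\<close>, \dots
  and the arithmetic-geometric mean inequality replace \<open>\<bar>1 - c\<bar>\<^sup>-\<^sup>k\<close> by the values
  \<open>\<bar>1 - c\<^sup>N\<bar>\<close> to the power \<open>-k/N\<close>, with \<open>N = 2\<^sup>M\<close>, which tend to 1.\<close>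

lemma cone_mean_value:
  fixes w :: "complex ^ ('n::finite option)"
  assumes w: "qform w = 1" and H: "\<And>x. H x \<ge> 0" and [measurable]: "H \<in> borel_measurable borel"
  shows "ennreal (1 / cmod (w $ None) ^ k) * cone_integral TYPE('n) k H
    \<le> (\<integral>\<^sup>+v. indicator neg_shell v * ennreal (H (1 - qform v / (cmod (v $ None))\<^sup>2)
          * (sqrt (qform v) / cmod (hform w v)) ^ k) \<partial>lborel)"
proof -
  define c where "c v = (\<Sum>j\<in>UNIV. v $ Some j * cnj (w $ Some j)) / (v $ None * cnj (w $ None))" for v
  define g where "g v = base_weight k H v" for v :: "complex ^ ('n option)"
  define I where "I M = (\<integral>\<^sup>+v. indicator neg_shell v * ennreal (g v * cmod (1 - c v ^ (2 ^ M)) powr (- (real k / 2 ^ M))) \<partial>lborel)"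
    for M :: nat
  have g0: "g v \<ge> 0" if "v \<in> neg_shell" for v using H that by (auto simp: g_def base_weight_def neg_shell_def)
  have [measurable]: "c \<in> borel_measurable borel"
    unfolding c_def by (intro borel_measurable_divide borel_measurable_continuous_onI continuous_intros)
  have [measurable]: "g \<in> borel_measurable borel"
    unfolding g_def base_weight_def by measurable
  have c1: "v $ None \<noteq> 0" "w $ None \<noteq> 0" "cmod (c v) < 1" if "v \<in> neg_shell" for v
    using negative_cauchy_schwarz[of v w] that w by (auto simp: neg_shell_def c_def)
  have cN: "cmod (c v ^ N) < 1" if "v \<in> neg_shell" "N > 0" for v N
    using c1(3)[OF that(1)] that(2) by (simp add: norm_power power_less_one_iff)
  have step: "I M \<ge> I (Suc M)" for M
  proof -
    define N :: nat where "N = 2 ^ M"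
    have "N > 0" by (simp add: N_def)
    define e where "e = real k / 2 ^ M"
    \<comment> \<open>Since \<open>\<omega> ^ N = -1\<close>, the rotation turns c^N into -c^N, and
      (1 - c^N) (1 + c^N) = 1 - c^(2N) leads to the next stage.\<close>
    define \<omega> where "\<omega> = cis (pi / N)"
    have \<omega>N: "\<omega> ^ N = -1" using \<open>N > 0\<close> by (simp add: \<omega>_def Complex.DeMoivre)
    have \<omega>: "cmod \<omega> = 1" by (simp add: \<omega>_def)
    have cD: "c (phase_mat \<omega> *v v) ^ N = - (c v ^ N)" for v
      by (simp add: c_def phase_mat_mult power_divide power_mult_distrib \<omega>N)
    have gD: "g (phase_mat \<omega> *v v) = g v" for v
      by (simp add: g_def base_weight_def qform_U_n1[OF phase_mat_U_n1[OF \<omega>]] phase_mat_mult norm_mult \<omega>)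
    have "I M = (\<integral>\<^sup>+v. indicator neg_shell (phase_mat \<omega> *v v) * ennreal (g (phase_mat \<omega> *v v)
        * cmod (1 - c (phase_mat \<omega> *v v) ^ N) powr (- e)) \<partial>lborel)"
      unfolding I_def e_def N_def by (rule nn_integral_U_n1[OF phase_mat_U_n1[OF \<omega>], symmetric]) measurable
    also have "\<dots> = (\<integral>\<^sup>+v. indicator neg_shell v * ennreal (g v * cmod (1 + c v ^ N) powr (- e)) \<partial>lborel)"
      by (simp add: cD gD indicator_def neg_shell_U_n1[OF phase_mat_U_n1[OF \<omega>]])
    finally have I2: "I M = (\<integral>\<^sup>+v. indicator neg_shell v * ennreal (g v * cmod (1 + c v ^ N) powr (- e)) \<partial>lborel)" .
    have "2 * I (Suc M) = (\<integral>\<^sup>+v. 2 * (indicator neg_shell v * ennreal (g v * cmod (1 - c v ^ (2 ^ Suc M)) powr (- (real k / 2 ^ Suc M)))) \<partial>lborel)"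
      unfolding I_def by (subst nn_integral_cmult) auto
    also have "\<dots> \<le> (\<integral>\<^sup>+v. indicator neg_shell v * ennreal (g v * cmod (1 - c v ^ N) powr (- e))
        + indicator neg_shell v * ennreal (g v * cmod (1 + c v ^ N) powr (- e)) \<partial>lborel)"
    proof (rule nn_integral_mono)
      fix v :: "complex ^ ('n option)"
      show "2 * (indicator neg_shell v * ennreal (g v * cmod (1 - c v ^ (2 ^ Suc M)) powr (- (real k / 2 ^ Suc M))))
        \<le> indicator neg_shell v * ennreal (g v * cmod (1 - c v ^ N) powr (- e))
        + indicator neg_shell v * ennreal (g v * cmod (1 + c v ^ N) powr (- e))"
      proof (cases "v \<in> neg_shell")
        case True
        define b where "b = c v ^ N"
        have b: "cmod b < 1" using cN[OF True \<open>N > 0\<close>] by (simp add: b_def)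
        then have "1 - b \<noteq> 0" "1 + b \<noteq> 0" by (auto simp: add_eq_0_iff)
        then have "2 * (cmod (1 - b) * cmod (1 + b)) powr (- e / 2) \<le> cmod (1 - b) powr (- e) + cmod (1 + b) powr (- e)"
          by (intro am_gm_powr) auto
        also have "cmod (1 - b) * cmod (1 + b) = cmod (1 - c v ^ (2 ^ Suc M))"
          by (simp add: b_def N_def power_mult mult.commute[of 2] flip: norm_mult)
             (simp add: algebra_simps power2_eq_square)
        also have "- e / 2 = - (real k / 2 ^ Suc M)" by (simp add: e_def)
        finally have "g v * (2 * cmod (1 - c v ^ (2 ^ Suc M)) powr (- (real k / 2 ^ Suc M)))
            \<le> g v * (cmod (1 - b) powr (- e) + cmod (1 + b) powr (- e))"
          using g0[OF True] by (rule mult_left_mono)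
        then have "2 * (g v * cmod (1 - c v ^ (2 ^ Suc M)) powr (- (real k / 2 ^ Suc M)))
            \<le> g v * cmod (1 - b) powr (- e) + g v * cmod (1 + b) powr (- e)"
          by (simp add: algebra_simps)
        then have "ennreal (2 * (g v * cmod (1 - c v ^ (2 ^ Suc M)) powr (- (real k / 2 ^ Suc M))))
            \<le> ennreal (g v * cmod (1 - b) powr (- e) + g v * cmod (1 + b) powr (- e))"
          by (rule ennreal_leI)
        then show ?thesis using True g0[OF True] by (simp add: b_def ennreal_mult)
      qed simp
    qed
    also have "\<dots> = I M + I M"
      by (subst nn_integral_add) (auto simp: I2[symmetric], auto simp: I_def N_def e_def)
    also have "\<dots> = 2 * I M" by (simp add: mult_2)
    finally show ?thesis by (simp add: ennreal_mult_le_mult_iff)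
  qed
  have I0: "I 0 \<ge> I M" for M by (induction M) (auto intro: order_trans step)
  \<comment> \<open>The crude bound \<bar>1 - c^N\<bar> \<le> 2 suffices: the exponent -k/N tends to
    0, so the lost factor 2^(-k/N) tends to 1 and no limit has to be taken under the
    integral.\<close>
  have "ennreal (2 powr (- (real k / 2 ^ M))) * cone_integral TYPE('n) k H \<le> I M" for M
  proof -
    have "ennreal (2 powr (- (real k / 2 ^ M))) * cone_integral TYPE('n) k H
      = (\<integral>\<^sup>+v. ennreal (2 powr (- (real k / 2 ^ M))) * (indicator neg_shell v * ennreal (g v)) \<partial>lborel)"
      unfolding cone_integral_def g_def[symmetric] by (subst nn_integral_cmult) auto
    also have "\<dots> \<le> I M" unfolding I_def
    proof (rule nn_integral_mono)
      fix v :: "complex ^ ('n option)"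
      show "ennreal (2 powr (- (real k / 2 ^ M))) * (indicator neg_shell v * ennreal (g v))
        \<le> indicator neg_shell v * ennreal (g v * cmod (1 - c v ^ (2 ^ M)) powr (- (real k / 2 ^ M)))"
      proof (cases "v \<in> neg_shell")
        case True
        have b: "cmod (c v ^ (2 ^ M)) < 1" using cN[OF True] by simp
        then have "c v ^ (2 ^ M) \<noteq> 1" by auto
        then have "cmod (1 - c v ^ (2 ^ M)) > 0" by auto
        moreover have "cmod (1 - c v ^ (2 ^ M)) \<le> 2"
          using norm_triangle_ineq4[of 1 "c v ^ (2 ^ M)"] b by simp
        ultimately have "2 powr (- (real k / 2 ^ M)) \<le> cmod (1 - c v ^ (2 ^ M)) powr (- (real k / 2 ^ M))"
          by (intro powr_mono2') auto
        then have "g v * 2 powr (- (real k / 2 ^ M)) \<le> g v * cmod (1 - c v ^ (2 ^ M)) powr (- (real k / 2 ^ M))"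
          using g0[OF True] by (rule mult_left_mono)
        then have "ennreal (2 powr (- (real k / 2 ^ M)) * g v) \<le> ennreal (g v * cmod (1 - c v ^ (2 ^ M)) powr (- (real k / 2 ^ M)))"
          by (intro ennreal_leI) (simp add: mult.commute)
        then show ?thesis using True by (simp add: ennreal_mult' ennreal_mult'')
      qed simp
    qed
    finally show ?thesis .
  qed
  then have le: "ennreal (2 powr (- (real k / 2 ^ M))) * cone_integral TYPE('n) k H \<le> I 0" for M
    using I0 order_trans by blast
  have "(\<lambda>M. real k * (1 / 2) ^ M) \<longlonglongrightarrow> real k * 0"
    by (intro tendsto_mult tendsto_const LIMSEQ_power_zero) simp
  then have "(\<lambda>M. 2 powr (- (real k / 2 ^ M))) \<longlonglongrightarrow> 2 powr (- 0)"
    by (intro tendsto_powr tendsto_const tendsto_minus) (simp_all add: power_divide)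
  then have "(\<lambda>M. ennreal (2 powr (- (real k / 2 ^ M)))) \<longlonglongrightarrow> ennreal 1"
    by (intro tendsto_ennrealI) simp
  then have "(\<lambda>M. ennreal (2 powr (- (real k / 2 ^ M))) * cone_integral TYPE('n) k H)
      \<longlonglongrightarrow> ennreal 1 * cone_integral TYPE('n) k H"
    by (intro tendsto_mult_ennreal tendsto_const) auto
  then have lim: "cone_integral TYPE('n) k H \<le> I 0"
    using le by (intro LIMSEQ_le_const2[of _ "cone_integral TYPE('n) k H" "I 0"]) auto
  have "(\<integral>\<^sup>+v. indicator neg_shell v * ennreal (H (1 - qform v / (cmod (v $ None))\<^sup>2)
          * (sqrt (qform v) / cmod (hform w v)) ^ k) \<partial>lborel)
     = (\<integral>\<^sup>+v. ennreal (1 / cmod (w $ None) ^ k) * (indicator neg_shell v * ennreal (g v * cmod (1 - c v) powr (- real k))) \<partial>lborel)"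
  proof (rule nn_integral_cong)
    fix v :: "complex ^ ('n option)"
    show "indicator neg_shell v * ennreal (H (1 - qform v / (cmod (v $ None))\<^sup>2)
          * (sqrt (qform v) / cmod (hform w v)) ^ k)
      = ennreal (1 / cmod (w $ None) ^ k) * (indicator neg_shell v * ennreal (g v * cmod (1 - c v) powr (- real k)))"
    proof (cases "v \<in> neg_shell")
      case True
      have "hform v w = - (v $ None * cnj (w $ None)) * (1 - c v)"
        using c1[OF True] by (simp add: hform_def c_def field_simps)
      then have h: "cmod (hform w v) = cmod (v $ None) * cmod (w $ None) * cmod (1 - c v)"
        by (simp add: cmod_hform_commute[of w v] norm_mult)
      have "1 - c v \<noteq> 0" using c1(3)[OF True] by auto
      then have "cmod (1 - c v) powr (- real k) = 1 / cmod (1 - c v) ^ k"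
        by (simp add: powr_minus_divide powr_realpow)
      then have "H (1 - qform v / (cmod (v $ None))\<^sup>2) * (sqrt (qform v) / cmod (hform w v)) ^ k
        = 1 / cmod (w $ None) ^ k * (g v * cmod (1 - c v) powr (- real k))"
        by (simp add: h g_def base_weight_def power_divide power_mult_distrib)
      moreover have "ennreal (1 / cmod (w $ None) ^ k * (g v * cmod (1 - c v) powr (- real k)))
        = ennreal (1 / cmod (w $ None) ^ k) * ennreal (g v * cmod (1 - c v) powr (- real k))"
        using g0[OF True] by (intro ennreal_mult) auto
      ultimately show ?thesis using True by simp
    qed simp
  qed
  also have "\<dots> = ennreal (1 / cmod (w $ None) ^ k) * I 0"
    unfolding I_def by (subst nn_integral_cmult) auto
  finally show ?thesis using lim by (simp add: mult_left_mono)
qed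

text \<open>In the term of g, the substitution v \<mapsto> g R v moves the centre of H to the base
  vector and replaces p by a vector w whose last entry has modulus \<bar><p, g p>\<bar>;
  \<open>cone_mean_value\<close> then bounds that term by the integral of H, centred at g p, against
  the weight centred at p. The overlap hypothesis bounds the sum of these integrands by the weight
  itself, whose integral is independent of p.\<close>

lemma packing_inequality:
  fixes p :: "complex ^ ('n::finite option)"
  assumes p: "qform p = 1" and A: "finite A" "A \<subseteq> U_n1"
    and H: "\<And>x. H x \<ge> 0" and [measurable]: "H \<in> borel_measurable borel"
    and overlap: "\<And>v. v \<in> neg_shell \<Longrightarrow> (\<Sum>g\<in>A. H (1 - qform v / (cmod (hform (g *v p) v))\<^sup>2)) \<le> 1"
  shows "(\<Sum>g\<in>A. ennreal (1 / cmod (hform p (g *v p)) ^ k)) * cone_integral TYPE('n) k H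
    \<le> cone_integral TYPE('n) k (\<lambda>_. 1)"
proof -
  obtain R where R: "R \<in> U_n1" "R *v axis None 1 = p" using U_n1_transitive[OF p] .
  define \<phi> where "\<phi> v = (sqrt (qform v) / cmod (hform p v)) ^ k" for v
  have [measurable]: "\<phi> \<in> borel_measurable borel" unfolding \<phi>_def by measurable
  have hN: "cmod (hform v (axis None 1)) = cmod (v $ None)" for v by (simp add: hform_axis)
  have hR: "cmod (hform p (R *v v)) = cmod (v $ None)" for v
    by (simp add: R(2)[symmetric] hform_U_n1[OF R(1)] cmod_hform_commute[of "axis None 1"] hN)
  have H1: "cone_integral TYPE('n) k (\<lambda>_. 1) = (\<integral>\<^sup>+v. indicator neg_shell v * ennreal (\<phi> v) \<partial>lborel)"
  proof -
    have "(\<integral>\<^sup>+v. indicator neg_shell v * ennreal (\<phi> v) \<partial>lborel) = (\<integral>\<^sup>+v. indicator neg_shell (R *v v) * ennreal (\<phi> (R *v v)) \<partial>lborel)"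
      by (rule nn_integral_U_n1[OF R(1), symmetric]) measurable
    also have "\<dots> = cone_integral TYPE('n) k (\<lambda>_. 1)"
      unfolding cone_integral_def
      by (intro nn_integral_cong) (simp add: indicator_def neg_shell_U_n1[OF R(1)] \<phi>_def hR base_weight_def qform_U_n1[OF R(1)])
    finally show ?thesis by simp
  qed
  have tm: "ennreal (1 / cmod (hform p (g *v p)) ^ k) * cone_integral TYPE('n) k H
    \<le> (\<integral>\<^sup>+v. indicator neg_shell v * ennreal (H (1 - qform v / (cmod (hform (g *v p) v))\<^sup>2) * \<phi> v) \<partial>lborel)"
    if g: "g \<in> A" for g
  proof -
    have gU: "g \<in> U_n1" using g A by blast
    then have gR: "g ** R \<in> U_n1" using R(1) by (rule U_n1_mult)
    obtain g' where g': "g' \<in> U_n1" "(g ** R) ** g' = mat 1" "g' ** (g ** R) = mat 1"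
      using U_n1_inverse[OF gR] by metis
    define w where "w = g' *v p"
    have qw: "qform w = 1" by (simp add: w_def qform_U_n1 g'(1) p)
    have w: "hform p ((g ** R) *v v) = hform w v" for v
      using hform_U_n1[OF g'(1), of p "(g ** R) *v v"] by (simp add: w_def matrix_vector_mul_assoc g'(3))
    have gp: "(g ** R) *v axis None 1 = g *v p" by (simp add: R(2) flip: matrix_vector_mul_assoc)
    have "cmod (w $ None) = cmod (hform w (axis None 1))" by (simp add: hN)
    also have "\<dots> = cmod (hform p (g *v p))" by (simp add: w[symmetric] gp)
    finally have wN: "cmod (w $ None) = cmod (hform p (g *v p))" .
    have hg: "cmod (hform (g *v p) ((g ** R) *v v)) = cmod (v $ None)" for v
      by (simp add: gp[symmetric] hform_U_n1[OF gR] cmod_hform_commute[of "axis None 1"] hN)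
    have "(\<integral>\<^sup>+v. indicator neg_shell v * ennreal (H (1 - qform v / (cmod (hform (g *v p) v))\<^sup>2) * \<phi> v) \<partial>lborel)
      = (\<integral>\<^sup>+v. indicator neg_shell ((g ** R) *v v) * ennreal (H (1 - qform ((g ** R) *v v) / (cmod (hform (g *v p) ((g ** R) *v v)))\<^sup>2) * \<phi> ((g ** R) *v v)) \<partial>lborel)"
      by (rule nn_integral_U_n1[OF gR, symmetric]) measurable
    also have "\<dots> = (\<integral>\<^sup>+v. indicator neg_shell v * ennreal (H (1 - qform v / (cmod (v $ None))\<^sup>2)
          * (sqrt (qform v) / cmod (hform w v)) ^ k) \<partial>lborel)"
      by (simp add: indicator_def neg_shell_U_n1[OF gR] qform_U_n1[OF gR] hg \<phi>_def w)
    finally show ?thesis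
      using cone_mean_value[OF qw, of H k] H by (simp add: wN)
  qed
  have "(\<Sum>g\<in>A. ennreal (1 / cmod (hform p (g *v p)) ^ k)) * cone_integral TYPE('n) k H
    \<le> (\<Sum>g\<in>A. \<integral>\<^sup>+v. indicator neg_shell v * ennreal (H (1 - qform v / (cmod (hform (g *v p) v))\<^sup>2) * \<phi> v) \<partial>lborel)"
    unfolding sum_distrib_right by (rule sum_mono) (rule tm)
  also have "\<dots> = (\<integral>\<^sup>+v. (\<Sum>g\<in>A. indicator neg_shell v * ennreal (H (1 - qform v / (cmod (hform (g *v p) v))\<^sup>2) * \<phi> v)) \<partial>lborel)"
    by (rule nn_integral_sum[symmetric]) measurable
  also have "\<dots> \<le> (\<integral>\<^sup>+v. indicator neg_shell v * ennreal (\<phi> v) \<partial>lborel)"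
  proof (rule nn_integral_mono)
    fix v :: "complex ^ ('n option)"
    show "(\<Sum>g\<in>A. indicator neg_shell v * ennreal (H (1 - qform v / (cmod (hform (g *v p) v))\<^sup>2) * \<phi> v))
      \<le> indicator neg_shell v * ennreal (\<phi> v)"
    proof (cases "v \<in> neg_shell")
      case True
      then have \<phi>0: "\<phi> v \<ge> 0" by (auto simp: \<phi>_def neg_shell_def)
      have "(\<Sum>g\<in>A. H (1 - qform v / (cmod (hform (g *v p) v))\<^sup>2)) * \<phi> v \<le> 1 * \<phi> v"
        using overlap[OF True] \<phi>0 by (rule mult_right_mono)
      then show ?thesis
        using True H \<phi>0 by (simp add: sum_distrib_right sum_ennreal)
    qed simp
  qed
  finally show ?thesis by (simp add: H1)
qed

section \<open>Overlap bounds\<close>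

text \<open>The separated points of the orbit, seen from \<open>v\<close>, as points of the ball.\<close>

lemma ball_coordinates:
  fixes p :: "'a \<Rightarrow> complex ^ ('n::finite option)"
  assumes v: "qform v > 0" and p: "\<And>i. i \<in> A \<Longrightarrow> qform (p i) = 1"
    and sep: "\<And>i j. i \<in> A \<Longrightarrow> j \<in> A \<Longrightarrow> i \<noteq> j \<Longrightarrow> cmod (hform (p i) (p j)) \<ge> \<kappa>" and \<kappa>: "\<kappa> \<ge> 0"
  obtains z :: "'a \<Rightarrow> complex ^ 'n"
  where "\<And>i. i \<in> A \<Longrightarrow> 1 - qform v / (cmod (hform (p i) v))\<^sup>2 = (norm (z i))\<^sup>2"
    and "\<And>i. i \<in> A \<Longrightarrow> norm (z i) < 1"
    and "\<And>i j. i \<in> A \<Longrightarrow> j \<in> A \<Longrightarrow> i \<noteq> j \<Longrightarrow>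
      \<kappa>\<^sup>2 * (1 - (norm (z i))\<^sup>2) * (1 - (norm (z j))\<^sup>2) \<le> (cmod (1 - (\<Sum>l\<in>UNIV. z i $ l * cnj (z j $ l))))\<^sup>2"
proof -
  define c where "c = complex_of_real (1 / sqrt (qform v))"
  have c: "c * cnj c = complex_of_real (1 / qform v)" using v by (simp add: c_def flip: of_real_mult)
  have "hform (c *s v) (c *s v) = c * cnj c * hform v v"
    by (simp add: hform_smult_left hform_smult_right)
  also have "\<dots> = -1" using v by (simp add: c hform_self)
  finally have "qform (c *s v) = 1" by (simp add: hform_self)
  then obtain T where T: "T \<in> U_n1" "T *v axis None 1 = c *s v" by (rule U_n1_transitive)
  obtain T' where T': "T' \<in> U_n1" "T' ** T = mat 1" using U_n1_inverse[OF T(1)] by metis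
  define P where "P i = T' *v p i" for i
  have hP: "hform (P i) (P j) = hform (p i) (p j)" for i j by (simp add: P_def hform_U_n1 T'(1))
  have qP: "qform (P i) = 1" if "i \<in> A" for i using p[OF that] by (simp add: P_def qform_U_n1 T'(1))
  have PN: "(cmod (P i $ None))\<^sup>2 = (cmod (hform (p i) v))\<^sup>2 / qform v" for i
  proof -
    have "axis None 1 = T' *v (c *s v)"
      by (simp add: T(2)[symmetric] matrix_vector_mul_assoc T'(2))
    then have "cmod (P i $ None) = cmod (hform (P i) (T' *v (c *s v)))"
      by (simp add: hform_axis flip: \<open>axis None 1 = _\<close>)
    also have "\<dots> = cmod c * cmod (hform (p i) v)"
      by (simp add: P_def hform_U_n1 T'(1) hform_smult_right norm_mult)
    finally show ?thesis using v by (simp add: c_def power_mult_distrib power_divide norm_divide)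
  qed
  \<comment> \<open>After T' the point represented by v is the origin, so \<bar>z i\<bar> is tanh
    (d/2) for the distance d between \<open>p i\<close> and v.\<close>
  define z where "z i = (\<chi> l. P i $ Some l / P i $ None)" for i
  have PN0: "P i $ None \<noteq> 0" if "i \<in> A" for i using negative_cauchy_schwarz(1)[of "P i" "P i"] qP[OF that] by simp
  have z2: "1 - (norm (z i))\<^sup>2 = 1 / (cmod (P i $ None))\<^sup>2" if "i \<in> A" for i
  proof -
    have "(norm (z i))\<^sup>2 = (\<Sum>l\<in>UNIV. (cmod (P i $ Some l))\<^sup>2) / (cmod (P i $ None))\<^sup>2"
      by (simp add: z_def norm_vec_def L2_set_def sum_nonneg norm_divide power_divide sum_divide_distrib)
    also have "(\<Sum>l\<in>UNIV. (cmod (P i $ Some l))\<^sup>2) = (cmod (P i $ None))\<^sup>2 - 1"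
      using qP[OF that] by (simp add: qform_def)
    finally show ?thesis using PN0[OF that] by (simp add: field_simps)
  qed
  have zz: "1 - (\<Sum>l\<in>UNIV. z i $ l * cnj (z j $ l)) = - hform (p i) (p j) / (P i $ None * cnj (P j $ None))"
    if "i \<in> A" "j \<in> A" for i j
  proof -
    have "(\<Sum>l\<in>UNIV. z i $ l * cnj (z j $ l))
        = (\<Sum>l\<in>UNIV. P i $ Some l * cnj (P j $ Some l)) / (P i $ None * cnj (P j $ None))"
      by (simp add: z_def sum_divide_distrib)
    also have "(\<Sum>l\<in>UNIV. P i $ Some l * cnj (P j $ Some l)) = hform (p i) (p j) + P i $ None * cnj (P j $ None)"
      unfolding hP[of i j, symmetric] by (simp add: hform_def)
    finally show ?thesis using PN0[OF that(1)] PN0[OF that(2)] by (simp add: field_simps)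
  qed
  show ?thesis
  proof (rule that[of z])
    fix i assume i: "i \<in> A"
    show "1 - qform v / (cmod (hform (p i) v))\<^sup>2 = (norm (z i))\<^sup>2"
      using z2[OF i] by (simp add: PN)
    have "1 - (norm (z i))\<^sup>2 > 0" using PN0[OF i] by (simp add: z2[OF i])
    then show "norm (z i) < 1" using abs_square_less_1[of "norm (z i)"] by simp
    fix j assume j: "j \<in> A" and ij: "i \<noteq> j"
    have "\<kappa>\<^sup>2 \<le> (cmod (hform (p i) (p j)))\<^sup>2"
      using sep[OF i j ij] \<kappa> by (rule power_mono)
    then show "\<kappa>\<^sup>2 * (1 - (norm (z i))\<^sup>2) * (1 - (norm (z j))\<^sup>2) \<le> (cmod (1 - (\<Sum>l\<in>UNIV. z i $ l * cnj (z j $ l))))\<^sup>2"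
      unfolding z2[OF i] z2[OF j] zz[OF i j]
      by (simp add: norm_divide norm_mult power_divide power_mult_distrib divide_right_mono)
  qed
qed

text \<open>With s = tanh^2 a the constant (1 + s)/(1 - s) is cosh (2a): the points have mutual
  distance at least 4a and the balls have radius 2a. Instead of a triangle inequality for the
  hyperbolic distance, \<bar>1 - <z, z'>\<bar> \<le> 1 + s for two points with \<bar>z\<bar>^2,
  \<bar>z'\<bar>^2 < s contradicts the separation directly.\<close>

lemma ball_overlap:
  fixes p :: "'a \<Rightarrow> complex ^ ('n::finite option)"
  assumes v: "qform v > 0" and A: "finite A" and p: "\<And>i. i \<in> A \<Longrightarrow> qform (p i) = 1"
    and s: "0 < s" "s < 1"
    and sep: "\<And>i j. i \<in> A \<Longrightarrow> j \<in> A \<Longrightarrow> i \<noteq> j \<Longrightarrow> cmod (hform (p i) (p j)) \<ge> (1 + s) / (1 - s)"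
  shows "(\<Sum>i\<in>A. indicator {..<s} (1 - qform v / (cmod (hform (p i) v))\<^sup>2)) \<le> (1::real)"
proof -
  have k0: "(1 + s) / (1 - s) \<ge> 0" using s by simp
  obtain z :: "'a \<Rightarrow> complex ^ 'n" where
    z: "\<And>i. i \<in> A \<Longrightarrow> 1 - qform v / (cmod (hform (p i) v))\<^sup>2 = (norm (z i))\<^sup>2"
    "\<And>i. i \<in> A \<Longrightarrow> norm (z i) < 1"
    and zz: "\<And>i j. i \<in> A \<Longrightarrow> j \<in> A \<Longrightarrow> i \<noteq> j \<Longrightarrow>
      ((1 + s) / (1 - s))\<^sup>2 * (1 - (norm (z i))\<^sup>2) * (1 - (norm (z j))\<^sup>2) \<le> (cmod (1 - (\<Sum>l\<in>UNIV. z i $ l * cnj (z j $ l))))\<^sup>2"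
    using ball_coordinates[of v A p "(1 + s) / (1 - s)"] v p sep k0 by blast
  define B where "B = {i\<in>A. (norm (z i))\<^sup>2 < s}"
  have "i = j" if "i \<in> B" "j \<in> B" for i j
  proof (rule ccontr)
    assume ij: "i \<noteq> j"
    have i: "i \<in> A" "(norm (z i))\<^sup>2 < s" and j: "j \<in> A" "(norm (z j))\<^sup>2 < s" using that by (auto simp: B_def)
    have "norm (z i) * norm (z j) \<le> s"
    proof -
      have "2 * (norm (z i) * norm (z j)) \<le> (norm (z i))\<^sup>2 + (norm (z j))\<^sup>2"
        using sum_squares_bound[of "norm (z i)" "norm (z j)"] by simp
      then show ?thesis using i j by simp
    qed
    then have "cmod (1 - (\<Sum>l\<in>UNIV. z i $ l * cnj (z j $ l))) \<le> 1 + s"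
      using norm_triangle_ineq4[of 1 "\<Sum>l\<in>UNIV. z i $ l * cnj (z j $ l)"] cmod_sum_le_norm[of "z i" "z j"]
      by simp
    then have "(cmod (1 - (\<Sum>l\<in>UNIV. z i $ l * cnj (z j $ l))))\<^sup>2 \<le> (1 + s)\<^sup>2"
      by (rule power_mono) simp
    moreover have "(1 + s)\<^sup>2 = ((1 + s) / (1 - s))\<^sup>2 * ((1 - s) * (1 - s))"
      using s by (simp add: power_divide power2_eq_square)
    moreover have "((1 + s) / (1 - s))\<^sup>2 * ((1 - s) * (1 - s))
        < ((1 + s) / (1 - s))\<^sup>2 * ((1 - (norm (z i))\<^sup>2) * (1 - (norm (z j))\<^sup>2))"
      using s i j by (intro mult_strict_left_mono mult_strict_mono) auto
    ultimately show False using zz[OF i(1) j(1) ij] by (simp add: mult.assoc)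
  qed
  then have "card B \<le> 1" using A by (subst card_le_Suc0_iff_eq[unfolded One_nat_def[symmetric]]) (auto simp: B_def)
  moreover have "(\<Sum>i\<in>A. indicator {..<s} (1 - qform v / (cmod (hform (p i) v))\<^sup>2)) = real (card B)"
  proof -
    have "(\<Sum>i\<in>A. indicator {..<s} (1 - qform v / (cmod (hform (p i) v))\<^sup>2)) = (\<Sum>i\<in>A. if (norm (z i))\<^sup>2 < s then 1 else (0::real))"
      by (intro sum.cong) (auto simp: z)
    also have "\<dots> = (\<Sum>i\<in>B. 1)" unfolding B_def using A by (simp add: sum.If_cases Int_def)
    finally show ?thesis by simp
  qed
  ultimately show ?thesis by simp
qed

text \<open>Blichfeldt's density bound for sphere packings, transported to the ball model.\<close>

lemma blichfeldt_overlap: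
  fixes p :: "'a \<Rightarrow> complex ^ ('n::finite option)"
  assumes v: "qform v > 0" and A: "finite A" and p: "\<And>i. i \<in> A \<Longrightarrow> qform (p i) = 1"
    and \<kappa>: "\<kappa> > 1"
    and sep: "\<And>i j. i \<in> A \<Longrightarrow> j \<in> A \<Longrightarrow> i \<noteq> j \<Longrightarrow> cmod (hform (p i) (p j)) \<ge> \<kappa>"
  shows "(\<Sum>i\<in>A. max 0 (1 - (1 - qform v / (cmod (hform (p i) v))\<^sup>2) / ((\<kappa>\<^sup>2 - 1) / (2 * \<kappa>\<^sup>2)))) \<le> (1::real)"
proof -
  define K where "K = \<kappa>\<^sup>2"
  have K: "K > 1" using \<kappa> by (simp add: K_def one_less_power)
  have k0: "\<kappa> \<ge> 0" using \<kappa> by simp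
  define X where "X = (K - 1) / (2 * K)"
  have X: "X > 0" using K by (simp add: X_def)
  obtain z :: "'a \<Rightarrow> complex ^ 'n" where
    z: "\<And>i. i \<in> A \<Longrightarrow> 1 - qform v / (cmod (hform (p i) v))\<^sup>2 = (norm (z i))\<^sup>2"
    "\<And>i. i \<in> A \<Longrightarrow> norm (z i) < 1"
    and zz: "\<And>i j. i \<in> A \<Longrightarrow> j \<in> A \<Longrightarrow> i \<noteq> j \<Longrightarrow>
      K * (1 - (norm (z i))\<^sup>2) * (1 - (norm (z j))\<^sup>2) \<le> (cmod (1 - (\<Sum>l\<in>UNIV. z i $ l * cnj (z j $ l))))\<^sup>2"
    using ball_coordinates[of v A p \<kappa>] v p sep k0 unfolding K_def by blast
  define x where "x i = (norm (z i))\<^sup>2" for i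
  define B where "B = {i\<in>A. x i < X}"
  define N where "N = real (card B)"
  define S where "S = (\<Sum>i\<in>B. x i)"
  have B: "finite B" using A by (simp add: B_def)
  \<comment> \<open>Off the diagonal this is the separation condition expanded, with \<bar><z i, z
    j>\<bar>^2 estimated by x i * x j and then by K * x i * x j to remove the product terms. The
    last summand corrects the value at i = j to the exact 2 * x i, so the double sum can be
    evaluated as a whole.\<close>
  have pair: "2 * (z i \<bullet> z j) \<le> (1 - K) + K * (x i + x j) + (if i = j then (K - 1) + 2 * x i - 2 * K * x i else 0)"
    if "i \<in> B" "j \<in> B" for i j
  proof (cases "i = j")
    case True
    then show ?thesis by (simp add: x_def power2_norm_eq_inner)
  next
    case False
    define c where "c = (\<Sum>l\<in>UNIV. z i $ l * cnj (z j $ l))"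
    have Re: "Re c = z i \<bullet> z j" by (simp add: c_def inner_vec_def inner_complex_def)
    have "(cmod c)\<^sup>2 \<le> x i * x j"
      using power_mono[OF cmod_sum_le_norm[of "z i" "z j"], of 2] by (simp add: c_def x_def power_mult_distrib)
    moreover have "(cmod (1 - c))\<^sup>2 = 1 - 2 * Re c + (cmod c)\<^sup>2"
      unfolding cmod_power2 by (simp add: power2_eq_square algebra_simps)
    moreover have "K * (1 - x i) * (1 - x j) \<le> (cmod (1 - c))\<^sup>2"
      using zz[of i j] that False by (simp add: B_def x_def c_def)
    moreover have "x i * x j \<le> K * (x i * x j)" using K mult_right_mono[of 1 K "x i * x j"] by (simp add: x_def)
    ultimately have "2 * (z i \<bullet> z j) \<le> (1 - K) + K * (x i + x j)" by (simp add: Re algebra_simps)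
    then show ?thesis using False by simp
  qed
  \<comment> \<open>Blichfeldt's step: the squared norm of the sum of the points is nonnegative,
    which limits how many of them can lie close to the origin while being far from each
    other.\<close>
  have "0 \<le> 2 * ((\<Sum>i\<in>B. z i) \<bullet> (\<Sum>j\<in>B. z j))" by simp
  also have "\<dots> = (\<Sum>i\<in>B. \<Sum>j\<in>B. 2 * (z i \<bullet> z j))"
    by (simp add: inner_sum_left inner_sum_right sum_distrib_left) (rule sum.swap)
  also have "\<dots> \<le> (\<Sum>i\<in>B. \<Sum>j\<in>B. (1 - K) + K * (x i + x j) + (if i = j then (K - 1) + 2 * x i - 2 * K * x i else 0))"
    by (intro sum_mono pair)
  also have "\<dots> = (\<Sum>i\<in>B. N * (1 - K) + K * (N * x i + S) + ((K - 1) + 2 * x i - 2 * K * x i))"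
    unfolding sum.distrib distrib_left sum_distrib_left[symmetric]
    using B by (simp add: N_def S_def sum.distrib mult_ac sum_distrib_left sum_distrib_right cong: sum.cong)
  also have "\<dots> = N * N * (1 - K) + 2 * K * N * S + N * (K - 1) + 2 * S - 2 * K * S"
    by (simp add: sum.distrib sum_subtractf algebra_simps N_def S_def
        flip: sum_distrib_left sum_distrib_right)
  finally have main: "N * (N - 1) * (K - 1) \<le> 2 * S * (1 + K * (N - 1))" by (simp add: algebra_simps)
  have S0: "S \<ge> 0" by (simp add: S_def x_def sum_nonneg)
  have "N - S / X \<le> 1"
  proof (cases "card B = 0")
    case True
    then show ?thesis using divide_nonneg_pos[OF S0 X] by (simp add: N_def)
  next
    case False
    then have N: "N \<ge> 1" by (simp add: N_def)
    have "1 + K * (N - 1) \<le> K * N" using K by (simp add: algebra_simps)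
    then have "2 * S * (1 + K * (N - 1)) \<le> 2 * S * (K * N)" using S0 by (intro mult_left_mono) auto
    then have "N * ((N - 1) * (K - 1)) \<le> N * (2 * K * S)" using main by (simp add: algebra_simps)
    then have "(N - 1) * (K - 1) \<le> 2 * K * S" using N by simp
    then show ?thesis using K by (simp add: X_def field_simps)
  qed
  moreover have "(\<Sum>i\<in>A. max 0 (1 - (1 - qform v / (cmod (hform (p i) v))\<^sup>2) / ((\<kappa>\<^sup>2 - 1) / (2 * \<kappa>\<^sup>2)))) = N - S / X"
  proof -
    have "(\<Sum>i\<in>A. max 0 (1 - (1 - qform v / (cmod (hform (p i) v))\<^sup>2) / ((\<kappa>\<^sup>2 - 1) / (2 * \<kappa>\<^sup>2))))
      = (\<Sum>i\<in>A. max 0 (1 - x i / X))"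
      by (intro sum.cong refl) (simp only: z(1) x_def X_def K_def)
    also have "\<dots> = (\<Sum>i\<in>B. max 0 (1 - x i / X))"
      using A X by (intro sum.mono_neutral_right) (auto simp: B_def not_less max_def)
    also have "\<dots> = (\<Sum>i\<in>B. 1 - x i / X)"
      using X by (intro sum.cong) (auto simp: B_def max_def)
    finally show ?thesis by (simp add: sum_subtractf N_def S_def sum_divide_distrib)
  qed
  ultimately show ?thesis by simp
qed

section \<open>Reduction to radial integrals\<close>

definition vec_join :: "(complex ^ 'n::finite) \<times> complex \<Rightarrow> complex ^ ('n option)" where
  "vec_join y = (\<chi> i. case i of None \<Rightarrow> snd y | Some j \<Rightarrow> fst y $ j)"

lemma linear_vec_join: "linear vec_join"
  by (auto simp: linear_iff vec_join_def vec_eq_iff split: option.split)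

lemma measurable_vec_join [measurable]: "vec_join \<in> borel_measurable borel"
  using linear_vec_join by (auto intro!: borel_measurable_continuous_onI linear_continuous_on
        simp: linear_conv_bounded_linear)

lemma lborel_distr_vec_join: "distr lborel borel (vec_join :: (complex ^ 'n::finite) \<times> complex \<Rightarrow> _) = lborel"
proof (rule lborel_distr_basis_bij[OF linear_vec_join])
  have 1: "vec_join (axis j u, 0) = axis (Some j) u" for j :: 'n and u
    by (auto simp: vec_join_def vec_eq_iff axis_def split: option.split)
  have 2: "vec_join (0 :: complex ^ 'n, u) = axis None u" for u
    by (auto simp: vec_join_def vec_eq_iff axis_def split: option.split)
  have "inj (vec_join :: (complex ^ 'n) \<times> complex \<Rightarrow> _)"
  proof (rule injI)
    fix x y :: "(complex ^ 'n) \<times> complex" assume *: "vec_join x = vec_join y"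
    have "vec_join x $ None = vec_join y $ None" "vec_join x $ Some j = vec_join y $ Some j" for j
      by (simp_all add: *)
    then show "x = y" by (simp add: vec_join_def vec_eq_iff prod_eq_iff)
  qed
  moreover have "vec_join ` Basis = (Basis :: (complex ^ ('n option)) set)"
  proof -
    have "vec_join ` Basis = (\<Union>j. (\<lambda>u. vec_join (axis (j::'n) u, 0)) ` Basis) \<union> (\<lambda>u. vec_join (0 :: complex ^ 'n, u)) ` Basis"
      by (auto simp: Basis_prod_def Basis_vec_def image_iff)
    also have "\<dots> = (\<Union>i. axis i ` Basis)"
      unfolding 1 2 by (auto simp: image_iff) (metis not_Some_eq)
    also have "\<dots> = Basis" by (auto simp: Basis_vec_def)
    finally show ?thesis .
  qed
  ultimately show "bij_betw vec_join Basis (Basis :: (complex ^ ('n option)) set)"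
    by (auto simp: bij_betw_def intro: inj_on_subset)
qed

text \<open>Polar coordinates through distribution functions: both measures on the line agree on
  upper rays, which pull back to balls. The variable is -\<bar>x\<bar>^2 rather than \<bar>x\<bar>^2
  because \<open>measure_eqI_lessThan\<close> compares upper rays and needs them to have finite
  measure. In even real dimension the density is a polynomial in t.\<close>

lemma nn_integral_norm_square:
  fixes \<Psi> :: "real \<Rightarrow> ennreal"
  assumes d: "DIM('a::euclidean_space) = 2 * d" and [measurable]: "\<Psi> \<in> borel_measurable borel"
  shows "(\<integral>\<^sup>+(x::'a). \<Psi> ((norm x)\<^sup>2) \<partial>lborel)
    = ennreal (unit_ball_vol (real (2 * d))) * (\<integral>\<^sup>+t. indicator {0..} t * (ennreal (d * t ^ (d - 1)) * \<Psi> t) \<partial>lborel)"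
proof -
  have d0: "d > 0" using d DIM_positive[where 'a='a] by simp
  define c where "c = unit_ball_vol (real (2 * d))"
  have c: "c > 0" by (simp add: c_def)
  define M where "M = distr (lborel :: 'a measure) borel (\<lambda>x. - (norm x)\<^sup>2)"
  define N where "N = density lborel (\<lambda>t. ennreal (c * (d * (- t) ^ (d - 1))) * indicator {..0} t)"
  have emM: "emeasure M {t<..} = (if t < 0 then ennreal (c * (- t) ^ d) else 0)" for t
  proof -
    have "emeasure M {t<..} = emeasure lborel {x::'a. (norm x)\<^sup>2 < - t}"
      by (simp add: M_def emeasure_distr vimage_def less_minus_iff)
    also have "\<dots> = (if t < 0 then ennreal (c * (- t) ^ d) else 0)"
    proof (cases "t < 0")
      case True
      have "(norm x)\<^sup>2 < - t \<longleftrightarrow> norm x < sqrt (- t)" for x :: 'a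
        by (metis abs_norm_cancel real_sqrt_abs real_sqrt_less_iff)
      then have "{x::'a. (norm x)\<^sup>2 < - t} = ball 0 (sqrt (- t))"
        by (simp only: mem_ball_0 set_eq_iff mem_Collect_eq) simp
      then have "emeasure lborel {x::'a. (norm x)\<^sup>2 < - t} = ennreal (c * sqrt (- t) ^ (2 * d))"
        using True by (simp add: emeasure_ball d c_def)
      also have "sqrt (- t) ^ (2 * d) = (- t) ^ d" using True by (simp add: power_mult)
      finally show ?thesis using True by simp
    next
      case False
      then have "{x::'a. (norm x)\<^sup>2 < - t} = {}"
        by (auto simp: not_less intro: order_trans[OF _ zero_le_power2])
      then show ?thesis using False by simp
    qed
    finally show ?thesis .
  qed
  have emN: "emeasure N {t<..} = (if t < 0 then ennreal (c * (- t) ^ d) else 0)" for t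
  proof -
    have "emeasure N {t<..} = (\<integral>\<^sup>+x. ennreal (c * (d * (- x) ^ (d - 1))) * indicator {..0} x * indicator {t<..} x \<partial>lborel)"
      unfolding N_def by (subst emeasure_density) auto
    also have "\<dots> = (\<integral>\<^sup>+x. ennreal (c * (d * (- x) ^ (d - 1))) * indicator {t..0} x \<partial>lborel)"
      by (intro nn_integral_cong_AE) (use AE_lborel_singleton[of t] in eventually_elim, auto simp: indicator_def)
    also have "\<dots> = (if t < 0 then ennreal (c * (- t) ^ d) else 0)"
    proof (cases "t < 0")
      case True
      have "(\<integral>\<^sup>+x. ennreal (c * (d * (- x) ^ (d - 1))) * indicator {t..0} x \<partial>lborel)
        = ennreal (- c * (- 0) ^ d - (- c * (- t) ^ d))"
      proof (rule nn_integral_FTC_Icc)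
        fix x assume "x \<in> {t..0}"
        show "((\<lambda>x. - c * (- x) ^ d) has_real_derivative c * (d * (- x) ^ (d - 1))) (at x)"
          by (auto intro!: derivative_eq_intros)
        show "0 \<le> c * (d * (- x) ^ (d - 1))" using \<open>x \<in> {t..0}\<close> c by simp
      qed (use True in auto)
      then show ?thesis using True d0 by (simp add: zero_power)
    next
      case False
      have "(\<integral>\<^sup>+x. ennreal (c * (d * (- x) ^ (d - 1))) * indicator {t..0} x \<partial>lborel) = (\<integral>\<^sup>+x. 0 \<partial>(lborel::real measure))"
        by (intro nn_integral_cong_AE) (use AE_lborel_singleton[of 0] in eventually_elim, use False in \<open>auto simp: indicator_def\<close>)
      then show ?thesis using False by simp
    qed
    finally show ?thesis .
  qed
  have "M = N"
    by (rule measure_eqI_lessThan) (auto simp: emM emN M_def[THEN arg_cong[of _ _ sets]] N_def[THEN arg_cong[of _ _ sets]])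
  have "(\<integral>\<^sup>+(x::'a). \<Psi> ((norm x)\<^sup>2) \<partial>lborel) = (\<integral>\<^sup>+t. \<Psi> (- t) \<partial>M)"
    unfolding M_def by (subst nn_integral_distr) auto
  also have "\<dots> = (\<integral>\<^sup>+t. ennreal (c * (d * (- t) ^ (d - 1))) * indicator {..0} t * \<Psi> (- t) \<partial>lborel)"
    unfolding \<open>M = N\<close> N_def by (subst nn_integral_density) auto
  also have "\<dots> = (\<integral>\<^sup>+t. ennreal (c * (d * t ^ (d - 1))) * indicator {..0} (- t) * \<Psi> t \<partial>lborel)"
    by (subst nn_integral_real_affine[of _ "-1" 0]) auto
  also have "\<dots> = (\<integral>\<^sup>+t. ennreal c * (indicator {0..} t * (ennreal (d * t ^ (d - 1)) * \<Psi> t)) \<partial>lborel)"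
    using c by (intro nn_integral_cong) (auto simp: indicator_def ennreal_mult' mult_ac)
  also have "\<dots> = ennreal c * (\<integral>\<^sup>+t. indicator {0..} t * (ennreal (d * t ^ (d - 1)) * \<Psi> t) \<partial>lborel)"
    by (subst nn_integral_cmult) auto
  finally show ?thesis by (simp add: c_def)
qed

text \<open>The variable is t = sinh^2 (d/2), so that t/(t + 1) = tanh^2 (d/2) and 1/sqrt (t + 1) =
  1/cosh (d/2).\<close>

definition radial_integral :: "nat \<Rightarrow> nat \<Rightarrow> (real \<Rightarrow> real) \<Rightarrow> ennreal" where
  "radial_integral n k H = (\<integral>\<^sup>+t. indicator {0..} t * (ennreal (n * t ^ (n - 1))
      * ennreal (H (t / (t + 1)) * (1 / sqrt (t + 1)) ^ k)) \<partial>lborel)"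

text \<open>Polar coordinates are used in the last entry and then in the remaining entries x, with e
  = \<open>qform v\<close> and \<bar>x\<bar>^2 = e t. The weight depends on t alone, and the powers
  of e integrate over the shell to a constant. That constant is the same for all k and H and will
  cancel; all that matters is that it is neither 0 nor infinite.\<close>

lemma cone_integral_eq_radial:
  obtains \<kappa> :: ennreal where "\<kappa> \<noteq> 0" "\<kappa> \<noteq> \<infinity>"
    "\<And>k H. H \<in> borel_measurable borel \<Longrightarrow> cone_integral TYPE('n::finite) k H = \<kappa> * radial_integral CARD('n) k H"
proof -
  let ?n = "CARD('n)"
  define K where "K = (\<integral>\<^sup>+e. indicator {1<..<2} e * ennreal (e ^ ?n) \<partial>(lborel :: real measure))"
  define c where "c = unit_ball_vol (real (2 * ?n))"
  have c: "c > 0" by (simp add: c_def)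
  have Klo: "K \<ge> 1"
  proof -
    have "(1::ennreal) = (\<integral>\<^sup>+e. indicator {1<..<2} e \<partial>(lborel :: real measure))" by simp
    also have "\<dots> \<le> K" unfolding K_def
      by (intro nn_integral_mono) (auto simp: indicator_def ennreal_ge_1)
    finally show ?thesis .
  qed
  have Khi: "K \<noteq> \<infinity>"
  proof -
    have "K \<le> (\<integral>\<^sup>+e. ennreal (2 ^ ?n) * indicator {1<..<2} e \<partial>(lborel :: real measure))" unfolding K_def
      by (intro nn_integral_mono) (auto simp: indicator_def intro!: ennreal_leI power_mono)
    also have "\<dots> = ennreal (2 ^ ?n)" by (subst nn_integral_cmult) auto
    finally show ?thesis by (auto simp: top_unique)
  qed
  show ?thesis
  proof (rule that[of "ennreal pi * (ennreal c * K)"])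
    show "ennreal pi * (ennreal c * K) \<noteq> 0" using Klo c pi_gt_zero by (auto simp: ennreal_eq_0_iff not_le[symmetric])
    show "ennreal pi * (ennreal c * K) \<noteq> \<infinity>" using Khi by (auto simp: ennreal_mult_eq_top_iff)
    fix k and H :: "real \<Rightarrow> real" assume [measurable]: "H \<in> borel_measurable borel"
    define \<Phi> where "\<Phi> a e = ennreal (H (a / (a + e)) * (sqrt e / sqrt (a + e)) ^ k)" for a e
    have [measurable]: "(\<lambda>(a, e). \<Phi> a e) \<in> borel_measurable (borel \<Otimes>\<^sub>M borel)"
      unfolding \<Phi>_def by measurable
    have qv: "qform (vec_join (x, \<mu>)) = (cmod \<mu>)\<^sup>2 - (norm x)\<^sup>2" for x :: "complex ^ 'n" and \<mu>
      by (simp add: qform_def vec_join_def norm_vec_def L2_set_def sum_nonneg)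
    have vN: "vec_join (x, \<mu>) $ None = \<mu>" for x :: "complex ^ 'n" and \<mu> by (simp add: vec_join_def)
    have "cone_integral TYPE('n) k H
      = (\<integral>\<^sup>+v. indicator neg_shell v * ennreal (base_weight k H v) \<partial>(distr lborel borel (vec_join :: (complex ^ 'n) \<times> complex \<Rightarrow> _)))"
      by (simp add: cone_integral_def lborel_distr_vec_join)
    also have "\<dots> = (\<integral>\<^sup>+y. indicator neg_shell (vec_join y) * ennreal (base_weight k H (vec_join (y :: (complex ^ 'n) \<times> complex))) \<partial>lborel)"
      unfolding base_weight_def by (rule nn_integral_distr) measurable
    also have "\<dots> = (\<integral>\<^sup>+y. (case y of (x, \<mu>) \<Rightarrow> indicator {1<..<2} ((cmod \<mu>)\<^sup>2 - (norm x)\<^sup>2) * \<Phi> ((norm x)\<^sup>2) ((cmod \<mu>)\<^sup>2 - (norm x)\<^sup>2))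
          \<partial>(lborel :: ((complex ^ 'n) \<times> complex) measure))"
    proof (intro nn_integral_cong)
      fix y :: "(complex ^ 'n) \<times> complex"
      obtain x \<mu> where y: "y = (x, \<mu>)" by (cases y)
      define b where "b = (cmod \<mu>)\<^sup>2"
      define a where "a = (norm x)\<^sup>2"
      have a: "a \<ge> 0" by (simp add: a_def)
      have sb: "cmod \<mu> = sqrt b" by (simp add: b_def)
      show "indicator neg_shell (vec_join y) * ennreal (base_weight k H (vec_join y))
        = (case y of (x, \<mu>) \<Rightarrow> indicator {1<..<2} ((cmod \<mu>)\<^sup>2 - (norm x)\<^sup>2) * \<Phi> ((norm x)\<^sup>2) ((cmod \<mu>)\<^sup>2 - (norm x)\<^sup>2))"
      proof (cases "1 < b - a \<and> b - a < 2")
        case True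
        then have "b > 0" using a by linarith
        then have "1 - (b - a) / b = a / b" by (simp add: field_simps)
        then show ?thesis using True \<open>b > 0\<close>
          by (simp add: y neg_shell_def qv base_weight_def vN \<Phi>_def indicator_def b_def[symmetric] a_def[symmetric] sb)
      next
        case False
        then show ?thesis by (auto simp: y neg_shell_def qv indicator_def b_def[symmetric] a_def[symmetric])
      qed
    qed
    also have "\<dots> = (\<integral>\<^sup>+x. (\<integral>\<^sup>+\<mu>. indicator {1<..<2} ((cmod \<mu>)\<^sup>2 - (norm x)\<^sup>2) * \<Phi> ((norm x)\<^sup>2) ((cmod \<mu>)\<^sup>2 - (norm x)\<^sup>2)
          \<partial>lborel) \<partial>(lborel :: (complex ^ 'n) measure))"
      unfolding lborel_prod[symmetric] by (subst lborel.nn_integral_fst[symmetric]) auto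
    also have "\<dots> = (\<integral>\<^sup>+x. ennreal pi * (\<integral>\<^sup>+e. indicator {1<..<2} e * \<Phi> ((norm x)\<^sup>2) e \<partial>lborel) \<partial>(lborel :: (complex ^ 'n) measure))"
    proof (intro nn_integral_cong)
      fix x :: "complex ^ 'n"
      define a where "a = (norm x)\<^sup>2"
      have a: "a \<ge> 0" by (simp add: a_def)
      have "(\<integral>\<^sup>+\<mu>. indicator {1<..<2} ((cmod \<mu>)\<^sup>2 - a) * \<Phi> a ((cmod \<mu>)\<^sup>2 - a) \<partial>lborel)
        = ennreal (unit_ball_vol (real (2 * 1))) * (\<integral>\<^sup>+t. indicator {0..} t * (ennreal (real 1 * t ^ (1 - 1)) * (indicator {1<..<2} (t - a) * \<Phi> a (t - a))) \<partial>lborel)"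
        by (rule nn_integral_norm_square) auto
      also have "unit_ball_vol (real (2 * 1)) = pi" by (simp add: unit_ball_vol_2)
      also have "(\<integral>\<^sup>+t. indicator {0..} t * (ennreal (real 1 * t ^ (1 - 1)) * (indicator {1<..<2} (t - a) * \<Phi> a (t - a))) \<partial>lborel)
        = (\<integral>\<^sup>+t. indicator {1<..<2} (t - a) * \<Phi> a (t - a) \<partial>lborel)"
        using a by (intro nn_integral_cong) (auto simp: indicator_def)
      also have "\<dots> = (\<integral>\<^sup>+e. indicator {1<..<2} e * \<Phi> a e \<partial>lborel)"
        by (subst nn_integral_real_affine[of _ 1 a]) auto
      finally show "(\<integral>\<^sup>+\<mu>. indicator {1<..<2} ((cmod \<mu>)\<^sup>2 - (norm x)\<^sup>2) * \<Phi> ((norm x)\<^sup>2) ((cmod \<mu>)\<^sup>2 - (norm x)\<^sup>2) \<partial>lborel)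
        = ennreal pi * (\<integral>\<^sup>+e. indicator {1<..<2} e * \<Phi> ((norm x)\<^sup>2) e \<partial>lborel)"
        by (simp add: a_def)
    qed
    also have "\<dots> = ennreal pi * (\<integral>\<^sup>+x. (\<integral>\<^sup>+e. indicator {1<..<2} e * \<Phi> ((norm x)\<^sup>2) e \<partial>lborel) \<partial>(lborel :: (complex ^ 'n) measure))"
      by (rule nn_integral_cmult) measurable
    also have "(\<integral>\<^sup>+x. (\<integral>\<^sup>+e. indicator {1<..<2} e * \<Phi> ((norm x)\<^sup>2) e \<partial>lborel) \<partial>(lborel :: (complex ^ 'n) measure))
      = (\<integral>\<^sup>+e. (\<integral>\<^sup>+x. indicator {1<..<2} e * \<Phi> ((norm x)\<^sup>2) e \<partial>(lborel :: (complex ^ 'n) measure)) \<partial>lborel)"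
      by (rule lborel_pair.Fubini') measurable
    also have "\<dots> = (\<integral>\<^sup>+e. (indicator {1<..<2} e * ennreal (e ^ ?n)) * (ennreal c * radial_integral ?n k H) \<partial>lborel)"
    proof (intro nn_integral_cong)
      fix e :: real
      show "(\<integral>\<^sup>+x. indicator {1<..<2} e * \<Phi> ((norm x)\<^sup>2) e \<partial>(lborel :: (complex ^ 'n) measure))
        = (indicator {1<..<2} e * ennreal (e ^ ?n)) * (ennreal c * radial_integral ?n k H)"
      proof (cases "e \<in> {1<..<2}")
        case True
        then have e: "e > 0" by simp
        have "(\<integral>\<^sup>+x. \<Phi> ((norm x)\<^sup>2) e \<partial>(lborel :: (complex ^ 'n) measure))
          = ennreal c * (\<integral>\<^sup>+t. indicator {0..} t * (ennreal (?n * t ^ (?n - 1)) * \<Phi> t e) \<partial>lborel)"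
          unfolding c_def by (rule nn_integral_norm_square) auto
        also have "(\<integral>\<^sup>+t. indicator {0..} t * (ennreal (?n * t ^ (?n - 1)) * \<Phi> t e) \<partial>lborel)
          = ennreal e * (\<integral>\<^sup>+t. indicator {0..} (e * t) * (ennreal (?n * (e * t) ^ (?n - 1)) * \<Phi> (e * t) e) \<partial>lborel)"
          using e by (subst nn_integral_real_affine[of _ e 0]) auto
        also have "(\<integral>\<^sup>+t. indicator {0..} (e * t) * (ennreal (?n * (e * t) ^ (?n - 1)) * \<Phi> (e * t) e) \<partial>lborel)
          = (\<integral>\<^sup>+t. ennreal (e ^ (?n - 1)) * (indicator {0..} t * (ennreal (?n * t ^ (?n - 1))
      * ennreal (H (t / (t + 1)) * (1 / sqrt (t + 1)) ^ k))) \<partial>lborel)"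
        proof (intro nn_integral_cong)
          fix t :: real
          show "indicator {0..} (e * t) * (ennreal (?n * (e * t) ^ (?n - 1)) * \<Phi> (e * t) e)
            = ennreal (e ^ (?n - 1)) * (indicator {0..} t * (ennreal (?n * t ^ (?n - 1))
              * ennreal (H (t / (t + 1)) * (1 / sqrt (t + 1)) ^ k)))"
          proof (cases "t \<ge> 0")
            case True
            have et: "e * t + e = e * (t + 1)" by (simp add: algebra_simps)
            have "\<Phi> (e * t) e = ennreal (H (t / (t + 1)) * (1 / sqrt (t + 1)) ^ k)"
              unfolding \<Phi>_def et using e by (simp add: real_sqrt_mult)
            moreover have "ennreal (?n * (e * t) ^ (?n - 1)) = ennreal (e ^ (?n - 1)) * ennreal (?n * t ^ (?n - 1))"
              using e True by (simp add: power_mult_distrib mult_ac flip: ennreal_mult)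
            ultimately show ?thesis using e True by (simp add: mult_ac)
          next
            case False
            then show ?thesis using e by (simp add: zero_le_mult_iff)
          qed
        qed
        also have "\<dots> = ennreal (e ^ (?n - 1)) * radial_integral ?n k H"
          unfolding radial_integral_def by (rule nn_integral_cmult) measurable
        also have "ennreal e * (ennreal (e ^ (?n - 1)) * radial_integral ?n k H) = ennreal (e ^ ?n) * radial_integral ?n k H"
        proof -
          have "e * e ^ (?n - 1) = e ^ ?n" by (simp add: power_eq_if)
          moreover have "ennreal e * ennreal (e ^ (?n - 1)) = ennreal (e * e ^ (?n - 1))"
            using e by (intro ennreal_mult[symmetric]) auto
          ultimately show ?thesis by (simp only: mult.assoc[symmetric])
        qed
        finally show ?thesis using True by (simp add: mult_ac)
      qed simp
    qed
    also have "\<dots> = K * (ennreal c * radial_integral ?n k H)"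
      unfolding K_def by (rule nn_integral_multc) measurable
    finally show "cone_integral TYPE('n) k H = ennreal pi * (ennreal c * K) * radial_integral ?n k H"
      by (simp add: mult_ac)
  qed
qed

text \<open>The primitive, vanishing at 0, of 2n (1 - x^2)^(n-1) x^(l+1), written out by the
  binomial theorem: an incomplete beta integral in x^2, with value n B(l/2 + 1, n) at 1. The
  variable is x = 1/cosh (d/2), and l = k - 2n - 2 measures the distance of k from the smallest
  admissible value.\<close>

definition beta_prim :: "nat \<Rightarrow> nat \<Rightarrow> real \<Rightarrow> real" where
  "beta_prim n l x = 2 * real n * (\<Sum>j\<le>n-1. of_nat ((n - 1) choose j) * (-1) ^ j * x ^ (l + 2 + 2 * j) / real (l + 2 + 2 * j))"

lemma DERIV_beta_prim [derivative_intros]: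
  assumes "(g has_real_derivative g') (at x)"
  shows "((\<lambda>x. beta_prim n l (g x)) has_real_derivative 2 * real n * (1 - (g x)\<^sup>2) ^ (n - 1) * (g x) ^ (l + 1) * g') (at x)"
proof -
  have 1: "((\<lambda>x. x ^ (l + 2 + 2 * j) / real (l + 2 + 2 * j)) has_real_derivative x ^ (l + 1 + 2 * j)) (at x)" for j and x :: real
    using DERIV_cdivide[OF DERIV_pow[of "l + 2 + 2 * j" x], of "real (l + 2 + 2 * j)"]
    by (simp del: of_nat_add of_nat_mult of_nat_Suc)
  have 2: "((\<lambda>x. of_nat ((n - 1) choose j) * (-1) ^ j * x ^ (l + 2 + 2 * j) / real (l + 2 + 2 * j))
     has_real_derivative of_nat ((n - 1) choose j) * (-1) ^ j * x ^ (l + 1 + 2 * j)) (at x)" for j and x :: real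
    using DERIV_cmult[OF 1, of "of_nat ((n - 1) choose j) * (-1) ^ j"] by (simp add: mult.assoc)
  have "(1 - y\<^sup>2) ^ (n - 1) * y ^ (l + 1) = (\<Sum>j\<le>n-1. of_nat ((n - 1) choose j) * (-1) ^ j * y ^ (l + 1 + 2 * j))" for y :: real
  proof -
    have "(1 - y\<^sup>2) ^ (n - 1) = (- y\<^sup>2 + 1) ^ (n - 1)" by simp
    also have "\<dots> = (\<Sum>j\<le>n-1. of_nat ((n - 1) choose j) * (- y\<^sup>2) ^ j * 1 ^ (n - 1 - j))"
      by (rule binomial_ring)
    also have "\<dots> = (\<Sum>j\<le>n-1. of_nat ((n - 1) choose j) * (-1) ^ j * y ^ (2 * j))"
      by (intro sum.cong refl) (simp add: power_mult power_minus[of "y\<^sup>2"])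
    finally show ?thesis by (simp add: sum_distrib_left power_add mult_ac)
  qed
  then have "(beta_prim n l has_real_derivative 2 * real n * ((1 - y\<^sup>2) ^ (n - 1) * y ^ (l + 1))) (at y)" for y :: real
    unfolding beta_prim_def by (simp only:) (intro DERIV_cmult DERIV_sum 2)
  from DERIV_chain2[OF this assms] show ?thesis by (simp add: mult.assoc)
qed

lemma beta_prim_0 [simp]: "beta_prim n l 0 = 0"
  by (simp add: beta_prim_def)

lemma DERIV_radial_primitive:
  assumes t: "t \<ge> 0" and n: "n \<ge> 1"
  shows "((\<lambda>t. - beta_prim n l (1 / sqrt (t + 1))) has_real_derivative
    real n * t ^ (n - 1) * (1 / sqrt (t + 1)) ^ (2 * n + 2 + l)) (at t)"
proof -
  define x where "x = 1 / sqrt (t + 1)"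
  have x2: "x\<^sup>2 * (t + 1) = 1" using t by (simp add: x_def power_divide)
  have "((\<lambda>t. 1 / sqrt (t + 1)) has_real_derivative - (x ^ 3 / 2)) (at t)"
    using t by (auto intro!: derivative_eq_intros simp: x_def field_simps power3_eq_cube)
  from DERIV_minus[OF DERIV_beta_prim[OF this, of n l], folded x_def]
  have "((\<lambda>t. - beta_prim n l (1 / sqrt (t + 1))) has_real_derivative
    - (2 * real n * (1 - x\<^sup>2) ^ (n - 1) * x ^ (l + 1) * - (x ^ 3 / 2))) (at t)" .
  moreover have "- (2 * real n * (1 - x\<^sup>2) ^ (n - 1) * x ^ (l + 1) * - (x ^ 3 / 2)) = real n * ((1 - x\<^sup>2) ^ (n - 1) * x ^ (l + 4))"
    by (simp add: power_add numeral_eq_Suc)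
  ultimately have "((\<lambda>t. - beta_prim n l (1 / sqrt (t + 1))) has_real_derivative
    real n * ((1 - x\<^sup>2) ^ (n - 1) * x ^ (l + 4))) (at t)" by (simp only:)
  moreover have "1 - x\<^sup>2 = t * x\<^sup>2" using x2 by (simp add: algebra_simps)
  then have "(1 - x\<^sup>2) ^ (n - 1) * x ^ (l + 4) = t ^ (n - 1) * (x ^ (2 * (n - 1)) * x ^ (l + 4))"
    by (simp add: power_mult_distrib power_mult)
  moreover have "x ^ (2 * (n - 1)) * x ^ (l + 4) = x ^ (2 * n + 2 + l)"
    using n by (simp add: power_add[symmetric] algebra_simps)
  ultimately show ?thesis by (simp only: x_def[symmetric] mult.assoc)
qed

lemma radial_integral_one:
  assumes n: "n \<ge> 1"
  shows "radial_integral n (2 * n + 2 + l) (\<lambda>_. 1) = ennreal (beta_prim n l 1)"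
proof -
  let ?f = "\<lambda>t::real. real n * t ^ (n - 1) * (1 / sqrt (t + 1)) ^ (2 * n + 2 + l)"
  have lim: "((\<lambda>t. - beta_prim n l (1 / sqrt (t + 1))) \<longlongrightarrow> - beta_prim n l 0) at_top"
  proof -
    have c: "isCont (beta_prim n l) 0" using DERIV_isCont[OF DERIV_beta_prim[OF DERIV_ident]] .
    have "filterlim (\<lambda>t::real. 1 + t) at_top at_top"
      by (rule filterlim_tendsto_add_at_top[OF tendsto_const filterlim_ident])
    then have "filterlim (\<lambda>t::real. t + 1) at_top at_top" by (simp add: add.commute)
    then have z: "((\<lambda>t::real. 1 / sqrt (t + 1)) \<longlongrightarrow> 0) at_top"
      by (intro tendsto_divide_0[OF tendsto_const] filterlim_at_top_imp_at_infinity
          filterlim_compose[OF sqrt_at_top])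
    show ?thesis by (rule tendsto_minus[OF isCont_tendsto_compose[OF c z]])
  qed
  have "radial_integral n (2 * n + 2 + l) (\<lambda>_. 1) = (\<integral>\<^sup>+t. ennreal (?f t) * indicator {0..} t \<partial>lborel)"
    unfolding radial_integral_def
    by (intro nn_integral_cong) (auto simp: indicator_def simp flip: ennreal_mult)
  also have "\<dots> = ennreal (- beta_prim n l 0 - (- beta_prim n l (1 / sqrt (0 + 1))))"
    by (rule nn_integral_FTC_atLeast[OF _ DERIV_radial_primitive[OF _ n] _ lim]) auto
  finally show ?thesis by simp
qed

lemma radial_integral_ball:
  assumes n: "n \<ge> 1" and s: "0 < s" "s < 1"
  shows "radial_integral n (2 * n + 2 + l) (indicator {..<s}) = ennreal (beta_prim n l 1 - beta_prim n l (sqrt (1 - s)))"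
proof -
  let ?f = "\<lambda>t::real. real n * t ^ (n - 1) * (1 / sqrt (t + 1)) ^ (2 * n + 2 + l)"
  define u where "u = s / (1 - s)"
  have u: "u > 0" using s by (simp add: u_def)
  have u1: "1 / sqrt (u + 1) = sqrt (1 - s)"
  proof -
    have "u + 1 = 1 / (1 - s)" using s by (simp add: u_def field_simps)
    then show ?thesis by (simp add: real_sqrt_divide)
  qed
  have us: "t / (t + 1) < s \<longleftrightarrow> t < u" if "t \<ge> 0" for t
    using that s by (simp add: u_def field_simps)
  have "radial_integral n (2 * n + 2 + l) (indicator {..<s}) = (\<integral>\<^sup>+t. ennreal (?f t) * indicator {0..u} t \<partial>lborel)"
    unfolding radial_integral_def
    by (intro nn_integral_cong_AE, use AE_lborel_singleton[of u] in eventually_elim)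
      (auto simp: indicator_def us simp flip: ennreal_mult)
  also have "\<dots> = ennreal (- beta_prim n l (1 / sqrt (u + 1)) - (- beta_prim n l (1 / sqrt (0 + 1))))"
    using u n by (intro nn_integral_FTC_Icc DERIV_radial_primitive) auto
  finally show ?thesis by (simp add: u1)
qed

text \<open>The integrand decreases in k, so k = 8 serves all smaller values. For k = 8 the
  substitution x = t/(t + 1) makes it the polynomial 2x (1 - x) (1 - x/X). Cutting at u = X/(1 - X)
  loses nothing, as the weight vanishes beyond.\<close>

lemma radial_integral_blichfeldt:
  assumes X: "0 < X" "X < 1" and k: "k \<le> 8"
  shows "ennreal (X\<^sup>2 / 3 * (1 - X / 2)) \<le> radial_integral 2 k (\<lambda>x. max 0 (1 - x / X))"
proof -
  define u where "u = X / (1 - X)"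
  define P where "P x = x\<^sup>2 - 2 * x ^ 3 / 3 - (2 * x ^ 3 / 3 - x ^ 4 / 2) / X" for x
  have u: "u > 0" using X by (simp add: u_def)
  have uX: "u / (u + 1) = X" using X by (simp add: u_def field_simps)
  have us: "t / (t + 1) \<le> X" if "t \<in> {0..u}" for t
    using that X by (simp add: u_def field_simps)
  let ?f = "\<lambda>t::real. 2 * t * (1 / (t + 1)) ^ 4 * (1 - t / (t + 1) / X)"
  have "(\<integral>\<^sup>+t. ennreal (?f t) * indicator {0..u} t \<partial>lborel) = ennreal (P (u / (u + 1)) - P (0 / (0 + 1)))"
  proof (rule nn_integral_FTC_Icc)
    fix t assume t: "t \<in> {0..u}"
    define x where "x = t / (t + 1)"
    have d: "((\<lambda>t. t / (t + 1)) has_real_derivative (1 / (t + 1))\<^sup>2) (at t)"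
      using t by (auto intro!: derivative_eq_intros simp: field_simps power2_eq_square)
    have P': "(P has_real_derivative 2 * x * (1 - x) * (1 - x / X)) (at x)"
      unfolding P_def using X by (auto intro!: derivative_eq_intros simp: field_simps power2_eq_square power3_eq_cube)
    have "((\<lambda>t. P (t / (t + 1))) has_real_derivative 2 * x * (1 - x) * (1 - x / X) * (1 / (t + 1))\<^sup>2) (at t)"
      using DERIV_chain2[OF P'[unfolded x_def] d] by (simp add: x_def)
    moreover have "1 - x = 1 / (t + 1)" "x = t * (1 / (t + 1))" using t by (auto simp: x_def field_simps)
    then have "2 * x * (1 - x) * (1 - x / X) * (1 / (t + 1))\<^sup>2 = ?f t"
      by (simp add: x_def power2_eq_square numeral_eq_Suc)
    ultimately show "((\<lambda>t. P (t / (t + 1))) has_real_derivative ?f t) (at t)" by simp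
    show "0 \<le> ?f t" using us[OF t] t X by (intro mult_nonneg_nonneg) (auto simp: divide_le_eq mult.commute)
  qed (use u in auto)
  also have "P (u / (u + 1)) - P (0 / (0 + 1)) = X\<^sup>2 / 3 * (1 - X / 2)"
    unfolding uX using X by (simp add: P_def field_simps power2_eq_square power3_eq_cube numeral_eq_Suc)
  finally have int: "(\<integral>\<^sup>+t. ennreal (?f t) * indicator {0..u} t \<partial>lborel) = ennreal (X\<^sup>2 / 3 * (1 - X / 2))" .
  have "(\<integral>\<^sup>+t. ennreal (?f t) * indicator {0..u} t \<partial>lborel) \<le> radial_integral 2 k (\<lambda>x. max 0 (1 - x / X))"
    unfolding radial_integral_def
  proof (rule nn_integral_mono)
    fix t :: real
    show "ennreal (?f t) * indicator {0..u} t \<le> indicator {0..} t * (ennreal (real 2 * t ^ (2 - 1))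
      * ennreal (max 0 (1 - t / (t + 1) / X) * (1 / sqrt (t + 1)) ^ k))"
    proof (cases "t \<in> {0..u}")
      case True
      have h: "0 \<le> 1 - t / (t + 1) / X" using us[OF True] X True by (simp add: divide_le_eq mult.commute)
      have "(1 / (t + 1)) ^ 4 = (1 / sqrt (t + 1)) ^ 8"
      proof -
        have "sqrt (t + 1) ^ 8 = ((sqrt (t + 1))\<^sup>2) ^ 4" unfolding power_mult[symmetric] by simp
        also have "(sqrt (t + 1))\<^sup>2 = t + 1" using True by simp
        finally show ?thesis by (simp only: power_divide power_one)
      qed
      also have "\<dots> \<le> (1 / sqrt (t + 1)) ^ k"
        using True k by (intro power_decreasing) (auto simp: divide_le_eq)
      finally have "2 * t * (1 - t / (t + 1) / X) * (1 / (t + 1)) ^ 4 \<le> 2 * t * (1 - t / (t + 1) / X) * (1 / sqrt (t + 1)) ^ k"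
        using h True by (intro mult_left_mono) auto
      then have "ennreal (?f t) \<le> ennreal (2 * t * ((1 - t / (t + 1) / X) * (1 / sqrt (t + 1)) ^ k))"
        by (intro ennreal_leI) (simp only: mult_ac)
      also have "\<dots> = ennreal (2 * t) * ennreal ((1 - t / (t + 1) / X) * (1 / sqrt (t + 1)) ^ k)"
        using True h by (intro ennreal_mult mult_nonneg_nonneg) auto
      finally show ?thesis using True h by (simp add: max_def)
    qed simp
  qed
  then show ?thesis by (simp only: int)
qed

section \<open>Inequalities for incomplete beta integrals\<close>

lemma beta_prim_pos:
  assumes "n \<ge> 1"
  shows "beta_prim n l 1 > 0"
proof -
  have D: "\<And>x. (beta_prim n l has_real_derivative 2 * real n * (1 - x\<^sup>2) ^ (n - 1) * x ^ (l + 1)) (at x)"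
    using DERIV_beta_prim[OF DERIV_ident] by simp
  have "\<exists>z>0. z < 1 \<and> beta_prim n l 1 - beta_prim n l 0 = (1 - 0) * (2 * real n * (1 - z\<^sup>2) ^ (n - 1) * z ^ (l + 1))"
    by (rule MVT2) (use D in auto)
  then obtain z where z: "0 < z" "z < 1" "beta_prim n l 1 = 2 * real n * (1 - z\<^sup>2) ^ (n - 1) * z ^ (l + 1)"
    by auto
  have "1 - z\<^sup>2 > 0" using z by (simp add: abs_square_less_1)
  then show ?thesis using z assms by simp
qed

text \<open>With \<open>s = 1 - x\<^sup>2\<close> the difference of both sides, times \<open>c s\<^sup>n\<close>, vanishes at \<open>x = 1\<close> and has
  derivative \<open>-2 n x s\<^sup>n\<^sup>-\<^sup>1\<close> times the difference of the two sides of the hypothesis.\<close>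

lemma beta_ratio_criterion:
  assumes n: "n \<ge> 2" and \<rho>: "0 < \<rho>" "\<rho> < 1"
    and q: "\<And>x. 0 < x \<Longrightarrow> x < 1 \<Longrightarrow> real (l + 1) * beta_prim n l x \<le> x ^ l * (1 + real (l + 1) * (1 - x\<^sup>2) ^ n)"
  shows "beta_prim n l 1 \<le> (beta_prim n l 1 - beta_prim n l \<rho>) * (1 + 1 / (real (l + 1) * (1 - \<rho>\<^sup>2) ^ n))"
proof -
  define c where "c = real (l + 1)"
  have c: "c > 0" by (simp add: c_def)
  define \<beta> where "\<beta> = beta_prim n l 1"
  define Q where "Q x = (\<beta> - beta_prim n l x) * (1 + c * (1 - x\<^sup>2) ^ n) - c * \<beta> * (1 - x\<^sup>2) ^ n" for x
  have D: "(Q has_real_derivative - (2 * real n * x * (1 - x\<^sup>2) ^ (n - 1)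
      * (x ^ l * (1 + c * (1 - x\<^sup>2) ^ n) - c * beta_prim n l x))) (at x)" for x
    unfolding Q_def by (auto intro!: derivative_eq_intros) (simp add: algebra_simps)
  have "Q 1 \<le> Q \<rho>"
  proof (rule DERIV_nonpos_imp_nonincreasing[of \<rho> 1 Q])
    show "\<rho> \<le> 1" using \<rho> by simp
    fix x assume x: "\<rho> \<le> x" "x \<le> 1"
    have "0 \<le> 2 * real n * x * (1 - x\<^sup>2) ^ (n - 1) * (x ^ l * (1 + c * (1 - x\<^sup>2) ^ n) - c * beta_prim n l x)"
    proof (cases "x = 1")
      \<comment> \<open>The endpoint is outside the range of the hypothesis, but there the factor (1
        - x^2)^(n-1) vanishes because n \<ge> 2.\<close>
      case True
      then show ?thesis using n by (simp add: zero_power)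
    next
      case False
      then have "x\<^sup>2 \<le> 1" using x \<rho> by (simp add: power_le_one)
      then show ?thesis using q[of x] x \<rho> False by (intro mult_nonneg_nonneg) (auto simp: c_def)
    qed
    then show "\<exists>y. (Q has_real_derivative y) (at x) \<and> y \<le> 0"
      using D[of x] by (intro exI[of _ "- (2 * real n * x * (1 - x\<^sup>2) ^ (n - 1)
      * (x ^ l * (1 + c * (1 - x\<^sup>2) ^ n) - c * beta_prim n l x))"]) auto
  qed
  moreover have "Q 1 = 0" using n by (simp add: Q_def \<beta>_def zero_power)
  moreover have "(1 - \<rho>\<^sup>2) ^ n > 0" using \<rho> by (simp add: abs_square_less_1)
  ultimately have "0 \<le> Q \<rho>" and s: "(1 - \<rho>\<^sup>2) ^ n > 0" by auto
  then have "\<beta> * (c * (1 - \<rho>\<^sup>2) ^ n) \<le> (\<beta> - beta_prim n l \<rho>) * (1 + c * (1 - \<rho>\<^sup>2) ^ n)"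
    by (simp add: Q_def mult_ac)
  then have "\<beta> \<le> (\<beta> - beta_prim n l \<rho>) * (1 + c * (1 - \<rho>\<^sup>2) ^ n) / (c * (1 - \<rho>\<^sup>2) ^ n)"
    using c s by (simp add: pos_le_divide_eq)
  also have "\<dots> = (\<beta> - beta_prim n l \<rho>) * (1 + 1 / (c * (1 - \<rho>\<^sup>2) ^ n))"
  proof -
    have "x * (1 + y) / y = x * (1 + 1 / y)" if "y > 0" for x y :: real
      using that by (simp add: field_simps)
    then show ?thesis using mult_pos_pos[OF c s] by blast
  qed
  finally show ?thesis by (simp add: \<beta>_def c_def)
qed

text \<open>The left side is the integral of l x^(l-1) (1 - t x^2)^3 over the unit interval. With
  denominators cleared and l = v + 1, the difference of the two sides is a polynomial in v whose
  coefficients are cubics in t, each nonnegative on [0, 1].\<close>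

lemma cubic_certificate:
  fixes t l :: real
  assumes t: "0 \<le> t" "t \<le> 1" and l: "l \<ge> 1"
  shows "1 - 3 * l * t / (l + 2) + 3 * l * t\<^sup>2 / (l + 4) - l * t ^ 3 / (l + 6) \<le> 2 * (1 - t) ^ 3 + 1 / (l + 1)"
proof -
  define v where "v = l - 1"
  have v: "v \<ge> 0" using l by (simp add: v_def)
  have lv: "l = v + 1" by (simp add: v_def)
  \<comment> \<open>The cubic is split into a3 (k - t) (t - b)^2 and a linear remainder that is
    nonnegative at both ends of [0, 1]. In the four applications b is a rational number close to the
    minimum point of the cubic, and k is then determined by the coefficient of t^2.\<close>
  have cubic: "0 \<le> a0 - a1 * t + a2 * t\<^sup>2 - a3 * t ^ 3"
    if "k \<ge> 1" "a3 \<ge> 0" "a2 = a3 * (k + 2 * b)" "a3 * (k * b\<^sup>2) \<le> a0"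
      "a3 * (k * b\<^sup>2) - a3 * (2 * k * b + b\<^sup>2) + a1 \<le> a0" for a0 a1 a2 a3 k b
  proof -
    have "0 \<le> a3 * ((k - t) * (t - b)\<^sup>2) + ((1 - t) * (a0 - a3 * (k * b\<^sup>2))
        + t * (a0 - (a3 * (k * b\<^sup>2) - a3 * (2 * k * b + b\<^sup>2) + a1)))"
      using that t by (intro add_nonneg_nonneg mult_nonneg_nonneg) auto
    also have "\<dots> = a0 - a1 * t + a2 * t\<^sup>2 - a3 * t ^ 3"
      by (simp add: that(3) power2_eq_square power3_eq_cube algebra_simps)
    finally show ?thesis .
  qed
  have p0: "0 \<le> 315 - 1050 * t + 1134 * t\<^sup>2 - 390 * t ^ 3"
    by (rule cubic[where k = "451/325" and b = "19/25"]) (simp_all add: power2_eq_square)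
  have p1: "0 \<le> 318 - 1095 * t + 1233 * t\<^sup>2 - 433 * t ^ 3"
    by (rule cubic[where k = "30907/21650" and b = "71/100"]) (simp_all add: power2_eq_square)
  have p2: "0 \<le> 116 - 387 * t + 447 * t\<^sup>2 - 161 * t ^ 3"
    by (rule cubic[where k = "11241/8050" and b = "69/100"]) (simp_all add: power2_eq_square)
  have p3: "0 \<le> 18 - 57 * t + 63 * t\<^sup>2 - 23 * t ^ 3"
    by (rule cubic[where k = "1241/1150" and b = "83/100"]) (simp_all add: power2_eq_square)
  have p4: "0 \<le> (1 - t) ^ 3" using t by simp
  have "0 \<le> (315 - 1050 * t + 1134 * t\<^sup>2 - 390 * t ^ 3) + v * (318 - 1095 * t + 1233 * t\<^sup>2 - 433 * t ^ 3)
     + v\<^sup>2 * (116 - 387 * t + 447 * t\<^sup>2 - 161 * t ^ 3) + v ^ 3 * (18 - 57 * t + 63 * t\<^sup>2 - 23 * t ^ 3) + v ^ 4 * (1 - t) ^ 3"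
    using p0 p1 p2 p3 p4 v by (intro add_nonneg_nonneg mult_nonneg_nonneg) auto
  also have "\<dots> = (l + 1) * (l + 2) * (l + 4) * (l + 6) * (2 * (1 - t) ^ 3 - 1) + (l + 2) * (l + 4) * (l + 6)
      + 3 * l * t * ((l + 1) * (l + 4) * (l + 6)) - 3 * l * t\<^sup>2 * ((l + 1) * (l + 2) * (l + 6)) + l * t ^ 3 * ((l + 1) * (l + 2) * (l + 4))"
    unfolding lv by (simp add: numeral_eq_Suc algebra_simps)
  also have "\<dots> = (l + 1) * (l + 2) * (l + 4) * (l + 6)
     * (2 * (1 - t) ^ 3 + 1 / (l + 1) - (1 - 3 * l * t / (l + 2) + 3 * l * t\<^sup>2 / (l + 4) - l * t ^ 3 / (l + 6)))"
  proof -
    have "l + 1 \<noteq> 0" "l + 2 \<noteq> 0" "l + 4 \<noteq> 0" "l + 6 \<noteq> 0" using l by auto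
    then show ?thesis by (simp add: divide_simps) (simp add: algebra_simps)
  qed
  finally have "0 \<le> (l + 1) * (l + 2) * (l + 4) * (l + 6)
     * (2 * (1 - t) ^ 3 + 1 / (l + 1) - (1 - 3 * l * t / (l + 2) + 3 * l * t\<^sup>2 / (l + 4) - l * t ^ 3 / (l + 6)))" .
  moreover have "(l + 1) * (l + 2) * (l + 4) * (l + 6) > 0" using l by simp
  ultimately show ?thesis unfolding zero_le_mult_iff[of "(l + 1) * (l + 2) * (l + 4) * (l + 6)"] by linarith
qed

text \<open>Convexity of y \<mapsto> y^(n/3), which needs n \<ge> 3. It trades the exponent n for 3,
  so that a single cubic inequality covers all n \<ge> 3.\<close>

lemma power_mean_cube:
  assumes n: "n \<ge> 3" and s: "0 < s" and v: "0 \<le> v" "v \<le> 1" and t: "t = s powr (real n / 3)"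
  shows "(1 - v + v * s) ^ n \<le> (1 - v + v * t) ^ 3"
proof -
  define p where "p = real n / 3"
  have p: "p \<ge> 1" using n by (simp add: p_def)
  define A where "A = 1 - v + v * s"
  have A: "A > 0"
  proof (cases "v = 0")
    case False
    then have "v * s > 0" using v s by simp
    then show ?thesis using v by (simp add: A_def)
  qed (simp add: A_def)
  have "A powr p \<le> (1 - v) * 1 powr p + v * s powr p"
    using convex_onD[OF powr_convex[OF p], of v 1 s] v s by (simp add: A_def)
  then have "A powr p \<le> 1 - v + v * t" by (simp add: t p_def)
  then have "(A powr p) ^ 3 \<le> (1 - v + v * t) ^ 3" by (rule power_mono) simp
  moreover have "(A powr p) ^ 3 = A ^ n"
  proof -
    have "(A powr p) ^ 3 = A powr (real 3 * p)" using A by (simp add: powr_power mult.commute)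
    also have "real 3 * p = real n" by (simp add: p_def)
    finally show ?thesis using A by (simp add: powr_realpow)
  qed
  ultimately show ?thesis by (simp add: A_def)
qed

text \<open>Integration by parts: adding s^n \<rho>^l to \<open>beta_prim n l \<rho>\<close> gives
  the integral over x in [0, 1] of (1 - (\<rho> x)^2)^n times the derivative of (\<rho> x)^l. By
  \<open>power_mean_cube\<close> the first factor is at most (1 - \<tau> x^2)^3 with (1 - \<tau>)^3
  = s^n, and \<open>cubic_certificate\<close> bounds the resulting integral. U and V are the
  primitives of the two integrands. For l = 0 the function U is constant.\<close>

lemma beta_prim_bound_ge3:
  assumes n: "n \<ge> 3" and \<rho>: "0 < \<rho>" "\<rho> < 1"
  shows "real (l + 1) * beta_prim n l \<rho> \<le> \<rho> ^ l * (1 + real (l + 1) * (1 - \<rho>\<^sup>2) ^ n)"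
proof -
  define s where "s = 1 - \<rho>\<^sup>2"
  have s: "0 < s" "s \<le> 1" using \<rho> by (simp_all add: s_def abs_square_less_1)
  define U where "U x = beta_prim n l (\<rho> * x) + (1 - (\<rho> * x)\<^sup>2) ^ n * (\<rho> * x) ^ l" for x
  have U': "(U has_real_derivative (1 - (\<rho> * x)\<^sup>2) ^ n * (real l * (\<rho> * x) ^ (l - 1) * \<rho>)) (at x)" for x
  proof -
    define W where "W y = beta_prim n l y + (1 - y\<^sup>2) ^ n * y ^ l" for y
    have W': "(W has_real_derivative (1 - y\<^sup>2) ^ n * (real l * y ^ (l - 1))) (at y)" for y
      unfolding W_def by (auto intro!: derivative_eq_intros simp: algebra_simps)
    have "((\<lambda>x. \<rho> * x) has_real_derivative \<rho>) (at x)" by (auto intro!: derivative_eq_intros)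
    from DERIV_chain2[OF W' this] show ?thesis by (simp add: U_def[abs_def] W_def mult.assoc)
  qed
  have U1: "U 1 = beta_prim n l \<rho> + s ^ n * \<rho> ^ l" by (simp add: U_def s_def)
  show ?thesis
  proof (cases "l = 0")
    case True
    have "U 1 = U 0"
      by (rule DERIV_isconst_all) (use U' True in auto)
    moreover have "0 < s ^ n" using s by simp
    ultimately show ?thesis using U1 True by (simp add: U_def s_def[symmetric])
  next
    case False
    define t where "t = s powr (real n / 3)"
    have t3: "t ^ 3 = s ^ n"
    proof -
      have "t ^ 3 = s powr (real 3 * (real n / 3))" using s by (simp add: t_def powr_power mult.commute)
      then show ?thesis using s by (simp add: powr_realpow)
    qed
    have t: "0 \<le> t" "t \<le> 1" using s n by (auto simp: t_def powr_le1)
    define \<tau> where "\<tau> = 1 - t"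
    define L where "L = real l"
    have L: "L \<ge> 1" using False by (simp add: L_def)
    define V where "V x = \<rho> ^ l * (x ^ l - 3 * L * \<tau> * (x ^ (l + 2) / (L + 2)) + 3 * L * \<tau>\<^sup>2 * (x ^ (l + 4) / (L + 4)) - L * \<tau> ^ 3 * (x ^ (l + 6) / (L + 6)))" for x
    have V': "(V has_real_derivative \<rho> ^ l * (L * x ^ (l - 1) * (1 - \<tau> * x\<^sup>2) ^ 3)) (at x)" for x
    proof -
      have mon: "((\<lambda>x. x ^ (l + j) / (L + real j)) has_real_derivative x ^ (l + (j - 1))) (at x)"
        if "j > 0" for j
        using DERIV_cdivide[OF DERIV_pow[of "l + j" x], of "L + real j"] L that by (simp add: L_def)
      have "l = Suc (l - 1)" using False by simp
      then obtain m where m: "l = Suc m" by blast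
      have "(V has_real_derivative \<rho> ^ l * (L * x ^ (l - 1) - 3 * L * \<tau> * x ^ (l + 1) + 3 * L * \<tau>\<^sup>2 * x ^ (l + 3) - L * \<tau> ^ 3 * x ^ (l + 5))) (at x)"
        unfolding V_def L_def using mon[of 2] mon[of 4] mon[of 6] DERIV_pow[of l x]
        by (intro DERIV_cmult DERIV_diff DERIV_add) (simp_all add: L_def del: add_2_eq_Suc')
      moreover have "L * x ^ (l - 1) - 3 * L * \<tau> * x ^ (l + 1) + 3 * L * \<tau>\<^sup>2 * x ^ (l + 3) - L * \<tau> ^ 3 * x ^ (l + 5)
         = L * x ^ (l - 1) * (1 - \<tau> * x\<^sup>2) ^ 3"
        unfolding m by (simp add: numeral_eq_Suc algebra_simps)
      ultimately show ?thesis by simp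
    qed
    have "U 1 - V 1 \<le> U 0 - V 0"
    proof (rule DERIV_nonpos_imp_nonincreasing[of 0 1 "\<lambda>x. U x - V x"])
      fix x :: real assume x: "0 \<le> x" "x \<le> 1"
      have "x\<^sup>2 \<le> 1" using x by (simp add: power_le_one)
      then have "(1 - x\<^sup>2 + x\<^sup>2 * s) ^ n \<le> (1 - x\<^sup>2 + x\<^sup>2 * t) ^ 3"
        by (intro power_mean_cube[OF n s(1) _ _ t_def]) auto
      then have le: "(1 - (\<rho> * x)\<^sup>2) ^ n \<le> (1 - \<tau> * x\<^sup>2) ^ 3"
        by (simp add: s_def \<tau>_def algebra_simps power_mult_distrib)
      have rw: "real l * (\<rho> * x) ^ (l - 1) * \<rho> = \<rho> ^ l * (L * x ^ (l - 1))"
        using False by (cases l) (simp_all add: power_mult_distrib L_def)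
      have "(1 - (\<rho> * x)\<^sup>2) ^ n * (\<rho> ^ l * (L * x ^ (l - 1))) \<le> (1 - \<tau> * x\<^sup>2) ^ 3 * (\<rho> ^ l * (L * x ^ (l - 1)))"
        using le L x \<rho> by (intro mult_right_mono) auto
      then have "(1 - (\<rho> * x)\<^sup>2) ^ n * (real l * (\<rho> * x) ^ (l - 1) * \<rho>) - \<rho> ^ l * (L * x ^ (l - 1) * (1 - \<tau> * x\<^sup>2) ^ 3) \<le> 0"
        unfolding rw by (simp add: algebra_simps)
      then show "\<exists>y. ((\<lambda>x. U x - V x) has_real_derivative y) (at x) \<and> y \<le> 0"
        using DERIV_diff[OF U' V'] by blast
    qed simp
    moreover have "U 0 - V 0 = 0" using False by (simp add: U_def V_def zero_power)
    ultimately have "beta_prim n l \<rho> + s ^ n * \<rho> ^ l \<le> V 1" by (simp add: U1)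
    also have "V 1 = \<rho> ^ l * (1 - 3 * L * \<tau> / (L + 2) + 3 * L * \<tau>\<^sup>2 / (L + 4) - L * \<tau> ^ 3 / (L + 6))"
      by (simp add: V_def)
    also have "\<dots> \<le> \<rho> ^ l * (2 * (1 - \<tau>) ^ 3 + 1 / (L + 1))"
      using t \<rho> by (intro mult_left_mono cubic_certificate L) (auto simp: \<tau>_def)
    finally have "beta_prim n l \<rho> \<le> \<rho> ^ l * (s ^ n + 1 / (L + 1))" by (simp add: \<tau>_def t3 algebra_simps)
    then have "(L + 1) * beta_prim n l \<rho> \<le> (L + 1) * (\<rho> ^ l * (s ^ n + 1 / (L + 1)))"
      using L by (intro mult_left_mono) auto
    also have "\<dots> = \<rho> ^ l * (1 + (L + 1) * s ^ n)" using L by (simp add: field_simps)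
    finally show ?thesis by (simp add: L_def s_def add.commute)
  qed
qed

section \<open>The case n = 2, with the exceptional weights k = 7 and k = 8\<close>

lemma beta_prim_2: "beta_prim 2 l x = 4 * (x ^ (l + 2) / real (l + 2) - x ^ (l + 4) / real (l + 4))"
  by (simp add: beta_prim_def numeral_eq_Suc algebra_simps)

text \<open>Clearing denominators leaves a quadratic in s. For l > 0 its discriminant has the sign
  of 8 - l^2, which is why l = 1 and l = 2 are left out; for l = 0 only the term in s^2
  survives.\<close>

lemma beta_prim_bound_2:
  assumes l: "l = 0 \<or> l \<ge> 3" and \<rho>: "0 < \<rho>" "\<rho> < 1"
  shows "real (l + 1) * beta_prim 2 l \<rho> \<le> \<rho> ^ l * (1 + real (l + 1) * (1 - \<rho>\<^sup>2) ^ 2)"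
proof -
  define s where "s = 1 - \<rho>\<^sup>2"
  define L where "L = real l"
  have L: "L = 0 \<or> L \<ge> 3" using l by (auto simp: L_def)
  have L0: "L \<ge> 0" using L by auto
  have "0 \<le> L * (L - 2) - 4 * L * (L + 1) * s + (L + 1) * (L + 2) * (L + 8) * s\<^sup>2"
  proof (cases "L = 0")
    case False
    then have L3: "L \<ge> 3" using L by simp
    define A where "A = (L + 1) * (L + 2) * (L + 8)"
    have A: "A > 0" using L3 by (simp add: A_def)
    have "0 \<le> (L + 4) * (L\<^sup>2 - 8) * (L * (L + 1))"
      using L3 power_mono[of 3 L 2] by (intro mult_nonneg_nonneg) auto
    also have "\<dots> = A * (L * (L - 2)) - (2 * L * (L + 1))\<^sup>2"
      by (simp add: A_def power2_eq_square algebra_simps)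
    finally have "0 \<le> (A * s - 2 * L * (L + 1))\<^sup>2 + (A * (L * (L - 2)) - (2 * L * (L + 1))\<^sup>2)" by simp
    also have "\<dots> = A * (L * (L - 2) - 4 * L * (L + 1) * s + A * s\<^sup>2)"
      by (simp add: power2_eq_square algebra_simps)
    finally show ?thesis using A by (simp add: zero_le_mult_iff A_def)
  qed simp
  also have "\<dots> = (L + 2) * (L + 4) * (1 + (L + 1) * s\<^sup>2) - 4 * (L + 1) * ((1 - s) * ((L + 4) - (L + 2) * (1 - s)))"
    by (simp add: power2_eq_square algebra_simps)
  finally have le: "4 * (L + 1) * ((1 - s) * ((L + 4) - (L + 2) * (1 - s))) \<le> (L + 2) * (L + 4) * (1 + (L + 1) * s\<^sup>2)"
    by simp
  have "(L + 1) * beta_prim 2 l \<rho> = \<rho> ^ l * (4 * (L + 1) * (\<rho>\<^sup>2 * ((L + 4) - (L + 2) * \<rho>\<^sup>2)) / ((L + 2) * (L + 4)))"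
  proof -
    have "L + 2 \<noteq> 0" "L + 4 \<noteq> 0" using L0 by auto
    then show ?thesis unfolding beta_prim_2
      by (simp add: L_def[symmetric] divide_simps power_add) (simp add: algebra_simps numeral_eq_Suc)
  qed
  also have "\<dots> \<le> \<rho> ^ l * (1 + (L + 1) * s\<^sup>2)"
    using le \<rho> L0 by (intro mult_left_mono) (auto simp: s_def divide_le_eq mult_ac)
  finally show ?thesis by (simp add: L_def s_def add.commute)
qed

text \<open>X is half of tanh^2 (2a), expressed in s = tanh^2 a, and the first factor on the right
  becomes 4 s^2 (1 + s + s^2) / (3 (1 + s)^6). Its product with 1/(c s^2) alone suffices: c times
  this product is 4/3 at s = 0, against the required 16/15. It remains at least 16/15 as long as 4
  (1 + s)^6 \<le> 5 (1 + s + s^2), and 9/200 lies just below the point where this fails.\<close>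

lemma blichfeldt_numeric:
  fixes s c \<beta> :: real
  assumes s: "0 < s" "s \<le> 9/200" and c: "c > 0" and c\<beta>: "c * \<beta> \<le> 16/15"
  defines "X \<equiv> 2 * s / (1 + s)\<^sup>2"
  shows "\<beta> \<le> X\<^sup>2 / 3 * (1 - X / 2) * (1 + 1 / (c * s\<^sup>2))"
proof -
  have p: "s\<^sup>2 \<le> (9/200)\<^sup>2" "s ^ 3 \<le> (9/200) ^ 3" "s ^ 4 \<le> (9/200) ^ 4" "s ^ 5 \<le> (9/200) ^ 5" "s ^ 6 \<le> (9/200) ^ 6"
    using s by (intro power_mono; simp)+
  have "5 * (1 + s + s\<^sup>2) - 4 * (1 + s) ^ 6 = 1 - 19 * s - 55 * s\<^sup>2 - 80 * s ^ 3 - 60 * s ^ 4 - 24 * s ^ 5 - 4 * s ^ 6"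
    by algebra
  also have "\<dots> \<ge> 1 - 19 * (9/200) - 55 * (9/200)\<^sup>2 - 80 * (9/200) ^ 3 - 60 * (9/200) ^ 4 - 24 * (9/200) ^ 5 - 4 * (9/200) ^ 6"
    using p s by linarith
  finally have "4 * (1 + s) ^ 6 \<le> 5 * (1 + s + s\<^sup>2)"
    by (simp add: power_divide)
  then have le: "16/15 * (3 * (1 + s) ^ 6) \<le> 4 * (1 + s + s\<^sup>2)" by simp
  have "c * \<beta> * (3 * (1 + s) ^ 6) \<le> 16/15 * (3 * (1 + s) ^ 6)"
    using c\<beta> s by (intro mult_right_mono) auto
  also note le
  also have "4 * (1 + s + s\<^sup>2) \<le> 4 * (1 + s + s\<^sup>2) * (1 + c * s\<^sup>2)"
    using mult_left_mono[of 1 "1 + c * s\<^sup>2" "4 * (1 + s + s\<^sup>2)"] c s by simp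
  finally have "\<beta> * (c * (3 * (1 + s) ^ 6)) \<le> 4 * (1 + s + s\<^sup>2) * (1 + c * s\<^sup>2)" by (simp add: mult_ac)
  then have "\<beta> \<le> 4 * (1 + s + s\<^sup>2) * (1 + c * s\<^sup>2) / (c * (3 * (1 + s) ^ 6))"
    using c s by (simp add: pos_le_divide_eq)
  also have "\<dots> = X\<^sup>2 / 3 * (1 - X / 2) * (1 + 1 / (c * s\<^sup>2))"
  proof -
    define w where "w = 1 + s"
    have w: "w \<noteq> 0" using s by (simp add: w_def)
    have "X\<^sup>2 / 3 * (1 - X / 2) = 4 * s\<^sup>2 * (w\<^sup>2 - s) / (3 * w ^ 6)"
    proof -
      have "X\<^sup>2 = 4 * s\<^sup>2 / w ^ 4" unfolding X_def w_def[symmetric] by (simp add: power_divide power_mult_distrib flip: power_mult)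
      moreover have "1 - X / 2 = (w\<^sup>2 - s) / w\<^sup>2" unfolding X_def w_def[symmetric] using w by (simp add: field_simps)
      ultimately show ?thesis by (simp add: power_add[symmetric])
    qed
    moreover have "w\<^sup>2 - s = 1 + s + s\<^sup>2" by (simp add: w_def power2_eq_square algebra_simps)
    ultimately have E: "X\<^sup>2 / 3 * (1 - X / 2) = 4 * s\<^sup>2 * (1 + s + s\<^sup>2) / (3 * w ^ 6)" by simp
    show ?thesis unfolding E using c s w unfolding w_def[symmetric] by (simp add: field_simps)
  qed
  finally show ?thesis .
qed

text \<open>A rational lower bound, in s = tanh^2 a, for the third term of the claim when n = 2 and
  k \<le> 8. The factor 39 is (5/2)^4 rounded down.\<close>

definition tail_weight :: "real \<Rightarrow> real" where
  "tail_weight s = 39 * (1 - s) ^ 6 / (1 + s) ^ 4"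

lemma tail_weight_antimono: "0 \<le> s \<Longrightarrow> s \<le> t \<Longrightarrow> t \<le> 1 \<Longrightarrow> tail_weight t \<le> tail_weight s"
  unfolding tail_weight_def by (intro frac_le mult_mono power_mono) auto

lemma tail_weight_nonneg: "0 \<le> s \<Longrightarrow> s \<le> 1 \<Longrightarrow> 0 \<le> tail_weight s"
  unfolding tail_weight_def by simp

text \<open>This is \<beta> \<le> J (1 + E + D) for l = 2, where \<beta> = 1/3 and J = s^2 - 2
  s^3/3, with \<open>tail_weight\<close> in place of D.\<close>

lemma ball_numeric_8:
  fixes s :: real
  assumes s: "9/200 \<le> s" "s < 1"
  shows "1/3 \<le> (s\<^sup>2 - 2 * s ^ 3 / 3) * (1 + 1 / (3 * s\<^sup>2) + tail_weight s)"
proof -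
  have main: "0 \<le> s - 2/9 - 2 * s\<^sup>2 / 3 + s * (tail_weight s * (1 - 2 * s / 3))"
  \<comment> \<open>The quadratic s - 2/9 - 2 s^2/3 has its smaller root near 0.271, so from 7/25 on
    it is nonnegative without the tail. Below 7/25 the tail alone outweighs the constant
    2/9.\<close>
  proof (cases "s \<ge> 7/25")
    case True
    have "0 \<le> (s - 7/25) * (1 - s)" using True s by simp
    then have "s\<^sup>2 \<le> 32/25 * s - 7/25" by (simp add: power2_eq_square field_simps)
    then have "0 \<le> s - 2/9 - 2 * s\<^sup>2 / 3" using True by linarith
    moreover have "0 \<le> s * (tail_weight s * (1 - 2 * s / 3))" using tail_weight_nonneg[of s] s by simp
    ultimately show ?thesis by simp
  next
    case False
    have "2/9 \<le> s * (tail_weight s * (1 - 2 * s / 3))"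
      if "a \<le> s" "s \<le> b" "0 < a" "b \<le> 1" "2/9 \<le> a * (tail_weight b * (1 - 2 * b / 3))" for a b
    proof -
      have "a * (tail_weight b * (1 - 2 * b / 3)) \<le> s * (tail_weight s * (1 - 2 * s / 3))"
        using that s tail_weight_antimono[of s b] tail_weight_nonneg[of b] tail_weight_nonneg[of s] by (intro mult_mono) auto
      then show ?thesis using that by simp
    qed
    note iv = this
    have n: "2/9 \<le> 9/200 * (tail_weight (1/10) * (1 - 2 * (1/10) / 3))"
      "2/9 \<le> 1/10 * (tail_weight (1/5) * (1 - 2 * (1/5) / 3))"
      "2/9 \<le> 1/5 * (tail_weight (7/25) * (1 - 2 * (7/25) / 3))"
      by (simp_all add: tail_weight_def power_divide)
    consider "s \<le> 1/10" | "1/10 \<le> s" "s \<le> 1/5" | "1/5 \<le> s" "s \<le> 7/25" using False by linarith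
    then have "2/9 \<le> s * (tail_weight s * (1 - 2 * s / 3))"
    proof cases
      case 1
      show ?thesis by (rule iv[OF s(1) 1 _ _ n(1)]) simp_all
    next
      case 2
      show ?thesis by (rule iv[OF 2 _ _ n(2)]) simp_all
    next
      case 3
      show ?thesis by (rule iv[OF 3 _ _ n(3)]) simp_all
    qed
    moreover have "0 \<le> s - 2 * s\<^sup>2 / 3" using False s mult_mono[of s 1 s s] by (simp add: power2_eq_square)
    ultimately show ?thesis by simp
  qed
  have "(s\<^sup>2 - 2 * s ^ 3 / 3) * (1 + 1 / (3 * s\<^sup>2) + tail_weight s) - 1/3
      = s * (s - 2/9 - 2 * s\<^sup>2 / 3 + s * (tail_weight s * (1 - 2 * s / 3)))"
    using s by (simp add: field_simps power2_eq_square power3_eq_cube)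
  moreover have "0 \<le> s * (s - 2/9 - 2 * s\<^sup>2 / 3 + s * (tail_weight s * (1 - 2 * s / 3)))"
    using main s by (intro mult_nonneg_nonneg) auto
  ultimately show ?thesis by linarith
qed

text \<open>Interval subdivision: the left side and s^2 increase, while the quadratic factor and
  \<open>tail_weight\<close> decrease. On [a, b] it therefore suffices to evaluate s^2 at a and
  everything else at b. The breakpoints are spaced so that this crude test succeeds on every
  piece.\<close>

lemma ball_numeric_7_poly:
  fixes s :: real
  assumes s: "9/200 \<le> s" "s < 1"
  shows "1/30 + s / 6 + s\<^sup>2 / 8 \<le> (1 - s / 3 - s\<^sup>2 / 4) * (s\<^sup>2 * (1 + tail_weight s))"
proof -
  have iv: ?thesis
    if "a \<le> s" "s \<le> b" "0 < a" "b \<le> 1" "1/30 + b / 6 + b\<^sup>2 / 8 \<le> (1 - b / 3 - b\<^sup>2 / 4) * (a\<^sup>2 * (1 + tail_weight b))" for a b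
  proof -
    have s2: "s\<^sup>2 \<le> b\<^sup>2" "a\<^sup>2 \<le> s\<^sup>2" using that s by (auto intro!: power_mono)
    have b1: "b\<^sup>2 \<le> 1" using that s by (simp add: power_le_one)
    have "1/30 + s / 6 + s\<^sup>2 / 8 \<le> 1/30 + b / 6 + b\<^sup>2 / 8" using that(2) s2 by linarith
    also have "\<dots> \<le> (1 - b / 3 - b\<^sup>2 / 4) * (a\<^sup>2 * (1 + tail_weight b))" by fact
    also have "\<dots> \<le> (1 - s / 3 - s\<^sup>2 / 4) * (s\<^sup>2 * (1 + tail_weight s))"
    proof (rule mult_mono)
      show "1 - b / 3 - b\<^sup>2 / 4 \<le> 1 - s / 3 - s\<^sup>2 / 4" using that(2) s2 by linarith
      show "0 \<le> 1 - s / 3 - s\<^sup>2 / 4" using s s2 b1 by linarith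
      have t: "0 \<le> tail_weight b" "tail_weight b \<le> tail_weight s"
        using that s tail_weight_antimono[of s b] tail_weight_nonneg[of b] by auto
      then show "a\<^sup>2 * (1 + tail_weight b) \<le> s\<^sup>2 * (1 + tail_weight s)"
        by (intro mult_mono s2(2)) auto
      show "0 \<le> a\<^sup>2 * (1 + tail_weight b)" using t by simp
    qed
    finally show ?thesis .
  qed
  have step: ?thesis
    if "s \<le> a \<Longrightarrow> ?thesis" "s \<le> b" "0 < a" "b \<le> 1" "1/30 + b / 6 + b\<^sup>2 / 8 \<le> (1 - b / 3 - b\<^sup>2 / 4) * (a\<^sup>2 * (1 + tail_weight b))" for a b
    using that iv[of a b] by (cases "s \<le> a") auto
  note numeric = tail_weight_def power_divide
  have ?thesis if "s \<le> 11/200" by (rule iv[OF s(1) that]) (simp_all add: numeric)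
  then have ?thesis if "s \<le> 17/200" by (rule step[of "11/200", OF _ that]) (simp_all add: numeric)
  then have ?thesis if "s \<le> 29/200" by (rule step[of "17/200", OF _ that]) (simp_all add: numeric)
  then have ?thesis if "s \<le> 47/200" by (rule step[of "29/200", OF _ that]) (simp_all add: numeric)
  then have ?thesis if "s \<le> 65/200" by (rule step[of "47/200", OF _ that]) (simp_all add: numeric)
  then have ?thesis if "s \<le> 81/200" by (rule step[of "65/200", OF _ that]) (simp_all add: numeric)
  then have ?thesis if "s \<le> 97/200" by (rule step[of "81/200", OF _ that]) (simp_all add: numeric)
  then have ?thesis if "s \<le> 117/200" by (rule step[of "97/200", OF _ that]) (simp_all add: numeric)
  then have ?thesis if "s \<le> 143/200" by (rule step[of "117/200", OF _ that]) (simp_all add: numeric)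
  then have ?thesis if "s \<le> 171/200" by (rule step[of "143/200", OF _ that]) (simp_all add: numeric)
  then have ?thesis if "s \<le> 195/200" by (rule step[of "171/200", OF _ that]) (simp_all add: numeric)
  then have ?thesis if "s \<le> 1" by (rule step[of "195/200", OF _ that]) (simp_all add: numeric)
  then show ?thesis using s by simp
qed

text \<open>For l = 1 the incomplete integral contains odd powers of \<rho> = sqrt (1 - s). It is
  bounded below by s^2 (1 - s/3 - s^2/4), which is polynomial in s and has the correct first two
  terms at s = 0; hence the difference is divisible by (1 - \<rho>)^4, with a cofactor that has
  positive coefficients.\<close>

lemma ball_numeric_7:
  fixes \<rho> :: real
  assumes \<rho>: "0 < \<rho>" and s: "9/200 \<le> 1 - \<rho>\<^sup>2"
  defines "s \<equiv> 1 - \<rho>\<^sup>2"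
  shows "8/15 \<le> (8/15 - 4 * (\<rho> ^ 3 / 3 - \<rho> ^ 5 / 5)) * (1 + 1 / (2 * s\<^sup>2) + tail_weight s)"
proof -
  have s1: "9/200 \<le> s" "s < 1" using assms by (auto simp: s_def)
  define B where "B = 1 - s / 3 - s\<^sup>2 / 4"
  have "0 \<le> (1 - \<rho>) ^ 4 * (7 + 28 * \<rho> + 70 * \<rho>\<^sup>2 + 60 * \<rho> ^ 3 + 15 * \<rho> ^ 4)"
    using \<rho> by simp
  also have "\<dots> = (32 - 80 * \<rho> ^ 3 + 48 * \<rho> ^ 5) - 5 * (s\<^sup>2 * (12 - 4 * s - 3 * s\<^sup>2))"
    unfolding s_def by algebra
  also have "12 - 4 * s - 3 * s\<^sup>2 = 12 * B" by (simp add: B_def)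
  finally have J: "s\<^sup>2 * B \<le> 8/15 - 4 * (\<rho> ^ 3 / 3 - \<rho> ^ 5 / 5)" by simp
  have "1/30 + s / 6 + s\<^sup>2 / 8 \<le> B * (s\<^sup>2 * (1 + tail_weight s))"
    unfolding B_def by (rule ball_numeric_7_poly[OF s1])
  moreover have "8/15 - B / 2 = 1/30 + s / 6 + s\<^sup>2 / 8" by (simp add: B_def field_simps)
  ultimately have "8/15 \<le> B / 2 + B * (s\<^sup>2 * (1 + tail_weight s))" by simp
  also have "\<dots> = s\<^sup>2 * B * (1 + 1 / (2 * s\<^sup>2) + tail_weight s)" using s1 by (simp add: field_simps)
  also have "\<dots> \<le> (8/15 - 4 * (\<rho> ^ 3 / 3 - \<rho> ^ 5 / 5)) * (1 + 1 / (2 * s\<^sup>2) + tail_weight s)"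
    using J tail_weight_nonneg[of s] s1 by (intro mult_right_mono) auto
  finally show ?thesis .
qed

text \<open>The numerator is estimated by sinh (5a/2) \<ge> (5/2) sinh a, the denominator by cosh^2
  (3a/2) \<le> cosh a cosh (2a). Since cosh^2 a = 1/(1 - s) and cosh (2a) = (1 + s)/(1 - s), the
  fourth power of cosh a cosh (2a) is (1 + s)^4 / (1 - s)^6.\<close>

lemma third_term_ge:
  fixes a :: real
  assumes a: "a > 0" and k: "k \<le> 8"
  shows "tail_weight ((tanh a)\<^sup>2) \<le> sinh (5 * a / 2) ^ 4 / (sinh a ^ 4 * cosh (3 * a / 2) ^ k)"
proof -
  define s where "s = (tanh a)\<^sup>2"
  have c1: "cosh a \<ge> 1" "cosh (3 * a / 2) \<ge> 1" "cosh (a / 2) \<ge> 1" by (rule cosh_real_ge_1)+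
  have sp: "sinh a > 0" "sinh (a / 2) > 0" "sinh (3 * a / 2) > 0" using a by simp_all
  have c2: "(cosh a)\<^sup>2 = 1 + (sinh a)\<^sup>2" by (simp add: cosh_square_eq)
  have sh: "(sinh a)\<^sup>2 = (cosh a)\<^sup>2 * s" using c1 by (simp add: s_def tanh_def power_divide)
  have cs: "(cosh a)\<^sup>2 * (1 - s) = 1" using c2 sh by (simp add: right_diff_distrib)
  have s1: "0 \<le> s" "s < 1"
  proof -
    show "0 \<le> s" by (simp add: s_def)
    have "0 < (cosh a)\<^sup>2 * (1 - s)" by (simp add: cs)
    then show "s < 1" using c1 by (simp add: zero_less_mult_iff)
  qed
  have "cosh (2 * a) = (cosh a)\<^sup>2 + (sinh a)\<^sup>2" by (simp add: cosh_double)
  also note sh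
  finally have "cosh (2 * a) * (1 - s) = ((cosh a)\<^sup>2 * (1 - s)) * (1 + s)" by (simp add: algebra_simps)
  then have cosh2: "cosh (2 * a) * (1 - s) = 1 + s" by (simp only: cs mult_1)
  have "5 / 2 * sinh a \<le> sinh (5 * a / 2)"
  proof -
    have "sinh (5 * a / 2) = sinh (a + 3 * a / 2)" by (simp add: field_simps)
    also have "\<dots> = sinh a * cosh (3 * a / 2) + cosh a * sinh (3 * a / 2)" by (rule sinh_add)
    finally have 1: "sinh (5 * a / 2) = sinh a * cosh (3 * a / 2) + cosh a * sinh (3 * a / 2)" .
    have "sinh (3 * a / 2) = sinh (a + a / 2)" by (simp add: field_simps)
    also have "\<dots> = sinh a * cosh (a / 2) + cosh a * sinh (a / 2)" by (rule sinh_add)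
    finally have 2: "sinh (3 * a / 2) = sinh a * cosh (a / 2) + cosh a * sinh (a / 2)" .
    have 3: "sinh a = 2 * (cosh (a / 2) * sinh (a / 2))" using sinh_double[of "a / 2"] by simp
    have "cosh (a / 2) \<le> cosh a" using a by (subst cosh_real_nonneg_le_iff) auto
    then have "cosh (a / 2) * sinh (a / 2) \<le> cosh a * sinh (a / 2)" using sp by (intro mult_right_mono) auto
    moreover have "sinh a * 1 \<le> sinh a * cosh (a / 2)" using sp c1 by (intro mult_left_mono) auto
    ultimately have "3 / 2 * sinh a \<le> sinh (3 * a / 2)" using 2 3 by linarith
    moreover have "1 * sinh (3 * a / 2) \<le> cosh a * sinh (3 * a / 2)" using sp c1 by (intro mult_right_mono) auto
    moreover have "sinh a * 1 \<le> sinh a * cosh (3 * a / 2)" using sp c1 by (intro mult_left_mono) auto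
    ultimately show ?thesis using 1 by linarith
  qed
  then have "(5 / 2 * sinh a) ^ 4 \<le> sinh (5 * a / 2) ^ 4" using sp by (intro power_mono) auto
  then have "(5 / 2) ^ 4 * sinh a ^ 4 \<le> sinh (5 * a / 2) ^ 4" by (simp only: power_mult_distrib)
  moreover have "39 * sinh a ^ 4 \<le> (5 / 2) ^ 4 * sinh a ^ 4" by (rule mult_right_mono) (simp_all add: power_divide)
  ultimately have num: "39 * sinh a ^ 4 \<le> sinh (5 * a / 2) ^ 4" by linarith
  have "cosh (3 * a / 2) ^ k \<le> cosh (3 * a / 2) ^ 8" using c1 k by (intro power_increasing) auto
  also have "\<dots> = ((cosh (3 * a / 2))\<^sup>2) ^ 4" unfolding power_mult[symmetric] by simp
  also have "\<dots> \<le> (cosh a * cosh (2 * a)) ^ 4"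
  proof (intro power_mono)
    have "2 * (cosh (3 * a / 2))\<^sup>2 = cosh (3 * a) + 1"
      using cosh_double_cosh[of "3 * a / 2"] by simp
    moreover have "cosh (3 * a) + cosh a = 2 * (cosh a * cosh (2 * a))"
      using cosh_add[of "2 * a" a] cosh_diff[of "2 * a" a] by (simp add: mult.commute)
    ultimately show "(cosh (3 * a / 2))\<^sup>2 \<le> cosh a * cosh (2 * a)" using c1 by linarith
  qed simp
  finally have "cosh (3 * a / 2) ^ k \<le> (cosh a * cosh (2 * a)) ^ 4" .
  then have "cosh (3 * a / 2) ^ k * (1 - s) ^ 6 \<le> (cosh a * cosh (2 * a)) ^ 4 * (1 - s) ^ 6"
    using s1 by (intro mult_right_mono) auto
  also have "\<dots> = ((cosh a)\<^sup>2 * (1 - s))\<^sup>2 * (cosh (2 * a) * (1 - s)) ^ 4"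
    by algebra
  also have "\<dots> = (1 + s) ^ 4" unfolding cs cosh2 by simp
  finally have den: "cosh (3 * a / 2) ^ k * (1 - s) ^ 6 \<le> (1 + s) ^ 4" .
  have "39 * (1 - s) ^ 6 * (sinh a ^ 4 * cosh (3 * a / 2) ^ k) = (39 * sinh a ^ 4) * (cosh (3 * a / 2) ^ k * (1 - s) ^ 6)"
    by simp
  also have "\<dots> \<le> sinh (5 * a / 2) ^ 4 * (1 + s) ^ 4"
    using num den s1 by (intro mult_mono) auto
  finally have "39 * (1 - s) ^ 6 * (sinh a ^ 4 * cosh (3 * a / 2) ^ k) \<le> sinh (5 * a / 2) ^ 4 * (1 + s) ^ 4" .
  moreover have "0 < (1 + s) ^ 4" "0 < sinh a ^ 4 * cosh (3 * a / 2) ^ k" using s1 sp by simp_all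
  ultimately show ?thesis
    unfolding tail_weight_def s_def[symmetric]
    by (simp only: pos_divide_le_eq times_divide_eq_left pos_le_divide_eq)
qed

section \<open>The orbit sum\<close>

text \<open>The constant relating cone integrals to radial integrals cancels. J is only a lower
  bound for the weighted integral because for Blichfeldt's weights that integral is estimated, not
  computed.\<close>

lemma packing_real:
  fixes p :: "complex ^ ('n::finite option)"
  assumes p: "qform p = 1" and A: "finite A" "A \<subseteq> U_n1"
    and H: "\<And>x. H x \<ge> 0" "H \<in> borel_measurable borel"
    and overlap: "\<And>v. qform v > 0 \<Longrightarrow> (\<Sum>g\<in>A. H (1 - qform v / (cmod (hform (g *v p) v))\<^sup>2)) \<le> 1"
    and J: "ennreal J \<le> radial_integral CARD('n) k H" "J \<ge> 0"
    and \<beta>: "radial_integral CARD('n) k (\<lambda>_. 1) = ennreal \<beta>" "\<beta> \<ge> 0"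
  shows "(\<Sum>g\<in>A. 1 / cmod (hform p (g *v p)) ^ k) * J \<le> \<beta>"
proof -
  obtain \<kappa> where \<kappa>: "\<kappa> \<noteq> 0" "\<kappa> \<noteq> \<infinity>"
    "\<And>k H. H \<in> borel_measurable borel \<Longrightarrow> cone_integral TYPE('n) k H = \<kappa> * radial_integral CARD('n) k H"
    using cone_integral_eq_radial[where 'n='n] by metis
  define S where "S = (\<Sum>g\<in>A. 1 / cmod (hform p (g *v p)) ^ k)"
  have S0: "S \<ge> 0" by (simp add: S_def sum_nonneg)
  have "ennreal S * cone_integral TYPE('n) k H \<le> cone_integral TYPE('n) k (\<lambda>_. 1)"
    using packing_inequality[OF p A H, of k] overlap
    by (simp add: S_def neg_shell_def sum_ennreal[symmetric] del: sum_ennreal)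
  then have "\<kappa> * (ennreal S * radial_integral CARD('n) k H) \<le> \<kappa> * ennreal \<beta>"
    using H(2) by (simp add: \<kappa>(3) \<beta>(1) mult_ac)
  then have "ennreal S * radial_integral CARD('n) k H \<le> ennreal \<beta>"
    using \<kappa>(1,2) by (simp add: ennreal_mult_le_mult_iff)
  then have "ennreal S * ennreal J \<le> ennreal \<beta>"
    using J(1) by (meson mult_left_mono order_trans zero_le)
  then show ?thesis using S0 J(2) \<beta>(2) by (simp add: S_def[symmetric] flip: ennreal_mult)
qed

text \<open>Here a stands for r/4: the hypothesis says that the points of the orbit have mutual
  distance at least 4a = r. With s = tanh^2 a the second term is 1/((l + 1) s^n), the form in which
  the beta inequalities are stated.\<close>

lemma orbit_sum_bound:
  fixes p :: "complex ^ ('n::finite option)" and a :: real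
  defines "n \<equiv> CARD('n)"
  assumes p: "qform p = 1" and A: "finite A" "A \<subseteq> U_n1" and a: "a > 0"
    and sep: "\<And>g g'. g \<in> A \<Longrightarrow> g' \<in> A \<Longrightarrow> g \<noteq> g' \<Longrightarrow> cosh (2 * a) \<le> cmod (hform (g *v p) (g' *v p))"
    and n: "n \<ge> 2" and k: "k \<ge> 2 * n + 2"
  shows "(\<Sum>g\<in>A. 1 / cmod (hform p (g *v p)) ^ k)
    \<le> 1 + cosh a ^ (2 * n) / ((real k - 2 * real n - 1) * sinh a ^ (2 * n))
      + sinh (5 * a / 2) ^ (2 * n) / (sinh a ^ (2 * n) * cosh (3 * a / 2) ^ k)"
    (is "?S \<le> 1 + ?E + ?D")
proof -
  define S where "S = ?S"
  define E where "E = ?E"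
  define D where "D = ?D"
  define s where "s = (tanh a)\<^sup>2"
  define \<rho> where "\<rho> = sqrt (1 - s)"
  define l where "l = k - 2 * n - 2"
  have kl: "k = 2 * n + 2 + l" using k by (simp add: l_def)
  define \<beta> where "\<beta> = beta_prim n l 1"
  have sp: "sinh a > 0" "cosh a > 0" using a by simp_all
  have c2: "(cosh a)\<^sup>2 = (sinh a)\<^sup>2 + 1" by (rule cosh_square_eq)
  have sh: "(sinh a)\<^sup>2 = (cosh a)\<^sup>2 * s" using sp by (simp add: s_def tanh_def power_divide)
  have cs: "(cosh a)\<^sup>2 * (1 - s) = 1" using c2 sh by (simp add: right_diff_distrib)
  have s: "0 < s" "s < 1"
  proof -
    show "0 < s" using a by (simp add: s_def)
    have "0 < (cosh a)\<^sup>2 * (1 - s)" by (simp add: cs)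
    then show "s < 1" using sp by (simp add: zero_less_mult_iff)
  qed
  have \<rho>: "0 < \<rho>" "\<rho> < 1" using s by (auto simp: \<rho>_def)
  have \<rho>2: "1 - \<rho>\<^sup>2 = s" using s by (simp add: \<rho>_def)
  have cosh2: "cosh (2 * a) = (1 + s) / (1 - s)"
  proof -
    have "cosh (2 * a) = (cosh a)\<^sup>2 + (cosh a)\<^sup>2 * s" by (simp add: cosh_double flip: sh)
    then have "cosh (2 * a) * (1 - s) = ((cosh a)\<^sup>2 * (1 - s)) * (1 + s)" by (simp add: algebra_simps)
    then have "cosh (2 * a) * (1 - s) = 1 + s" by (simp only: cs mult_1)
    then show ?thesis using s by (simp add: field_simps)
  qed
  have qp: "qform (g *v p) = 1" if "g \<in> A" for g using that A(2) p by (auto simp: qform_U_n1)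
  have \<beta>1: "radial_integral CARD('n) k (\<lambda>_. 1) = ennreal \<beta>"
    unfolding \<beta>_def kl n_def[symmetric] using n by (intro radial_integral_one) simp
  have \<beta>0: "\<beta> > 0" unfolding \<beta>_def using n by (intro beta_prim_pos) simp
  have J0: "beta_prim n l \<rho> \<le> \<beta>"
  proof -
    have inc: "\<exists>y. (beta_prim n l has_real_derivative y) (at x) \<and> 0 \<le> y" if "\<rho> \<le> x" "x \<le> 1" for x
      using DERIV_beta_prim[OF DERIV_ident, of n l x] that \<rho>
      by (intro exI[of _ "2 * real n * (1 - x\<^sup>2) ^ (n - 1) * x ^ (l + 1)"]) (auto simp: power_le_one)
    show ?thesis unfolding \<beta>_def
      by (rule DERIV_nonneg_imp_nondecreasing[OF less_imp_le[OF \<rho>(2)] inc])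
  qed
  define J where "J = \<beta> - beta_prim n l \<rho>"
  have ball: "S * J \<le> \<beta>"
  unfolding S_def proof (rule packing_real[OF p A])
    show "0 \<le> (indicator {..<s} x :: real)" for x by simp
    show "(indicator {..<s} :: real \<Rightarrow> real) \<in> borel_measurable borel" by measurable
    show "(\<Sum>g\<in>A. indicator {..<s} (1 - qform v / (cmod (hform (g *v p) v))\<^sup>2)) \<le> (1::real)" if "qform v > 0" for v
      by (rule ball_overlap[OF that A(1) qp s]) (use sep cosh2 in auto)
    show "ennreal J \<le> radial_integral CARD('n) k (indicator {..<s})"
      unfolding J_def \<beta>_def \<rho>_def kl n_def[symmetric] using n s by (subst radial_integral_ball) auto
  qed (use J0 \<beta>1 \<beta>0 in \<open>auto simp: J_def\<close>)
  have E: "E = 1 / (real (l + 1) * s ^ n)"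
  proof -
    have "sinh a ^ (2 * n) = cosh a ^ (2 * n) * s ^ n" by (simp add: power_mult sh power_mult_distrib)
    moreover have "real k - 2 * real n - 1 = real (l + 1)" by (simp add: kl)
    ultimately show ?thesis using sp by (simp add: E_def)
  qed
  have D0: "D \<ge> 0" using a by (simp add: D_def)
  \<comment> \<open>I is the lower bound for the integral of the chosen weight: J for the balls,
    \<open>X^2 / 3 * (1 - X / 2)\<close> for Blichfeldt's weights.\<close>
  have fin: "S \<le> 1 + E + D" if "S * I \<le> \<beta>" "\<beta> \<le> I * (1 + E + D)" for I
  proof -
    have E0: "1 + E + D > 0" using D0 s by (simp add: E add_pos_nonneg)
    have I: "I > 0"
    proof (rule ccontr)
      assume "\<not> I > 0"
      then have "I * (1 + E + D) \<le> 0" using E0 by (simp add: mult_nonpos_nonneg)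
      then show False using \<beta>0 that(2) by linarith
    qed
    have "S * I \<le> (1 + E + D) * I" using that by (simp add: mult.commute)
    then show ?thesis using I by simp
  qed
  have "S \<le> 1 + E + D"
  \<comment> \<open>For n = 2 the values l = 1, 2 are k = 7, 8, where the hypothesis of
    \<open>beta_ratio_criterion\<close> fails for small s.\<close>
  proof (cases "n = 2 \<and> (l = 1 \<or> l = 2)")
    case False
    have "\<beta> \<le> J * (1 + 1 / (real (l + 1) * (1 - \<rho>\<^sup>2) ^ n))"
      unfolding J_def \<beta>_def
    proof (rule beta_ratio_criterion[OF n \<rho>])
      fix x :: real assume x: "0 < x" "x < 1"
      show "real (l + 1) * beta_prim n l x \<le> x ^ l * (1 + real (l + 1) * (1 - x\<^sup>2) ^ n)"
      proof (cases "n = 2")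
        case True
        then have "l = 0 \<or> l \<ge> 3" using False by auto
        then show ?thesis using True beta_prim_bound_2[of l, OF _ x] by simp
      next
        case False
        then show ?thesis using n beta_prim_bound_ge3[of n, OF _ x] by simp
      qed
    qed
    also have "\<dots> \<le> J * (1 + E + D)"
      unfolding E \<rho>2 using J0 D0 by (intro mult_left_mono) (auto simp: J_def)
    finally show ?thesis using fin ball by blast
  next
    case True
    then have n2: "n = 2" and l: "l = 1 \<or> l = 2" by auto
    have k8: "k \<le> 8" using l n2 by (auto simp: kl)
    have D: "D \<ge> tail_weight s"
      using third_term_ge[OF a k8] by (simp add: n2 s_def D_def)
    show ?thesis
    proof (cases "s \<le> 9/200")
      case small: True
      define X where "X = 2 * s / (1 + s)\<^sup>2"
      define \<kappa> where "\<kappa> = cosh (2 * a)"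
      have \<kappa>1: "\<kappa> > 1" using s unfolding \<kappa>_def cosh2 by (simp add: field_simps)
      have X: "X = (\<kappa>\<^sup>2 - 1) / (2 * \<kappa>\<^sup>2)"
      proof -
        have "(\<kappa>\<^sup>2 - 1) / (2 * \<kappa>\<^sup>2) = (1 - 1 / \<kappa>\<^sup>2) / 2" using \<kappa>1 by (simp add: field_simps)
        also have "1 / \<kappa>\<^sup>2 = (1 - s)\<^sup>2 / (1 + s)\<^sup>2" by (simp add: \<kappa>_def cosh2 power_divide)
        also have "(1 - (1 - s)\<^sup>2 / (1 + s)\<^sup>2) / 2 = ((1 + s)\<^sup>2 - (1 - s)\<^sup>2) / (1 + s)\<^sup>2 / 2"
          using s by (simp add: diff_divide_distrib)
        also have "(1 + s)\<^sup>2 - (1 - s)\<^sup>2 = 4 * s" by (simp add: power2_eq_square algebra_simps)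
        finally show ?thesis by (simp add: X_def)
      qed
      have X01: "0 < X" "X < 1"
      proof -
        show "0 < X" using s by (simp add: X_def)
        have "(1 + s)\<^sup>2 = 1 + 2 * s + s\<^sup>2" by (simp add: power2_eq_square algebra_simps)
        then have "2 * s < (1 + s)\<^sup>2" using zero_le_power2[of s] by linarith
        then show "X < 1" using s by (simp add: X_def)
      qed
      have "S * (X\<^sup>2 / 3 * (1 - X / 2)) \<le> \<beta>"
      unfolding S_def proof (rule packing_real[OF p A])
        show "0 \<le> max 0 (1 - x / X)" for x by simp
        show "(\<lambda>x. max 0 (1 - x / X)) \<in> borel_measurable borel" by measurable
        show "(\<Sum>g\<in>A. max 0 (1 - (1 - qform v / (cmod (hform (g *v p) v))\<^sup>2) / X)) \<le> 1" if "qform v > 0" for v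
          unfolding X by (rule blichfeldt_overlap[OF that A(1) qp \<kappa>1]) (use sep in \<open>auto simp: \<kappa>_def\<close>)
        show "ennreal (X\<^sup>2 / 3 * (1 - X / 2)) \<le> radial_integral CARD('n) k (\<lambda>x. max 0 (1 - x / X))"
          using radial_integral_blichfeldt[OF X01 k8] n2 by (simp add: n_def)
      qed (use X01 \<beta>1 \<beta>0 in auto)
      moreover have "\<beta> \<le> X\<^sup>2 / 3 * (1 - X / 2) * (1 + E + D)"
      proof -
        \<comment> \<open>The value is 16/15 for l = 1 and 1 for l = 2.\<close>
        have "real (l + 1) * \<beta> \<le> 16/15" using l by (auto simp: \<beta>_def n2 beta_prim_2)
        then have "\<beta> \<le> X\<^sup>2 / 3 * (1 - X / 2) * (1 + 1 / (real (l + 1) * s\<^sup>2))"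
          unfolding X_def by (intro blichfeldt_numeric[OF s(1) small]) auto
        also have "\<dots> \<le> X\<^sup>2 / 3 * (1 - X / 2) * (1 + E + D)"
          unfolding E using D0 X01 n2 by (intro mult_left_mono) auto
        finally show ?thesis .
      qed
      ultimately show ?thesis using fin by blast
    next
      case False
      have "\<beta> \<le> J * (1 + 1 / (real (l + 1) * s\<^sup>2) + tail_weight s)"
        using l
      proof
        assume l1: "l = 1"
        then show ?thesis
          using ball_numeric_7[OF \<rho>(1)] False by (simp add: J_def \<beta>_def n2 beta_prim_2 \<rho>2 power3_eq_cube mult.assoc)
      next
        assume l2: "l = 2"
        have "\<rho> ^ 4 = (\<rho>\<^sup>2)\<^sup>2" "\<rho> ^ 6 = (\<rho>\<^sup>2) ^ 3" by (simp_all flip: power_mult)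
        moreover have "\<rho>\<^sup>2 = 1 - s" using \<rho>2 by simp
        ultimately have "J = s\<^sup>2 - 2 * s ^ 3 / 3"
          by (simp add: J_def \<beta>_def n2 l2 beta_prim_2) (simp add: power2_eq_square power3_eq_cube field_simps)
        moreover have "\<beta> = 1/3" by (simp add: \<beta>_def n2 l2 beta_prim_2)
        ultimately show ?thesis using ball_numeric_8[of s] False s by (simp add: l2)
      qed
      also have "\<dots> \<le> J * (1 + E + D)"
        unfolding E using J0 D n2 by (intro mult_left_mono) (auto simp: J_def)
      finally show ?thesis using fin ball by blast
    qed
  qed
  then show ?thesis by (simp only: S_def E_def D_def)
qed

section \<open>Displacement functions on the ball\<close>

definition lift :: "complex ^ 'n::finite \<Rightarrow> complex ^ ('n option)" where
  "lift z = vec_join (z, 1)"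

lemma lift_nth [simp]: "lift z $ None = 1" "lift z $ Some j = z $ j"
  by (simp_all add: lift_def vec_join_def)

lemma qform_lift: "qform (lift z) = 1 - (norm z)\<^sup>2"
  by (simp add: qform_def norm_vec_def L2_set_def sum_nonneg)

lemma hform_lift: "hform (lift z) (lift w) = herm_form z w"
  by (simp add: hform_def herm_form_def)

lemma unit_ball_iff: "z \<in> unit_ball \<longleftrightarrow> norm z < 1"
  using abs_square_less_1[of "norm z"] by (simp add: unit_ball_def)

lemma mult_lift_None: "(g *v lift z) $ None = aut_factor g z"
  by (simp add: matrix_vector_mult_def sum_option aut_factor_def)

lemma
  assumes g: "g \<in> U_n1" and z: "z \<in> unit_ball"
  shows aut_factor_nonzero: "aut_factor g z \<noteq> 0"
    and mult_lift: "g *v lift z = aut_factor g z *s lift (ball_act g z)"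
    and ball_act_unit_ball: "ball_act g z \<in> unit_ball"
    and one_minus_norm_ball_act: "1 - (norm z)\<^sup>2 = (cmod (aut_factor g z))\<^sup>2 * (1 - (norm (ball_act g z))\<^sup>2)"
proof -
  have q: "qform (g *v lift z) > 0" using z by (simp add: qform_U_n1[OF g] qform_lift unit_ball_def)
  then show nz: "aut_factor g z \<noteq> 0"
    using negative_cauchy_schwarz(1)[of "g *v lift z" "g *v lift z"] by (simp add: mult_lift_None)
  have "(g *v lift z) $ i = (aut_factor g z *s lift (ball_act g z)) $ i" for i
  proof (cases i)
    case None
    then show ?thesis by (simp add: mult_lift_None)
  next
    case (Some j)
    have "(g *v lift z) $ Some j = (\<Sum>l\<in>UNIV. g $ Some j $ Some l * z $ l) + g $ Some j $ None"
      by (simp add: matrix_vector_mult_def sum_option)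
    then show ?thesis using Some nz by (simp add: ball_act_def)
  qed
  then show ml: "g *v lift z = aut_factor g z *s lift (ball_act g z)" by (simp add: vec_eq_iff)
  have "hform (g *v lift z) (g *v lift z) = aut_factor g z * cnj (aut_factor g z) * hform (lift (ball_act g z)) (lift (ball_act g z))"
    unfolding ml by (simp add: hform_smult_left hform_smult_right)
  then have "complex_of_real (qform (g *v lift z)) = complex_of_real ((cmod (aut_factor g z))\<^sup>2) * complex_of_real (qform (lift (ball_act g z)))"
    unfolding hform_self complex_norm_square[symmetric] by simp
  then have e: "qform (g *v lift z) = (cmod (aut_factor g z))\<^sup>2 * (1 - (norm (ball_act g z))\<^sup>2)"
    by (simp only: of_real_mult[symmetric] of_real_eq_iff qform_lift)
  then show "1 - (norm z)\<^sup>2 = (cmod (aut_factor g z))\<^sup>2 * (1 - (norm (ball_act g z))\<^sup>2)"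
    by (simp add: qform_U_n1[OF g] qform_lift)
  show "ball_act g z \<in> unit_ball"
    using q nz by (simp add: e unit_ball_def zero_less_mult_iff)
qed

text \<open>The hyperbolic cosine of half the displacement of \<open>z\<close> under \<open>g\<close>.\<close>

definition disp :: "('n::finite) cmat1 \<Rightarrow> complex ^ 'n \<Rightarrow> real" where
  "disp g z = cmod (hform (lift z) (g *v lift z)) / (1 - (norm z)\<^sup>2)"

lemma disp_altdef:
  assumes g: "g \<in> U_n1" and z: "z \<in> unit_ball"
  shows "disp g z = cmod (herm_form z (ball_act g z)) * cmod (aut_factor g z) / (1 - (norm z)\<^sup>2)"
  unfolding disp_def mult_lift[OF g z] by (simp add: hform_smult_right hform_lift norm_mult mult.commute)

lemma cosh_hyp_dist_ball_act:
  assumes g: "g \<in> U_n1" and z: "z \<in> unit_ball"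
  shows "cosh (hyp_dist z (ball_act g z) / 2) = disp g z"
proof (rule power2_eq_imp_eq)
  define w where "w = ball_act g z"
  define A where "A = 1 - (norm z)\<^sup>2"
  define B where "B = 1 - (norm w)\<^sup>2"
  define c where "c = cmod (aut_factor g z)"
  have w: "w \<in> unit_ball" unfolding w_def by (rule ball_act_unit_ball[OF g z])
  have A: "A > 0" and B: "B > 0" using z w by (simp_all add: A_def B_def unit_ball_def)
  have AB: "A = c\<^sup>2 * B" using one_minus_norm_ball_act[OF g z] by (simp add: A_def B_def c_def w_def)
  have c0: "c \<noteq> 0" using AB A by auto
  have "(cosh (hyp_dist z w / 2))\<^sup>2 = (cmod (herm_form z w))\<^sup>2 / (A * B)"
    unfolding cosh_hyp_dist(1)[OF z w] by (simp add: herm_form_self A_def B_def algebra_simps)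
  also have "\<dots> = (cmod (herm_form z w) * c / A)\<^sup>2"
    using c0 B by (simp add: AB power_divide power_mult_distrib power2_eq_square)
  also have "\<dots> = (disp g z)\<^sup>2" by (simp add: disp_altdef[OF g z] w_def c_def A_def)
  finally show "(cosh (hyp_dist z (ball_act g z) / 2))\<^sup>2 = (disp g z)\<^sup>2" by (simp add: w_def)
  show "0 \<le> disp g z" using A by (simp add: disp_def A_def)
qed simp

lemma disp_conj:
  assumes h: "h \<in> U_n1" "h' \<in> U_n1" "h' ** h = mat 1" and g: "g \<in> U_n1" and z: "z \<in> unit_ball"
  shows "disp (h ** g ** h') (ball_act h z) = disp g z"
proof -
  define j where "j = aut_factor h z"
  have j: "j \<noteq> 0" unfolding j_def by (rule aut_factor_nonzero[OF h(1) z])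
  have l: "lift (ball_act h z) = (1 / j) *s (h *v lift z)"
    unfolding mult_lift[OF h(1) z] j_def[symmetric] using j by (simp add: vec_eq_iff)
  have "(h ** g ** h') *v lift (ball_act h z) = (1 / j) *s (h *v (g *v lift z))"
  proof -
    have "(h ** g ** h') *v (h *v lift z) = (h ** g ** (h' ** h)) *v lift z"
      by (simp add: matrix_vector_mul_assoc matrix_mul_assoc)
    also have "\<dots> = h *v (g *v lift z)" by (simp add: h(3) matrix_vector_mul_assoc)
    finally show ?thesis unfolding l by (simp add: vector_scalar_commute)
  qed
  then have "cmod (hform (lift (ball_act h z)) ((h ** g ** h') *v lift (ball_act h z))) = cmod (hform (lift z) (g *v lift z)) / (cmod j)\<^sup>2"
    unfolding l by (simp add: hform_smult_left hform_smult_right hform_U_n1[OF h(1)] norm_mult norm_divide power2_eq_square)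
  moreover have "1 - (norm (ball_act h z))\<^sup>2 = (1 - (norm z)\<^sup>2) / (cmod j)\<^sup>2"
    using one_minus_norm_ball_act[OF h(1) z] j by (simp add: j_def)
  ultimately show ?thesis using j by (simp add: disp_def)
qed

text \<open>The equality case of the reversed Cauchy-Schwarz inequality. Since (1 - a b)^2 - (1 -
  a^2) (1 - b^2) = (a - b)^2 and \<bar>1 - <z, w>\<bar> \<ge> 1 - a b, the bound forces a = b and Re
  <z, w> = a b, hence \<bar>z - w\<bar> = 0.\<close>

lemma herm_form_eqD:
  assumes z: "z \<in> unit_ball" and w: "w \<in> unit_ball"
    and le: "(cmod (herm_form z w))\<^sup>2 \<le> (1 - (norm z)\<^sup>2) * (1 - (norm w)\<^sup>2)"
  shows "z = w"
proof -
  define a b where "a = norm z" and "b = norm w"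
  define c where "c = (\<Sum>j\<in>UNIV. z $ j * cnj (w $ j))"
  have Re: "Re c = z \<bullet> w" by (simp add: c_def inner_vec_def inner_complex_def)
  have ab: "0 \<le> a" "0 \<le> b" "a < 1" "b < 1" using z w by (simp_all add: a_def b_def unit_ball_iff)
  then have "a * b < 1" using mult_strict_mono'[of a 1 b 1] by simp
  have rc: "Re c \<le> a * b" using Cauchy_Schwarz_ineq2[of z w] by (simp add: Re a_def b_def)
  have "1 - Re c \<le> cmod (herm_form z w)"
    using complex_Re_le_cmod[of "1 - c"] by (simp add: herm_form_def c_def norm_minus_commute)
  then have "(1 - Re c)\<^sup>2 \<le> (cmod (herm_form z w))\<^sup>2"
    using rc \<open>a * b < 1\<close> by (intro power_mono) auto
  also have "\<dots> \<le> (1 - a * b)\<^sup>2 - (a - b)\<^sup>2"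
    using le by (simp add: a_def b_def power2_eq_square algebra_simps)
  finally have 1: "(1 - Re c)\<^sup>2 \<le> (1 - a * b)\<^sup>2 - (a - b)\<^sup>2" .
  moreover have 2: "(1 - a * b)\<^sup>2 \<le> (1 - Re c)\<^sup>2" using rc \<open>a * b < 1\<close> by (intro power_mono) auto
  ultimately have "(a - b)\<^sup>2 \<le> 0" by linarith
  then have eq: "a = b" by simp
  have "(1 - Re c)\<^sup>2 \<le> (1 - a * b)\<^sup>2" using 1 eq by simp
  then have "1 - Re c \<le> 1 - a * b" by (rule power2_le_imp_le) (use \<open>a * b < 1\<close> in simp)
  then have "Re c = a * b" using rc by simp
  moreover have "(norm (z - w))\<^sup>2 = a\<^sup>2 + b\<^sup>2 - 2 * Re c"
    using dot_norm_neg[of z w] unfolding a_def b_def Re by (simp add: field_simps)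
  ultimately have "(norm (z - w))\<^sup>2 = a\<^sup>2 + b\<^sup>2 - 2 * (a * b)" by (simp only:)
  also have "\<dots> = (a - b)\<^sup>2" by (simp add: power2_eq_square algebra_simps)
  finally show ?thesis using eq by simp
qed

lemma fixed_point_of_disp_le_1:
  assumes g: "g \<in> U_n1" and z: "z \<in> unit_ball" and le: "disp g z \<le> 1"
  shows "ball_act g z = z"
proof -
  define w where "w = ball_act g z"
  have w: "w \<in> unit_ball" unfolding w_def by (rule ball_act_unit_ball[OF g z])
  define c where "c = cmod (aut_factor g z)"
  have A: "1 - (norm z)\<^sup>2 > 0" using z by (simp add: unit_ball_def)
  have AB: "1 - (norm z)\<^sup>2 = c\<^sup>2 * (1 - (norm w)\<^sup>2)" using one_minus_norm_ball_act[OF g z] by (simp add: c_def w_def)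
  have c: "c > 0" using aut_factor_nonzero[OF g z] by (simp add: c_def)
  have "cmod (herm_form z w) * c \<le> 1 - (norm z)\<^sup>2"
    using le A by (simp add: disp_altdef[OF g z] c_def w_def)
  then have "(cmod (herm_form z w) * c)\<^sup>2 \<le> (1 - (norm z)\<^sup>2)\<^sup>2" using c by (intro power_mono) auto
  also have "\<dots> = (1 - (norm z)\<^sup>2) * (1 - (norm w)\<^sup>2) * c\<^sup>2" unfolding AB by (simp add: power2_eq_square)
  finally have "(cmod (herm_form z w))\<^sup>2 * c\<^sup>2 \<le> (1 - (norm z)\<^sup>2) * (1 - (norm w)\<^sup>2) * c\<^sup>2"
    by (simp add: power_mult_distrib)
  then have "z = w" using c by (intro herm_form_eqD[OF z w]) simp
  then show ?thesis by (simp add: w_def)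
qed

section \<open>Discrete cocompact subgroups\<close>

lemma U_n1_column:
  assumes g: "g \<in> U_n1"
  shows "(cmod (g $ None $ None))\<^sup>2 = 1 + (\<Sum>i\<in>UNIV. (cmod (g $ Some i $ None))\<^sup>2)"
    and "(\<Sum>i\<in>UNIV. (cmod (g $ Some i $ Some j))\<^sup>2) = 1 + (cmod (g $ None $ Some j))\<^sup>2"
proof -
  have col: "(g *v axis m 1) $ i = g $ i $ m" for i m
    by (simp add: matrix_vector_mult_def axis_def if_distrib cong: if_cong)
  have "qform (g *v axis None 1) = 1" unfolding qform_U_n1[OF g] by (simp add: qform_def axis_def)
  then show "(cmod (g $ None $ None))\<^sup>2 = 1 + (\<Sum>i\<in>UNIV. (cmod (g $ Some i $ None))\<^sup>2)"
    by (simp add: qform_def col)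
  have "qform (g *v axis (Some j) 1) = - (\<Sum>i\<in>UNIV. (cmod (if i = j then 1 else 0))\<^sup>2)"
    unfolding qform_U_n1[OF g] by (simp add: qform_def axis_def)
  also have "(\<lambda>i. (cmod (if i = j then 1 else 0))\<^sup>2) = (\<lambda>i. if i = j then 1 else (0::real))" by auto
  also have "- sum (\<lambda>i. if i = j then 1 else (0::real)) UNIV = -1" by simp
  finally show "(\<Sum>i\<in>UNIV. (cmod (g $ Some i $ Some j))\<^sup>2) = 1 + (cmod (g $ None $ Some j))\<^sup>2"
    by (simp add: qform_def col)
qed

lemma U_n1_row:
  assumes g: "g \<in> U_n1"
  shows "(cmod (g $ None $ None))\<^sup>2 = 1 + (\<Sum>i\<in>UNIV. (cmod (g $ None $ Some i))\<^sup>2)"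
proof -
  obtain g' where g': "g' \<in> U_n1" and eq: "g' = H_mat ** conj_transpose g ** H_mat"
    using U_n1_inverse[OF g] by metis
  have "g' $ i $ m = (if i = None then -1 else 1) * cnj (g $ m $ i) * (if m = None then -1 else 1)" for i m
    unfolding eq by (simp add: matrix_matrix_mult_def H_mat_def conj_transpose_def if_distrib[of "\<lambda>x. x * _"]
        if_distrib[of "\<lambda>x. _ * x"] cong: if_cong)
  then show ?thesis using U_n1_column(1)[OF g'] by simp
qed

text \<open>The row relation gives \<bar>C\<bar> \<le> \<bar>D\<bar>, so \<bar>C z + D\<bar> \<ge>
  \<bar>D\<bar> (1 - \<bar>z\<bar>); the row and column relations then control every other entry by
  \<bar>D\<bar>. Thus the automorphy factor at a single point bounds the whole matrix.\<close>

lemma U_n1_entry_bound: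
  assumes g: "g \<in> U_n1" and z: "z \<in> unit_ball"
  shows "cmod (g $ i $ m) \<le> 1 + cmod (aut_factor g z) / (1 - norm z)"
proof -
  define d where "d = cmod (g $ None $ None)"
  have d0: "d \<ge> 0" by (simp add: d_def)
  define y where "y = (\<chi> i. cnj (g $ None $ Some i))"
  have "(norm y)\<^sup>2 = d\<^sup>2 - 1"
    using U_n1_row[OF g] by (simp add: y_def norm_vec_def L2_set_def sum_nonneg d_def)
  then have "(norm y)\<^sup>2 \<le> d\<^sup>2" by linarith
  then have y: "norm y \<le> d" using d0 by (rule power2_le_imp_le)
  have "(\<Sum>i\<in>UNIV. g $ None $ Some i * z $ i) = (\<Sum>i\<in>UNIV. z $ i * cnj (y $ i))"
    by (intro sum.cong) (simp_all add: y_def mult.commute)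
  then have "cmod (\<Sum>i\<in>UNIV. g $ None $ Some i * z $ i) \<le> norm z * norm y"
    using cmod_sum_le_norm[of z y] by simp
  also have "\<dots> \<le> norm z * d" using y by (intro mult_left_mono) auto
  finally have "d \<le> cmod (aut_factor g z) + norm z * d"
    using norm_triangle_ineq4[of "aut_factor g z" "\<Sum>i\<in>UNIV. g $ None $ Some i * z $ i"]
    by (simp add: aut_factor_def d_def)
  then have "d * (1 - norm z) \<le> cmod (aut_factor g z)" by (simp add: algebra_simps)
  moreover have "1 - norm z > 0" using z by (simp add: unit_ball_iff)
  ultimately have d: "d \<le> cmod (aut_factor g z) / (1 - norm z)" by (simp add: pos_le_divide_eq)
  have mem: "x l \<le> (\<Sum>l\<in>UNIV. x l)" if "\<And>l. x l \<ge> 0" for x :: "'a::finite \<Rightarrow> real" and l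
    using that by (intro member_le_sum) auto
  have row: "(cmod (g $ None $ Some l))\<^sup>2 \<le> d\<^sup>2" for l
    using mem[of "\<lambda>l. (cmod (g $ None $ Some l))\<^sup>2" l] U_n1_row[OF g] by (simp add: d_def)
  have "(cmod (g $ i $ m))\<^sup>2 \<le> 1 + d\<^sup>2"
  proof (cases i)
    case None
    then show ?thesis using row by (cases m) (auto simp: d_def intro: order_trans[OF row])
  next
    case (Some l)
    show ?thesis
    proof (cases m)
      case None
      then show ?thesis
        using mem[of "\<lambda>l. (cmod (g $ Some l $ None))\<^sup>2" l] U_n1_column(1)[OF g] Some by (simp add: d_def)
    next
      case (Some t)
      then show ?thesis
        using mem[of "\<lambda>l. (cmod (g $ Some l $ Some t))\<^sup>2" l] U_n1_column(2)[OF g, of t] row[of t] \<open>i = Some l\<close> by simp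
    qed
  qed
  also have "\<dots> \<le> (1 + d)\<^sup>2" using d0 by (simp add: power2_eq_square algebra_simps)
  finally have "cmod (g $ i $ m) \<le> 1 + d" by (rule power2_le_imp_le) (use d0 in simp)
  then show ?thesis using d by simp
qed

lemma SU_n1_subset_U_n1: "carrier SU_n1 \<subseteq> U_n1"
  by (auto simp: SU_n1_def U_n1_def)

lemma
  assumes "subgroup \<Gamma> SU_n1"
  shows subgroup_subset_U_n1: "\<Gamma> \<subseteq> U_n1"
    and subgroup_one: "mat 1 \<in> \<Gamma>"
    and subgroup_mult: "g \<in> \<Gamma> \<Longrightarrow> h \<in> \<Gamma> \<Longrightarrow> g ** h \<in> \<Gamma>"
    and subgroup_inverse: "g \<in> \<Gamma> \<Longrightarrow> H_mat ** conj_transpose g ** H_mat \<in> \<Gamma>"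
proof -
  interpret group SU_n1 by (rule group_SU_n1)
  interpret subgroup \<Gamma> SU_n1 by (rule assms)
  show U: "\<Gamma> \<subseteq> U_n1" using subset SU_n1_subset_U_n1 by blast
  show "mat 1 \<in> \<Gamma>" using one_closed by (simp add: SU_n1_def)
  show "g ** h \<in> \<Gamma>" if "g \<in> \<Gamma>" "h \<in> \<Gamma>" using m_closed[OF that] by (simp add: SU_n1_def)
  show "H_mat ** conj_transpose g ** H_mat \<in> \<Gamma>" if "g \<in> \<Gamma>"
  proof -
    have gU: "g \<in> U_n1" using U that by blast
    obtain g' where g': "g' ** g = mat 1" "g ** g' = mat 1" "g' = H_mat ** conj_transpose g ** H_mat"
      using U_n1_inverse[OF gU] by metis
    have "inv\<^bsub>SU_n1\<^esub> g ** g = mat 1" using l_inv[of g] that subset by (auto simp: SU_n1_def)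
    then have "inv\<^bsub>SU_n1\<^esub> g = g'" by (metis g'(2) matrix_mul_assoc matrix_mul_lid matrix_mul_rid)
    then show ?thesis using m_inv_closed[OF that] g'(3) by simp
  qed
qed

text \<open>\<open>discrete\<close> says that the points are isolated, which does not exclude an
  accumulation point x outside the group. Two distinct elements a, b near x have a^-1 b near the
  identity, and the identity is isolated. On \<open>U_n1\<close> the inverse is H a* H, so F is
  continuous on all pairs of matrices and makes sense at (x, x).\<close>

lemma finite_discrete_subgroup_bounded:
  fixes \<Gamma> :: "('n::finite) cmat1 set"
  assumes \<Gamma>: "subgroup \<Gamma> SU_n1" and disc: "discrete \<Gamma>"
  shows "finite {g \<in> \<Gamma>. \<forall>i j. cmod (g $ i $ j) \<le> M}" (is "finite ?S")
proof (rule ccontr)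
  assume inf: "infinite ?S"
  have "norm g \<le> (\<Sum>i\<in>(UNIV::'n option set). \<Sum>j\<in>(UNIV::'n option set). M)" if "g \<in> ?S" for g
  proof -
    have "norm g \<le> (\<Sum>i\<in>UNIV. norm (g $ i))" unfolding norm_vec_def by (rule L2_set_le_sum) simp
    also have "\<dots> \<le> (\<Sum>i\<in>UNIV. \<Sum>j\<in>UNIV. cmod (g $ i $ j))"
      by (intro sum_mono) (subst norm_vec_def, rule L2_set_le_sum, simp)
    also have "\<dots> \<le> (\<Sum>i\<in>(UNIV::'n option set). \<Sum>j\<in>(UNIV::'n option set). M)" using that by (intro sum_mono) auto
    finally show ?thesis .
  qed
  then have "bounded ?S" unfolding bounded_iff by blast
  then obtain x where x: "x islimpt ?S" using bounded_infinite_imp_islimpt[OF _ _ inf] by blast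
  define F where "F y = H_mat ** conj_transpose (fst y) ** H_mat ** snd y" for y :: "'n cmat1 \<times> 'n cmat1"
  have contF: "continuous_on UNIV F"
    unfolding F_def matrix_matrix_mult_def conj_transpose_def by (intro continuous_intros)
  have Fgg: "F (g, g) = mat 1" if "g \<in> ?S" for g
  proof -
    have "g \<in> U_n1" using that subgroup_subset_U_n1[OF \<Gamma>] by blast
    then show ?thesis using U_n1_inverse[of g] by (metis F_def fst_conv snd_conv)
  qed
  have Fxx: "F (x, x) = mat 1"
  proof -
    have "closed {y. F (y, y) = mat 1}"
      by (intro closed_Collect_eq continuous_intros continuous_on_compose2[OF contF]) auto
    moreover have "?S \<subseteq> {y. F (y, y) = mat 1}" using Fgg by blast
    ultimately have "x \<in> {y. F (y, y) = mat 1}" using x by (meson closed_limpt islimpt_subset)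
    then show ?thesis by simp
  qed
  have "mat 1 isolated_in \<Gamma>" using disc subgroup_one[OF \<Gamma>] by (rule discreteD)
  then obtain e where e: "e > 0" "\<And>y. y \<in> \<Gamma> \<Longrightarrow> dist (mat 1) y < e \<Longrightarrow> y = mat 1"
    unfolding isolated_in_dist_Ex_iff by blast
  have "isCont F (x, x)" using contF by (simp add: continuous_on_eq_continuous_at)
  then obtain d where d: "d > 0" "\<And>y. dist y (x, x) < d \<Longrightarrow> dist (F y) (F (x, x)) < e"
    using e(1) unfolding continuous_at_eps_delta by blast
  obtain a where a: "a \<in> ?S" "a \<noteq> x" "dist a x < d / 2"
    using x d(1) unfolding islimpt_approachable by (meson half_gt_zero)
  \<comment> \<open>Taking b strictly closer to x than a makes the two elements distinct.\<close>
  have "min (d / 2) (dist a x) > 0" using d(1) a(2) by simp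
  then obtain b where b: "b \<in> ?S" "b \<noteq> x" "dist b x < min (d / 2) (dist a x)"
    using x unfolding islimpt_approachable by blast
  have "dist (a, b) (x, x) \<le> dist a x + dist b x"
    unfolding dist_prod_def by (simp add: sqrt_sum_squares_le_sum)
  then have "dist (F (a, b)) (mat 1) < e" using d(2)[of "(a, b)"] a b Fxx by simp
  moreover have "F (a, b) \<in> \<Gamma>"
    unfolding F_def using a b by (auto intro!: subgroup_mult[OF \<Gamma>] subgroup_inverse[OF \<Gamma>])
  ultimately have "F (a, b) = mat 1" using e(2) by (simp add: dist_commute)
  moreover have "a ** F (a, b) = b"
  proof -
    have "a \<in> U_n1" using a subgroup_subset_U_n1[OF \<Gamma>] by blast
    then have "a ** (H_mat ** conj_transpose a ** H_mat) = mat 1" using U_n1_inverse[of a] by metis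
    then show ?thesis by (simp add: F_def matrix_mul_assoc)
  qed
  ultimately have "a = b" by simp
  then show False using b by simp
qed

text \<open>The powers of g fix z with automorphy factors of modulus 1, so their entries are bounded
  and there are only finitely many of them. Two powers coincide, and g has finite order.\<close>

lemma no_fixed_points:
  fixes \<Gamma> :: "('n::finite) cmat1 set"
  assumes \<Gamma>: "subgroup \<Gamma> SU_n1" and disc: "discrete \<Gamma>" and tf: "torsion_free \<Gamma>"
    and g: "g \<in> \<Gamma>" and z: "z \<in> unit_ball" and fp: "ball_act g z = z"
  shows "g = mat 1"
proof -
  interpret group SU_n1 by (rule group_SU_n1)
  interpret subgroup \<Gamma> SU_n1 by (rule \<Gamma>)
  have gU: "g \<in> U_n1" using g subgroup_subset_U_n1[OF \<Gamma>] by blast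
  have gc: "g \<in> carrier SU_n1" using g subset by blast
  define j where "j = aut_factor g z"
  have gz: "g *v lift z = j *s lift z" using mult_lift[OF gU z] by (simp add: fp j_def)
  have j1: "cmod j = 1"
  proof -
    have "1 - (norm z)\<^sup>2 > 0" using z by (simp add: unit_ball_def)
    moreover have "1 - (norm z)\<^sup>2 = (cmod j)\<^sup>2 * (1 - (norm z)\<^sup>2)"
      using one_minus_norm_ball_act[OF gU z] by (simp only: fp j_def)
    ultimately have "(cmod j)\<^sup>2 = 1\<^sup>2" by (metis less_irrefl mult_cancel_right1 one_power2)
    then show ?thesis by (rule power2_eq_imp_eq) simp_all
  qed
  have pow: "(g [^]\<^bsub>SU_n1\<^esub> m) *v lift z = j ^ m *s lift z \<and> g [^]\<^bsub>SU_n1\<^esub> m \<in> \<Gamma>" for m :: nat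
  proof (induction m)
    case 0
    then show ?case using subgroup_one[OF \<Gamma>] by (simp add: SU_n1_def nat_pow_def)
  next
    case (Suc m)
    have "g [^]\<^bsub>SU_n1\<^esub> Suc m = (g [^]\<^bsub>SU_n1\<^esub> m) ** g" by (simp add: SU_n1_def nat_pow_def)
    moreover have "((g [^]\<^bsub>SU_n1\<^esub> m) ** g) *v lift z = (g [^]\<^bsub>SU_n1\<^esub> m) *v (j *s lift z)"
      by (simp add: gz flip: matrix_vector_mul_assoc)
    moreover have "\<dots> = j *s ((g [^]\<^bsub>SU_n1\<^esub> m) *v lift z)" by (rule vector_scalar_commute)
    moreover have "\<dots> = j ^ Suc m *s lift z" using Suc by (simp add: vector_smult_assoc)
    ultimately show ?case using Suc subgroup_mult[OF \<Gamma> _ g] by metis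
  qed
  define M where "M = 1 + 1 / (1 - norm z)"
  have "g [^]\<^bsub>SU_n1\<^esub> m \<in> {h \<in> \<Gamma>. \<forall>i j. cmod (h $ i $ j) \<le> M}" for m :: nat
  proof -
    define h where "h = g [^]\<^bsub>SU_n1\<^esub> m"
    have h: "h \<in> \<Gamma>" "h *v lift z = j ^ m *s lift z" using pow[of m] by (simp_all add: h_def)
    have "aut_factor h z = j ^ m" using mult_lift_None[of h z] by (simp add: h(2))
    then have "cmod (aut_factor h z) = 1" by (simp add: norm_power j1)
    then show ?thesis
      using h(1) U_n1_entry_bound[of h z] z subgroup_subset_U_n1[OF \<Gamma>] by (auto simp: M_def h_def[symmetric])
  qed
  then have "range (\<lambda>m::nat. g [^]\<^bsub>SU_n1\<^esub> m) \<subseteq> {h \<in> \<Gamma>. \<forall>i j. cmod (h $ i $ j) \<le> M}" by blast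
  then have "finite (range (\<lambda>m::nat. g [^]\<^bsub>SU_n1\<^esub> m))"
    using finite_discrete_subgroup_bounded[OF \<Gamma> disc] by (rule finite_subset)
  then have "\<not> inj (\<lambda>m::nat. g [^]\<^bsub>SU_n1\<^esub> m)" using finite_imageD infinite_UNIV_nat by blast
  then obtain a b :: nat where ab: "a < b" "g [^]\<^bsub>SU_n1\<^esub> a = g [^]\<^bsub>SU_n1\<^esub> b"
    unfolding inj_def by (metis linorder_neqE_nat)
  have "g [^]\<^bsub>SU_n1\<^esub> a \<otimes>\<^bsub>SU_n1\<^esub> g [^]\<^bsub>SU_n1\<^esub> (b - a) = g [^]\<^bsub>SU_n1\<^esub> a"
    using nat_pow_mult[OF gc, of a "b - a"] ab by simp
  then have "g [^]\<^bsub>SU_n1\<^esub> (b - a) = \<one>\<^bsub>SU_n1\<^esub>"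
    using gc by (simp add: l_cancel_one')
  then have "g = \<one>\<^bsub>SU_n1\<^esub>" using tf g ab(1) unfolding torsion_free_def by (metis zero_less_diff)
  then show ?thesis by (simp add: SU_n1_def)
qed

section \<open>Cocompactness and the uniform lower bound for the displacement\<close>

lemma ball_act_mult:
  assumes g: "g \<in> U_n1" and h: "h \<in> U_n1" and z: "z \<in> unit_ball"
  shows "ball_act (g ** h) z = ball_act g (ball_act h z)"
proof -
  define w where "w = ball_act h z"
  have w: "w \<in> unit_ball" unfolding w_def by (rule ball_act_unit_ball[OF h z])
  have "(g ** h) *v lift z = g *v (aut_factor h z *s lift w)"
    by (simp add: mult_lift[OF h z] w_def flip: matrix_vector_mul_assoc)
  also have "\<dots> = aut_factor h z *s (g *v lift w)" by (rule vector_scalar_commute)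
  also have "\<dots> = (aut_factor h z * aut_factor g w) *s lift (ball_act g w)"
    by (simp add: mult_lift[OF g w] vector_smult_assoc)
  finally have eq: "aut_factor (g ** h) z *s lift (ball_act (g ** h) z) = (aut_factor h z * aut_factor g w) *s lift (ball_act g w)"
    by (simp add: mult_lift[OF U_n1_mult[OF g h] z])
  from arg_cong[OF eq, of "\<lambda>v. v $ None"] have a: "aut_factor (g ** h) z = aut_factor h z * aut_factor g w" by simp
  have "ball_act (g ** h) z $ i = ball_act g w $ i" for i
    using arg_cong[OF eq, of "\<lambda>v. v $ Some i"] aut_factor_nonzero[OF U_n1_mult[OF g h] z] by (simp add: a)
  then show ?thesis by (simp add: vec_eq_iff w_def)
qed

lemma ball_act_one: "ball_act (mat 1) z = z"
proof -
  have "mat 1 *v lift z = lift z" by simp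
  then have "aut_factor (mat 1) z = 1" using mult_lift_None[of "mat 1" z] by simp
  then show ?thesis
    by (simp add: ball_act_def vec_eq_iff mat_def if_distrib[of "\<lambda>x. x * _"] cong: if_cong)
qed

lemma orbit_of_ball_act:
  assumes \<Gamma>: "subgroup \<Gamma> SU_n1" and h: "h \<in> \<Gamma>" and z: "z \<in> unit_ball"
  shows "orbit_of \<Gamma> (ball_act h z) = orbit_of \<Gamma> z"
proof -
  have U: "g \<in> U_n1" if "g \<in> \<Gamma>" for g using subgroup_subset_U_n1[OF \<Gamma>] that by blast
  obtain h' where h': "h' ** h = mat 1" "h' = H_mat ** conj_transpose h ** H_mat"
    using U_n1_inverse[OF U[OF h]] by metis
  have h'\<Gamma>: "h' \<in> \<Gamma>" unfolding h'(2) by (rule subgroup_inverse[OF \<Gamma> h])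
  show ?thesis
  proof (intro subset_antisym subsetI)
    fix x assume "x \<in> orbit_of \<Gamma> (ball_act h z)"
    then obtain g where g: "g \<in> \<Gamma>" "x = ball_act g (ball_act h z)" by (auto simp: orbit_of_def)
    then have "x = ball_act (g ** h) z" using U[OF g(1)] U[OF h] z by (simp add: ball_act_mult)
    then show "x \<in> orbit_of \<Gamma> z" using subgroup_mult[OF \<Gamma> g(1) h] by (auto simp: orbit_of_def)
  next
    fix x assume "x \<in> orbit_of \<Gamma> z"
    then obtain g where g: "g \<in> \<Gamma>" "x = ball_act g z" by (auto simp: orbit_of_def)
    have "ball_act (g ** h') (ball_act h z) = ball_act (g ** h' ** h) z"
      using U[OF g(1)] U[OF h'\<Gamma>] U[OF h] z by (simp add: ball_act_mult U_n1_mult)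
    also have "g ** h' ** h = g" by (simp add: h'(1) flip: matrix_mul_assoc)
    finally show "x \<in> orbit_of \<Gamma> (ball_act h z)"
      unfolding orbit_of_def using g subgroup_mult[OF \<Gamma> g(1) h'\<Gamma>]
      by (intro image_eqI[of _ _ "g ** h'"]) simp_all
  qed
qed

text \<open>The balls of radius m/(m + 1) about the origin increase to the unit ball and have open
  images in the quotient, so by compactness the image of one of them is everything.\<close>

lemma cocompact_radius:
  fixes \<Gamma> :: "('n::finite) cmat1 set"
  assumes \<Gamma>: "subgroup \<Gamma> SU_n1" and co: "cocompact \<Gamma>"
  obtains R where "0 \<le> R" "R < 1" "\<And>z. z \<in> unit_ball \<Longrightarrow> \<exists>h\<in>\<Gamma>. norm (ball_act h z) \<le> R"
proof -
  have U: "g \<in> U_n1" if "g \<in> \<Gamma>" for g using subgroup_subset_U_n1[OF \<Gamma>] that by blast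
  define t where "t m = real m / (real m + 1)" for m
  have t: "0 \<le> t m" "t m < 1" for m by (simp_all add: t_def)
  define W where "W m = orbit_of \<Gamma> ` {z. norm z < t m}" for m
  have sub: "{z. norm z < t m} \<subseteq> (unit_ball :: (complex ^ 'n) set)" for m
    using t(2)[of m] by (auto simp: unit_ball_iff)
  have iff: "orbit_of \<Gamma> z \<in> W m \<longleftrightarrow> (\<exists>h\<in>\<Gamma>. norm (ball_act h z) < t m)" if z: "z \<in> unit_ball" for z m
  proof
    assume "orbit_of \<Gamma> z \<in> W m"
    then obtain w where w: "norm w < t m" "orbit_of \<Gamma> z = orbit_of \<Gamma> w" by (auto simp: W_def)
    have "w \<in> orbit_of \<Gamma> w" using subgroup_one[OF \<Gamma>] ball_act_one[of w] by (force simp: orbit_of_def)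
    then have "w \<in> orbit_of \<Gamma> z" by (simp only: w(2))
    then show "\<exists>h\<in>\<Gamma>. norm (ball_act h z) < t m" using w(1) by (auto simp: orbit_of_def)
  next
    assume "\<exists>h\<in>\<Gamma>. norm (ball_act h z) < t m"
    then obtain h where h: "h \<in> \<Gamma>" "norm (ball_act h z) < t m" by blast
    then have "orbit_of \<Gamma> (ball_act h z) \<in> W m" by (auto simp: W_def)
    then show "orbit_of \<Gamma> z \<in> W m" by (simp only: orbit_of_ball_act[OF \<Gamma> h(1) z])
  qed
  \<comment> \<open>Multiplied by the squared automorphy factor, the condition becomes an inequality
    between polynomial expressions in z, so its openness needs no continuity of
    \<open>ball_act\<close>.\<close>
  have less: "norm (ball_act h z) < t m \<longleftrightarrow> (1 - (t m)\<^sup>2) * (cmod (aut_factor h z))\<^sup>2 < 1 - (norm z)\<^sup>2"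
    if "h \<in> \<Gamma>" and z: "z \<in> unit_ball" for h z m
  proof -
    have "norm (ball_act h z) < t m \<longleftrightarrow> (norm (ball_act h z))\<^sup>2 < (t m)\<^sup>2"
      using t(1)[of m] by (metis norm_ge_zero power2_less_imp_less power_strict_mono zero_less_numeral)
    also have "\<dots> \<longleftrightarrow> (1 - (t m)\<^sup>2) * (cmod (aut_factor h z))\<^sup>2 < (1 - (norm (ball_act h z))\<^sup>2) * (cmod (aut_factor h z))\<^sup>2"
      using aut_factor_nonzero[OF U[OF that(1)] z] by (simp add: mult_less_cancel_right)
    finally show ?thesis using one_minus_norm_ball_act[OF U[OF that(1)] z] by (simp add: mult.commute)
  qed
  have "openin (X_top \<Gamma>) (W m)" for m
  proof -
    have "W m \<subseteq> X_quot \<Gamma>" using sub[of m] by (auto simp: W_def X_quot_def)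
    moreover have "{z \<in> unit_ball. orbit_of \<Gamma> z \<in> W m}
      = (\<Union>h\<in>\<Gamma>. unit_ball \<inter> {z. (1 - (t m)\<^sup>2) * (cmod (aut_factor h z))\<^sup>2 < 1 - (norm z)\<^sup>2})"
      using iff less by auto
    moreover have "open (\<Union>h\<in>\<Gamma>. unit_ball \<inter> {z. (1 - (t m)\<^sup>2) * (cmod (aut_factor h z))\<^sup>2 < 1 - (norm z)\<^sup>2})"
      unfolding aut_factor_def
      by (intro open_UN ballI open_Int open_unit_ball open_Collect_less continuous_intros)
    ultimately show ?thesis by (simp add: openin_X_top)
  qed
  moreover have top: "topspace (X_top \<Gamma>) = orbit_of \<Gamma> ` unit_ball"
    using quotient_map_X_top[of \<Gamma>] by (simp add: quotient_map_def)
  moreover have "topspace (X_top \<Gamma>) \<subseteq> \<Union> (range W)"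
  proof
    fix x assume "x \<in> topspace (X_top \<Gamma>)"
    then obtain z where z: "z \<in> unit_ball" "x = orbit_of \<Gamma> z" by (auto simp: top)
    obtain m where m: "norm z / (1 - norm z) < real m" using reals_Archimedean2 by blast
    have "norm z < t m" using m z(1) by (simp add: t_def unit_ball_iff field_simps)
    then show "x \<in> \<Union> (range W)" using z(2) by (auto simp: W_def)
  qed
  ultimately obtain \<F> where \<F>: "finite \<F>" "\<F> \<subseteq> range W" "topspace (X_top \<Gamma>) \<subseteq> \<Union> \<F>"
    using co[unfolded cocompact_def compact_space_alt, rule_format, of "range W"] by blast
  then obtain I where I: "finite I" "\<F> = W ` I" by (meson finite_subset_image)
  define N where "N = Max (insert 0 I)"
  show ?thesis
  proof (rule that[of "t N"])
    fix z :: "complex ^ 'n" assume z: "z \<in> unit_ball"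
    then have "orbit_of \<Gamma> z \<in> \<Union> \<F>" using \<F>(3) top by blast
    then obtain m where m: "m \<in> I" "orbit_of \<Gamma> z \<in> W m" using I by auto
    then obtain h where h: "h \<in> \<Gamma>" "norm (ball_act h z) < t m" using iff[OF z] by blast
    have "m \<le> N" unfolding N_def using I(1) m(1) by (intro Max_ge) auto
    then have "t m \<le> t N" by (simp add: t_def field_simps)
    then show "\<exists>h\<in>\<Gamma>. norm (ball_act h z) \<le> t N" using h by force
  qed (use t in auto)
qed

text \<open>Conjugation by an element of the group moves z into a fixed compact ball. There a
  displacement value of at most 2 bounds the automorphy factor and with it all entries, so only
  finitely many elements remain; each of them attains a minimum, which exceeds 1 because it has no
  fixed point.\<close>

lemma disp_uniform:
  fixes \<Gamma> :: "('n::finite) cmat1 set"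
  assumes \<Gamma>: "subgroup \<Gamma> SU_n1" and disc: "discrete \<Gamma>" and tf: "torsion_free \<Gamma>" and co: "cocompact \<Gamma>"
  obtains \<mu> where "\<mu> > 1" "\<And>g z. g \<in> \<Gamma> - {mat 1} \<Longrightarrow> z \<in> unit_ball \<Longrightarrow> \<mu> \<le> disp g z"
proof -
  have U: "g \<in> U_n1" if "g \<in> \<Gamma>" for g using subgroup_subset_U_n1[OF \<Gamma>] that by blast
  obtain R where R: "0 \<le> R" "R < 1" "\<And>z. z \<in> unit_ball \<Longrightarrow> \<exists>h\<in>\<Gamma>. norm (ball_act h z) \<le> R"
    using cocompact_radius[OF \<Gamma> co] by blast
  define M where "M = 1 + 2 / (1 - R) / (1 - R)"
  define S where "S = {g \<in> \<Gamma>. \<forall>i j. cmod (g $ i $ j) \<le> M} - {mat 1}"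
  have finS: "finite S" unfolding S_def using finite_discrete_subgroup_bounded[OF \<Gamma> disc] by simp
  have ball: "cball 0 R \<subseteq> (unit_ball :: (complex ^ 'n) set)" using R(2) by (auto simp: unit_ball_iff)
  have "\<exists>m>1. \<forall>z\<in>cball 0 R. m \<le> disp g z" if g: "g \<in> S" for g
  proof -
    have g\<Gamma>: "g \<in> \<Gamma>" "g \<noteq> mat 1" using g by (auto simp: S_def)
    have "continuous_on (cball 0 R) (disp g)"
    proof -
      have [continuous_intros]: "continuous_on A lift" for A :: "(complex ^ 'n) set"
      proof -
        have "continuous_on A (\<lambda>z. vec_join (z, 1))"
          by (rule continuous_on_compose2[OF linear_continuous_on[of vec_join UNIV]])
            (auto intro!: continuous_intros simp: linear_vec_join simp flip: linear_conv_bounded_linear)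
        then show ?thesis by (simp add: lift_def[abs_def])
      qed
      have "1 - (norm z)\<^sup>2 \<noteq> 0" if "z \<in> cball 0 R" for z :: "complex ^ 'n"
        using ball that by (auto simp: unit_ball_def)
      then show ?thesis unfolding disp_def
        by (intro continuous_intros continuous_on_compose2[OF continuous_on_complex_matrix]) auto
    qed
    moreover have "cball 0 R \<noteq> ({} :: (complex ^ 'n) set)" using R(1) by auto
    ultimately obtain z where z: "z \<in> cball 0 R" "\<And>w. w \<in> cball 0 R \<Longrightarrow> disp g z \<le> disp g w"
      using continuous_attains_inf[of "cball 0 R" "disp g"] by auto
    have "disp g z > 1"
      using fixed_point_of_disp_le_1[OF U[OF g\<Gamma>(1)], of z] no_fixed_points[OF \<Gamma> disc tf g\<Gamma>(1), of z] z(1) ball g\<Gamma>(2)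
      by (meson not_le subsetD)
    then show ?thesis using z(2) by blast
  qed
  then obtain f where f: "\<And>g. g \<in> S \<Longrightarrow> f g > 1" "\<And>g z. g \<in> S \<Longrightarrow> z \<in> cball 0 R \<Longrightarrow> f g \<le> disp g z"
    by metis
  \<comment> \<open>The 2 is the arbitrary cutoff for large displacements, and the default when S is
    empty.\<close>
  define \<mu> where "\<mu> = Min (insert 2 (f ` S))"
  show ?thesis
  proof (rule that[of \<mu>])
    show "\<mu> > 1" unfolding \<mu>_def using finS f(1) by (subst Min_gr_iff) auto
    fix g and z :: "complex ^ 'n" assume g: "g \<in> \<Gamma> - {mat 1}" and z: "z \<in> unit_ball"
    obtain h where h: "h \<in> \<Gamma>" "norm (ball_act h z) \<le> R" using R(3)[OF z] by blast
    obtain h' where h': "h' \<in> U_n1" "h' ** h = mat 1" "h ** h' = mat 1" "h' = H_mat ** conj_transpose h ** H_mat"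
      using U_n1_inverse[OF U[OF h(1)]] by metis
    have h'\<Gamma>: "h' \<in> \<Gamma>" unfolding h'(4) by (rule subgroup_inverse[OF \<Gamma> h(1)])
    define k where "k = h ** g ** h'"
    define w where "w = ball_act h z"
    have w: "w \<in> unit_ball" "norm w \<le> R"
      using ball_act_unit_ball[OF U[OF h(1)] z] h(2) by (simp_all add: w_def)
    have k\<Gamma>: "k \<in> \<Gamma>" unfolding k_def using g h(1) h'\<Gamma> by (auto intro!: subgroup_mult[OF \<Gamma>])
    have "k \<noteq> mat 1"
    proof
      assume "k = mat 1"
      have "h' ** k ** h = (h' ** h) ** g ** (h' ** h)" by (simp add: k_def matrix_mul_assoc)
      then have "g = mat 1" using \<open>k = mat 1\<close> by (simp add: h'(2))
      then show False using g by simp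
    qed
    have eq: "disp g z = disp k w"
      unfolding k_def w_def using disp_conj[OF U[OF h(1)] h'(1,2) _ z, of g] U g by simp
    show "\<mu> \<le> disp g z"
    proof (cases "disp k w \<le> 2")
      case False
      moreover have "\<mu> \<le> 2" unfolding \<mu>_def using finS by (intro Min_le) auto
      ultimately show ?thesis by (simp add: eq)
    next
      case True
      have kU: "k \<in> U_n1" by (rule U[OF k\<Gamma>])
      define v where "v = ball_act k w"
      have v: "v \<in> unit_ball" unfolding v_def by (rule ball_act_unit_ball[OF kU w(1)])
      have "1 - R \<le> cmod (herm_form w v)"
      proof -
        have "norm w * norm v \<le> R * 1" using w v R(1) by (intro mult_mono) (auto simp: unit_ball_iff)
        then show ?thesis
          using norm_triangle_ineq2[of 1 "\<Sum>j\<in>UNIV. w $ j * cnj (v $ j)"] cmod_sum_le_norm[of w v]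
          by (simp add: herm_form_def norm_minus_commute)
      qed
      then have "(1 - R) * cmod (aut_factor k w) \<le> cmod (herm_form w v) * cmod (aut_factor k w)"
        by (intro mult_right_mono) auto
      also have "\<dots> \<le> 2 * (1 - (norm w)\<^sup>2)"
        using True w(1) by (simp add: disp_altdef[OF kU w(1)] v_def unit_ball_def divide_le_eq)
      also have "\<dots> \<le> 2" by simp
      finally have a: "cmod (aut_factor k w) \<le> 2 / (1 - R)" using R(2) by (simp add: pos_le_divide_eq mult.commute)
      have "cmod (k $ i $ j) \<le> M" for i j
      proof -
        have "cmod (aut_factor k w) / (1 - norm w) \<le> 2 / (1 - R) / (1 - R)"
          using a w(2) R(2) by (intro frac_le) auto
        then show ?thesis using U_n1_entry_bound[OF kU w(1), of i j] by (simp add: M_def)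
      qed
      then have kS: "k \<in> S" using k\<Gamma> \<open>k \<noteq> mat 1\<close> by (simp add: S_def)
      have "\<mu> \<le> f k" unfolding \<mu>_def using finS kS by (intro Min_le) auto
      also have "\<dots> \<le> disp k w" using f(2)[OF kS, of w] w(2) by simp
      finally show ?thesis by (simp add: eq)
    qed
  qed
qed

text \<open>The nontrivial element makes the infimum run over a nonempty set, so that the bound 2
  arcosh \<mu> for each displacement passes to \<open>inj_radius\<close>.\<close>

lemma
  fixes \<Gamma> :: "('n::finite) cmat1 set"
  assumes \<Gamma>: "subgroup \<Gamma> SU_n1" and disc: "discrete \<Gamma>" and tf: "torsion_free \<Gamma>" and co: "cocompact \<Gamma>"
    and ne: "\<Gamma> \<noteq> {mat 1}"
  shows inj_radius_pos: "inj_radius \<Gamma> > 0"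
    and disp_ge_inj_radius: "g \<in> \<Gamma> - {mat 1} \<Longrightarrow> z \<in> unit_ball \<Longrightarrow> cosh (inj_radius \<Gamma> / 2) \<le> disp g z"
proof -
  have U: "g \<in> U_n1" if "g \<in> \<Gamma>" for g using subgroup_subset_U_n1[OF \<Gamma>] that by blast
  let ?D = "{hyp_dist z (ball_act g z) | z g. z \<in> unit_ball \<and> g \<in> \<Gamma> - {mat 1}}"
  obtain \<mu> where \<mu>: "\<mu> > 1" "\<And>g z. g \<in> \<Gamma> - {mat 1} \<Longrightarrow> z \<in> unit_ball \<Longrightarrow> \<mu> \<le> disp g z"
    using disp_uniform[OF \<Gamma> disc tf co] by blast
  have d0: "0 \<le> hyp_dist z (ball_act g z)" if "z \<in> unit_ball" "g \<in> \<Gamma>" for z g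
    using cosh_hyp_dist(2)[OF that(1) ball_act_unit_ball[OF U[OF that(2)] that(1)]] .
  have "0 \<in> (unit_ball :: (complex ^ 'n) set)" by (simp add: unit_ball_def)
  moreover obtain g0 where "g0 \<in> \<Gamma> - {mat 1}" using ne subgroup_one[OF \<Gamma>] by blast
  ultimately have D: "?D \<noteq> {}" by blast
  have "2 * arcosh \<mu> \<le> inj_radius \<Gamma>"
    unfolding inj_radius_def
  proof (rule cInf_greatest[OF D])
    fix x assume "x \<in> ?D"
    then obtain z g where zg: "z \<in> unit_ball" "g \<in> \<Gamma> - {mat 1}" "x = hyp_dist z (ball_act g z)" by blast
    have "cosh (arcosh \<mu>) \<le> cosh (x / 2)"
      using \<mu>(2)[OF zg(2,1)] \<mu>(1) cosh_hyp_dist_ball_act[of g z] U zg by (simp add: cosh_arcosh_real)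
    moreover have "0 \<le> arcosh \<mu>" "0 \<le> x / 2" using \<mu>(1) d0 zg by (auto simp: arcosh_nonneg_real)
    ultimately have "arcosh \<mu> \<le> x / 2" by (simp only: cosh_real_nonneg_le_iff)
    then show "2 * arcosh \<mu> \<le> x" by simp
  qed
  moreover have "arcosh \<mu> > 0"
  proof -
    have "arcosh \<mu> \<noteq> 0" using cosh_arcosh_real[of \<mu>] \<mu>(1) by auto
    then show ?thesis using arcosh_nonneg_real[of \<mu>] \<mu>(1) by simp
  qed
  ultimately show r0: "inj_radius \<Gamma> > 0" by linarith
  show "cosh (inj_radius \<Gamma> / 2) \<le> disp g z" if g: "g \<in> \<Gamma> - {mat 1}" and z: "z \<in> unit_ball"
  proof -
    have "bdd_below ?D" using d0 by (intro bdd_belowI[of _ 0]) auto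
    then have "inj_radius \<Gamma> \<le> hyp_dist z (ball_act g z)"
      unfolding inj_radius_def using g z by (intro cInf_lower) auto
    then have "cosh (inj_radius \<Gamma> / 2) \<le> cosh (hyp_dist z (ball_act g z) / 2)"
      using r0 by (subst cosh_real_nonneg_le_iff) auto
    then show ?thesis using cosh_hyp_dist_ball_act[of g z] U g z by simp
  qed
qed

section \<open>From the orbit sum to the Bergman kernel\<close>

lemma bergman_pet_le:
  fixes \<Gamma> :: "('n::finite) cmat1 set"
  assumes \<Gamma>: "subgroup \<Gamma> SU_n1" and C: "bergman_series_const \<Gamma> k \<B> C" and z: "z \<in> unit_ball"
    and T: "\<And>A. finite A \<Longrightarrow> A \<subseteq> \<Gamma> \<Longrightarrow> (\<Sum>g\<in>A. 1 / disp g z ^ k) \<le> T"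
  shows "bergman_pet \<B> k z \<le> C * T"
proof -
  define f where "f g = complex_of_real C / (ball_pairing z (ball_act g z) ^ k * cnj (aut_factor g z) ^ k)" for g
  define q where "q = 1 - (norm z)\<^sup>2"
  have q: "q > 0" using z by (simp add: q_def unit_ball_def)
  have C0: "C \<ge> 0" and hs: "(f has_sum bergman_kernel \<B> z z) \<Gamma>"
    using C z by (auto simp: bergman_series_const_def f_def[abs_def])
  \<comment> \<open>In absolute value the terms of the expansion depend on g only through the
    displacement, so a bound uniform over finite partial sums passes to the limit.\<close>
  have fg: "cmod (f g) = C / q ^ k * (1 / disp g z ^ k)" if g: "g \<in> \<Gamma>" for g
  proof -
    have gU: "g \<in> U_n1" using subgroup_subset_U_n1[OF \<Gamma>] g by blast
    have "ball_pairing z (ball_act g z) = - herm_form z (ball_act g z)"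
      by (simp add: ball_pairing_def herm_form_def)
    then have "cmod (f g) = C / (cmod (herm_form z (ball_act g z)) * cmod (aut_factor g z)) ^ k"
      using C0 by (simp add: f_def norm_divide norm_mult norm_power power_mult_distrib)
    also have "cmod (herm_form z (ball_act g z)) * cmod (aut_factor g z) = q * disp g z"
      using q by (simp add: disp_altdef[OF gU z] q_def)
    finally show ?thesis by (simp add: power_mult_distrib)
  qed
  have "cmod (bergman_kernel \<B> z z) \<le> C / q ^ k * T"
  proof (rule Lim_norm_ubound[OF _ hs[unfolded has_sum_def]])
    show "\<forall>\<^sub>F A in finite_subsets_at_top \<Gamma>. norm (sum f A) \<le> C / q ^ k * T"
    proof (rule eventually_finite_subsets_at_top_weakI)
      fix A assume A: "finite A" "A \<subseteq> \<Gamma>"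
      have "norm (sum f A) \<le> (\<Sum>g\<in>A. cmod (f g))" by (rule norm_sum)
      also have "\<dots> = (\<Sum>g\<in>A. C / q ^ k * (1 / disp g z ^ k))" using A fg by (intro sum.cong) auto
      also have "\<dots> = C / q ^ k * (\<Sum>g\<in>A. 1 / disp g z ^ k)" by (rule sum_distrib_left[symmetric])
      also have "\<dots> \<le> C / q ^ k * T" using T[OF A] C0 q by (intro mult_left_mono) auto
      finally show "norm (sum f A) \<le> C / q ^ k * T" .
    qed
  qed simp
  then have "q ^ k * cmod (bergman_kernel \<B> z z) \<le> q ^ k * (C / q ^ k * T)"
    using q by (intro mult_left_mono) auto
  then show ?thesis using q by (simp add: bergman_pet_def q_def)
qed

text \<open>Since <g p, g' p> = <p, g^-1 g' p>, the separation required by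
  \<open>orbit_sum_bound\<close> is the displacement bound for g^-1 g', with a = r/4.\<close>

lemma disp_sum_bound:
  fixes \<Gamma> :: "('n::finite) cmat1 set"
  defines "n \<equiv> CARD('n)" and "r \<equiv> inj_radius \<Gamma>"
  assumes n: "n \<ge> 2" and \<Gamma>: "subgroup \<Gamma> SU_n1" and disc: "discrete \<Gamma>" and tf: "torsion_free \<Gamma>" and co: "cocompact \<Gamma>"
    and k: "k \<ge> 2 * n + 2" and z: "z \<in> unit_ball" and A: "finite A" "A \<subseteq> \<Gamma>"
  shows "(\<Sum>g\<in>A. 1 / disp g z ^ k) \<le> 1 + cosh (r / 4) ^ (2 * n) / ((real k - 2 * real n - 1) * sinh (r / 4) ^ (2 * n))
     + sinh (5 * r / 8) ^ (2 * n) / (sinh (r / 4) ^ (2 * n) * cosh (3 * r / 8) ^ k)" (is "_ \<le> 1 + ?E + ?D")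
proof -
  have U: "g \<in> U_n1" if "g \<in> \<Gamma>" for g using subgroup_subset_U_n1[OF \<Gamma>] that by blast
  define q where "q = 1 - (norm z)\<^sup>2"
  have q: "q > 0" using z by (simp add: q_def unit_ball_def)
  define c where "c = complex_of_real (1 / sqrt q)"
  define p where "p = c *s lift z"
  have cc: "c * cnj c = complex_of_real (1 / q)" using q by (simp add: c_def flip: of_real_mult)
  have hp: "hform p (g *v p) = complex_of_real (1 / q) * hform (lift z) (g *v lift z)" for g
    unfolding cc[symmetric] by (simp add: p_def hform_smult_left hform_smult_right vector_scalar_commute)
  have disp: "cmod (hform p (g *v p)) = disp g z" for g
    unfolding hp disp_def q_def[symmetric] using q by (simp add: norm_mult norm_divide)
  have qp: "qform p = 1"
  proof -
    have "complex_of_real (qform p) = 1" using hp[of "mat 1"] q by (simp add: hform_self qform_lift flip: q_def)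
    then show ?thesis by (simp only: of_real_eq_1_iff)
  qed
  show ?thesis
  proof (cases "\<Gamma> = {mat 1}")
    \<comment> \<open>Here \<open>inj_radius\<close> is the infimum of the empty set and nothing is
      known about r. The sum has at most one term, equal to 1, and the other two terms of the bound
      are nonnegative for every r because the exponents of sinh are even.\<close>
    case True
    have "disp (mat 1) z = 1" using disp[of "mat 1"] qp by (simp add: hform_self)
    then have "(\<Sum>g\<in>A. 1 / disp g z ^ k) \<le> 1" using A True by (cases "A = {}") (auto simp: subset_singleton_iff)
    moreover have "?E \<ge> 0" "?D \<ge> 0" using k by (simp_all add: power_mult)
    ultimately show ?thesis by linarith
  next
    case False
    have r0: "r > 0" unfolding r_def by (rule inj_radius_pos[OF \<Gamma> disc tf co False])
    have "(\<Sum>g\<in>A. 1 / cmod (hform p (g *v p)) ^ k)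
      \<le> 1 + cosh (r / 4) ^ (2 * CARD('n)) / ((real k - 2 * real CARD('n) - 1) * sinh (r / 4) ^ (2 * CARD('n)))
      + sinh (5 * (r / 4) / 2) ^ (2 * CARD('n)) / (sinh (r / 4) ^ (2 * CARD('n)) * cosh (3 * (r / 4) / 2) ^ k)"
    proof (rule orbit_sum_bound[OF qp A(1)])
      show "A \<subseteq> U_n1" using A U by blast
      fix g g' assume g: "g \<in> A" "g' \<in> A" "g \<noteq> g'"
      have gg: "g \<in> \<Gamma>" "g' \<in> \<Gamma>" using g A by auto
      obtain h where h: "h \<in> U_n1" "h ** g = mat 1" "g ** h = mat 1" "h = H_mat ** conj_transpose g ** H_mat"
        using U_n1_inverse[OF U[OF gg(1)]] by metis
      have h\<Gamma>: "h ** g' \<in> \<Gamma>" using subgroup_mult[OF \<Gamma> subgroup_inverse[OF \<Gamma> gg(1)] gg(2)] by (simp add: h(4))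
      have "h ** g' \<noteq> mat 1"
      proof
        assume "h ** g' = mat 1"
        then have "g ** (h ** g') = g" by simp
        then show False using g(3) h(3) by (simp add: matrix_mul_assoc)
      qed
      then have "cosh (r / 2) \<le> disp (h ** g') z"
        unfolding r_def using disp_ge_inj_radius[OF \<Gamma> disc tf co False _ z] h\<Gamma> by simp
      also have "\<dots> = cmod (hform p ((h ** g') *v p))" by (simp add: disp)
      also have "hform p ((h ** g') *v p) = hform (g *v p) (g *v ((h ** g') *v p))"
        by (simp add: hform_U_n1[OF U[OF gg(1)]])
      also have "g *v ((h ** g') *v p) = g' *v p"
        by (simp add: matrix_vector_mul_assoc matrix_mul_assoc h(3))
      finally show "cosh (2 * (r / 4)) \<le> cmod (hform (g *v p) (g' *v p))" by simp
    qed (use r0 n k in \<open>auto simp: n_def\<close>)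
    then show ?thesis by (simp add: disp n_def)
  qed
qed

theorem theorem4p2:
  fixes \<Gamma> :: "('n::finite) cmat1 set"
    and F :: "(complex ^ 'n) set"
    and \<B> :: "(complex ^ 'n \<Rightarrow> complex) set"
    and k :: nat and C :: real
  defines "n \<equiv> CARD('n)" and "r \<equiv> inj_radius \<Gamma>"
  assumes "n \<ge> 2"
    and "subgroup \<Gamma> SU_n1" and "discrete \<Gamma>" and "torsion_free \<Gamma>" and "cocompact \<Gamma>"
    and "k \<ge> 2 * n + 2"
    and "fundamental_domain \<Gamma> F"
    and "petersson_onb \<Gamma> F k \<B>"
    and "bergman_series_const \<Gamma> k \<B> C"
  shows "(SUP x\<in>X_quot \<Gamma>. SUP z\<in>x. ereal (bergman_pet \<B> k z))
    \<le> ereal (C + C * cosh (r / 4) ^ (2 * n) / ((real k - 2 * real n - 1) * sinh (r / 4) ^ (2 * n))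
               + C * sinh (5 * r / 8) ^ (2 * n) / (sinh (r / 4) ^ (2 * n) * cosh (3 * r / 8) ^ k))"
proof (intro SUP_least)
  fix x z assume x: "x \<in> X_quot \<Gamma>" and "z \<in> x"
  then obtain w g where w: "w \<in> unit_ball" "g \<in> \<Gamma>" "z = ball_act g w"
    by (auto simp: X_quot_def orbit_of_def)
  have z: "z \<in> unit_ball"
    unfolding w(3) using w subgroup_subset_U_n1[OF assms(4)] by (intro ball_act_unit_ball) auto
  have "bergman_pet \<B> k z \<le> C * (1 + cosh (r / 4) ^ (2 * n) / ((real k - 2 * real n - 1) * sinh (r / 4) ^ (2 * n))
     + sinh (5 * r / 8) ^ (2 * n) / (sinh (r / 4) ^ (2 * n) * cosh (3 * r / 8) ^ k))"
    by (rule bergman_pet_le[OF assms(4,11) z])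
      (use disp_sum_bound[OF assms(3-8)[unfolded n_def] z] in \<open>simp add: n_def r_def\<close>)
  then show "ereal (bergman_pet \<B> k z)
    \<le> ereal (C + C * cosh (r / 4) ^ (2 * n) / ((real k - 2 * real n - 1) * sinh (r / 4) ^ (2 * n))
               + C * sinh (5 * r / 8) ^ (2 * n) / (sinh (r / 4) ^ (2 * n) * cosh (3 * r / 8) ^ k))"
    by (simp add: distrib_left)
qed

end
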